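(* Let $\mathcal{C}$ be a category admitting pullbacks of split epimorphisms along split epimorphisms, and let $\mathcal{M}$ be a class of spans in $\mathcal{C}$ for which the box construction is defined. Assume further that $\mathcal{M}$ is closed under the kernel pair construction and contains the span part of every local product. Then the following conditions are equivalent: (A) The Lawvere condition holds in $\mathcal{C}$ with respect to $\mathcal{M}$, i.e. the forgetful functor $\mathbf{Grpd}(\mathcal{C},\mathcal{M})\to\mathbf{RG}(\mathcal{C},\mathcal{M})$ is an isomorphism of categories. (B) The forgetful functor $\mathbf{Grpd}(\mathcal{C},\mathcal{M})\to\mathbf{RG}(\mathcal{C},\mathcal{M})$ has a section. (C) The forgetful functor $\mathbf{Cat}(\mathcal{C},\mathcal{M})\to\mathbf{RG}(\mathcal{C},\mathcal{M})$ is an isomorphism. (D) The forgetful functor $\mathbf{Cat}(\mathcal{C},\mathcal{M})\to\mathbf{RG}(\mathcal{C},\mathcal{M})$ has a section. (E) The forgetful functor $\mathbf{MG}(\mathcal{C},\mathcal{M})\to\mathbf{RG}(\mathcal{C},\mathcal{M})$ is an isomorphism. (F) The forgetful functor $\mathbf{MG}(\mathcal{C},\mathcal{M})\to\mathbf{RG}(\mathcal{C},\mathcal{M})$ has a section. (G) For all morphisms $p_1\colon E\to A$, $e_1\colon A\to E$, $p_2\colon E\to C$, $e_2\colon C\to E$, $\alpha\colon A\to D$, $\gamma\colon C\to D$, $d\colon D\to D_0$, $c\colon D\to D_1$ in $\mathcal{C}$, if (a) $(p_1,p_2)$ is jointly monic; (b) the spans $(D,d,c)$ and $(E,p_1,p_2)$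 belong to $\mathcal{M}$; and (c) $p_1e_1=1_A$, $p_2e_2=1_C$, $(e_1p_1)(e_2p_2)=(e_2p_2)(e_1p_1)$, $\alpha p_1(e_2p_2)=\gamma p_2(e_1p_1)$, $d\alpha p_1=d\alpha p_1(e_2p_2)$, $c\gamma p_2=c\gamma p_2(e_1p_1)$; then there exists a unique morphism $m\colon E\to D$ such that $me_1=\alpha$, $me_2=\gamma$, $dm=d\gamma p_2$, $cm=c\alpha p_1$. (H) For all morphisms $f\colon A\to B$, $r\colon B\to A$, $g\colon C\to B$, $s\colon B\to C$, $\alpha\colon A\to D$, $\beta\colon B\to D$, $\gamma\colon C\to D$, $d\colon D\to D_0$, $c\colon D\to D_1$ in $\mathcal{C}$, if $fr=1_B=gs$, $\alpha r=\beta=\gamma s$, $d\alpha=d\beta f$, $c\beta g=c\gamma$ and $(D,d,c)\in\mathcal{M}$, then there exists a unique morphism $m\colon A\times_BC\to D$ such that $m\langle1_A,sf\rangle=\alpha$, $m\langle rg,1_C\rangle=\gamma$, $dm=d\gamma\pi_2$, $cm=c\alpha\pi_1$. (I) The forgetful functor $\mathbf{PseudoGrpd}(\mathcal{C},\mathcal{M})\to\mathbf{Span}(\mathcal{C},\mathcal{M})$ has a section, and, moreover, if $(D,d,c)$ is a span in $\mathcal{M}$ and $p_1\colon E\to A$, $e_1\colon A\to E$, $p_2\colon E\to C$, $e_2\colon C\to E$, $f\colon A\to B$, $r\colon B\to A$, $g\colon C\to B$, $s\colon B\to C$ form a commutative split square in $\mathcal{C}$, then for every morphism $m\colon E\to D$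 with $dm=dme_2p_2$ and $cm=cme_1p_1$ there exists a unique morphism $\overline{m}\colon A\times_BC\to D$ such that $$\overline{m}\langle1_A,sf\rangle=me_1,\quad \overline{m}\langle rg,1_C\rangle=me_2,\quad d\overline{m}=dme_2\pi_2,\quad c\overline{m}=cme_1\pi_1.$$ (J) Every span $(D,d,c)\in\mathcal{M}$ is equipped with a morphism $p_D\colon D(d,c)\to D$ such that, for any three parallel morphisms $x,y,z\colon Z\to D$ with $dx=dy$ and $cy=cz$, $dp_D\langle x,y,z\rangle=dz$, $cp_D\langle x,y,z\rangle=cx$, $p_D\langle x,y,y\rangle=x$, $p_D\langle y,y,z\rangle=z$, and moreover, for any $f\colon D\to D'$, $f_0\colon D_0\to D_0'$, $f_1\colon D_1\to D_1'$ with $d'f=f_0d$, $c'f=f_1c$ and $(D',d',c')\in\mathcal{M}$, one has $f\,p_D=p_{D'}\,(f\times_{f_0}f\times_{f_1}f)$. (K) The forgetful functor $\mathbf{PreGrpd}(\mathcal{C},\mathcal{M})\to\mathbf{Span}(\mathcal{C},\mathcal{M})$ is an isomorphism. (L) The forgetful functor $\mathbf{KockGrpd}(\mathcal{C},\mathcal{M})\to\mathbf{Span}(\mathcal{C},\mathcal{M})$ has a section. (M) The forgetful functor $\mathbf{KockGrpd}(\mathcal{C},\mathcal{M})\to\mathbf{Span}(\mathcal{C},\mathcal{M})$ is an isomorphism. (N) The forgetful functor $\mathbf{MKite}(\mathcal{C},\mathcal{M})\to\mathbf{DiKite}(\mathcal{C},\mathcal{M})$ has a section. (O) The forgetful functor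 $\mathbf{MKite}(\mathcal{C},\mathcal{M})\to\mathbf{DiKite}(\mathcal{C},\mathcal{M})$ is an isomorphism.
   Context: Spans. A span $(D,d,c)$ in $\mathcal{C}$ is a pair $d\colon D\to D_0$, $c\colon D\to D_1$ both admitting kernel pairs, $(d_1,d_2\colon D(d)\to D)$ and $(c_1,c_2\colon D(c)\to D)$. A morphism of spans $(D,d,c)\to(D',d',c')$ is $(f,f_0,f_1)$ with $d'f=f_0d$, $c'f=f_1c$. $\mathbf{Span}(\mathcal{C},\mathcal{M})$ is the category of spans in $\mathcal{M}$. Kernel pair construction. $D(d,c)$ is the pullback of $d_2\colon D(d)\to D$ and $c_1\colon D(c)\to D$; morphisms $Z\to D(d,c)$ are triples $\langle x,y,z\rangle$ of morphisms $Z\to D$ with $dx=dy$, $cy=cz$. $\mathrm{dom}\langle x,y,z\rangle=x$, $\mathrm{cod}\langle x,y,z\rangle=z$. $\mathcal{M}$ is closed under the kernel pair construction if $(D,d,c)\in\mathcal{M}$ implies $(D(d,c),\mathrm{dom},\mathrm{cod})\in\mathcal{M}$. $f\times_{f_0}f\times_{f_1}f$ sends $\langle x,y,z\rangle$ to $\langle fx,fy,fz\rangle$. Box construction. $(D,d,c)$ admits the box construction if there is an object $D(\square)$ with $q_1,q_2,q_3,q_4\colon D(\square)\to D$ universal with $dq_1=dq_2$, $cq_2=cq_3$, $dq_3=dq_4$, $cq_4=cq_1$; so morphisms $Z\to D(\square)$ are quadruples $\langle x,y,z,w\rangle$ of morphisms $Z\to D$ with $dx=dy$, $cy=cz$, $dz=dw$,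 $cw=cx$. It is moreover required that the canonical projection $D(\square)\to D(d,c)$, $\langle x,y,z,w\rangle\mapsto\langle x,y,z\rangle$, admits a kernel pair. The box construction is defined for $\mathcal{M}$ if this holds for every span in $\mathcal{M}$. Local product: $p_1\colon E\to A$, $e_1\colon A\to E$, $p_2\colon E\to C$, $e_2\colon C\to E$ for which there are $f\colon A\to B$, $r\colon B\to A$, $g\colon C\to B$, $s\colon B\to C$ with $fr=1_B=gs$ such that $(E,p_1,p_2)$ is the pullback of $f$ and $g$, $e_1=\langle1_A,sf\rangle$, $e_2=\langle rg,1_C\rangle$; its span part is $(E,p_1,p_2)$. Throughout $A\times_BC$ is the pullback of $f$ and $g$, with projections $\pi_1,\pi_2$. Commutative split square: morphisms $p_1\colon E\to A$, $e_1\colon A\to E$, $p_2\colon E\to C$, $e_2\colon C\to E$, $f\colon A\to B$, $r\colon B\to A$, $g\colon C\to B$, $s\colon B\to C$ such that $p_1e_1=1_A$, $p_2e_2=1_C$, $fr=1_B=gs$, $gp_2=fp_1$, $e_1r=e_2s$. Reflexive graph: $(C_1,C_0,d,e,c)$ with $de=1_{C_0}=ce$. Unital multiplicative graph: a reflexive graph with $m\colon C_1\times_{C_0}C_1\to C_1$ (pullback with $d\pi_1=c\pi_2$) such that $dm=d\pi_2$, $cm=c\pi_1$, $m\langle1,ed\rangle=1=m\langle ec,1\rangle$. Internal category: one with $m$ associative. Internal groupoid: an internal category with $i\colon C_1\to C_1$, $m\langle1,i\rangle=ec$, $m\langle i,1\rangle=ed$ (in particular $di=c$, $ci=d$). $\mathbf{RG}$,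 $\mathbf{MG}$, $\mathbf{Cat}$, $\mathbf{Grpd}(\mathcal{C},\mathcal{M})$: the corresponding categories of structures whose span part $(C_1,d,c)$ is in $\mathcal{M}$, with structure-preserving morphisms. Pregroupoid $(D,d,c,p)$: a span with $p\colon D(d,c)\to D$ satisfying $p\langle x,y,y\rangle=x$, $p\langle y,y,z\rangle=z$, $dp\langle x,y,z\rangle=dz$, $cp\langle x,y,z\rangle=cx$. Kock pregroupoid: a pregroupoid with $p\langle u,v,p\langle x,y,z\rangle\rangle=p\langle p\langle u,v,x\rangle,y,z\rangle$ whenever $du=dv$, $cv=cx$, $dx=dy$, $cy=cz$. Pseudogroupoid: a span admitting the box construction with $m\colon D(\square)\to D$ such that $m\langle x,y,y,x\rangle=x$, $m\langle y,y,z,z\rangle=z$, $dm\langle x,y,z,w\rangle=dz$, $cm\langle x,y,z,w\rangle=cx$, $m\langle x,y,z,w\rangle=m\langle x,y,z,w'\rangle$ (whenever the quadruples are defined). $\mathbf{PreGrpd}$, $\mathbf{KockGrpd}$, $\mathbf{PseudoGrpd}(\mathcal{C},\mathcal{M})$: the categories of such structures with span in $\mathcal{M}$; morphisms are span morphisms commuting with $p$ (resp. $m$). Directed kite (dikite): morphisms $f\colon A\to B$, $r\colon B\to A$, $g\colon C\to B$, $s\colon B\to C$ with $fr=1_B=gs$, $\alpha\colon A\to D$, $\beta\colon B\to D$, $\gamma\colon C\to D$ and a span $(D,d,c)$ (its direction) with $\alpha r=\beta=\gamma s$, $d\alpha=d\beta f$, $c\beta g=c\gamma$. A multiplication on it is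 $m\colon A\times_BC\to D$ with $m\langle1_A,sf\rangle=\alpha$, $m\langle rg,1_C\rangle=\gamma$, $dm=d\gamma\pi_2$, $cm=c\alpha\pi_1$. $\mathbf{DiKite}(\mathcal{C},\mathcal{M})$: dikites with direction in $\mathcal{M}$, morphisms being natural transformations $(h_A,h_B,h_C,h_D,h_0,h_1)$ of such diagrams. $\mathbf{MKite}(\mathcal{C},\mathcal{M})$: dikites in $\mathbf{DiKite}(\mathcal{C},\mathcal{M})$ equipped with a multiplication, morphisms being those with $h_Dm=m'(h_A\times_{h_B}h_C)$. A section of a functor $F$ is a functor $S$ with $FS$ the identity.
   Formalization: In (I), a commutative split square is also required to satisfy p_2e_1 = sf and p_1e_2 = rg; without these, (I) fails in abelian groups with all spans (B=0, A=C=Z, E=Z^2, e_1(a)=(a,a), e_2(c)=(0,c)), although (J) holds there. *)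

theory Defs
  imports Main
begin

section \<open>Categories and functors\<close>

record ('o, 'm) cat =
  Obj :: "'o set"
  Arr :: "'m set"
  Dom :: "'m \<Rightarrow> 'o"
  Cod :: "'m \<Rightarrow> 'o"
  Ident :: "'o \<Rightarrow> 'm"
  Comp :: "'m \<Rightarrow> 'm \<Rightarrow> 'm"  (infixl "\<cdot>\<index>" 70)

definition Hom :: "('o, 'm, 'x) cat_scheme \<Rightarrow> 'o \<Rightarrow> 'o \<Rightarrow> 'm set" where
  "Hom \<C> X Y = {f \<in> Arr \<C>. Dom \<C> f = X \<and> Cod \<C> f = Y}"

locale category =
  fixes \<C> :: "('o, 'm, 'x) cat_scheme" (structure)
  assumes Dom_closed: "f \<in> Arr \<C> \<Longrightarrow> Dom \<C> f \<in> Obj \<C>"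
    and Cod_closed: "f \<in> Arr \<C> \<Longrightarrow> Cod \<C> f \<in> Obj \<C>"
    and Ident_closed: "X \<in> Obj \<C> \<Longrightarrow> Ident \<C> X \<in> Hom \<C> X X"
    and Comp_closed: "f \<in> Hom \<C> X Y \<Longrightarrow> g \<in> Hom \<C> Y Z \<Longrightarrow> g \<cdot> f \<in> Hom \<C> X Z"
    and Ident_right: "f \<in> Hom \<C> X Y \<Longrightarrow> f \<cdot> Ident \<C> X = f"
    and Ident_left: "f \<in> Hom \<C> X Y \<Longrightarrow> Ident \<C> Y \<cdot> f = f"
    and Comp_assoc: "f \<in> Hom \<C> X Y \<Longrightarrow> g \<in> Hom \<C> Y Z \<Longrightarrow> h \<in> Hom \<C> Z W \<Longrightarrow>
      h \<cdot> (g \<cdot> f) = (h \<cdot> g) \<cdot> f"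

type_synonym ('o, 'm, 'p, 'n) func = "('o \<Rightarrow> 'p) \<times> ('m \<Rightarrow> 'n)"

definition is_functor ::
  "('o, 'm, 'x) cat_scheme \<Rightarrow> ('p, 'n, 'y) cat_scheme \<Rightarrow> ('o, 'm, 'p, 'n) func \<Rightarrow> bool" where
  "is_functor A B F \<longleftrightarrow>
    (\<forall>X \<in> Obj A. fst F X \<in> Obj B) \<and>
    (\<forall>f \<in> Arr A. snd F f \<in> Hom B (fst F (Dom A f)) (fst F (Cod A f))) \<and>
    (\<forall>X \<in> Obj A. snd F (Ident A X) = Ident B (fst F X)) \<and>
    (\<forall>f \<in> Arr A. \<forall>g \<in> Arr A. Cod A f = Dom A g \<longrightarrow>
      snd F (g \<cdot>\<^bsub>A\<^esub> f) = snd F g \<cdot>\<^bsub>B\<^esub> snd F f)"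

definition has_section ::
  "('o, 'm, 'x) cat_scheme \<Rightarrow> ('p, 'n, 'y) cat_scheme \<Rightarrow> ('o, 'm, 'p, 'n) func \<Rightarrow> bool" where
  "has_section A B F \<longleftrightarrow> is_functor A B F \<and>
    (\<exists>S. is_functor B A S \<and>
      (\<forall>Y \<in> Obj B. fst F (fst S Y) = Y) \<and> (\<forall>g \<in> Arr B. snd F (snd S g) = g))"

definition is_cat_iso ::
  "('o, 'm, 'x) cat_scheme \<Rightarrow> ('p, 'n, 'y) cat_scheme \<Rightarrow> ('o, 'm, 'p, 'n) func \<Rightarrow> bool" where
  "is_cat_iso A B F \<longleftrightarrow> is_functor A B F \<and>
    (\<exists>G. is_functor B A G \<and>
      (\<forall>X \<in> Obj A. fst G (fst F X) = X) \<and> (\<forall>f \<in> Arr A. snd G (snd F f) = f) \<and>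
      (\<forall>Y \<in> Obj B. fst F (fst G Y) = Y) \<and> (\<forall>g \<in> Arr B. snd F (snd G g) = g))"

text \<open>
  Categories of structures: a morphism is a triple (source, target, tuple of components).
  The arguments are the structures, the morphisms between two of them, the components of the
  identities, and the composition of component tuples.
\<close>

definition structure_cat ::
  "'s set \<Rightarrow> ('s \<Rightarrow> 's \<Rightarrow> 'k set) \<Rightarrow> ('s \<Rightarrow> 'k) \<Rightarrow> ('k \<Rightarrow> 'k \<Rightarrow> 'k) \<Rightarrow> ('s, 's \<times> 's \<times> 'k) cat"
  where
  "structure_cat S H i cmp = \<lparr>
    Obj = S,
    Arr = {(X, Y, h). X \<in> S \<and> Y \<in> S \<and> h \<in> H X Y},
    Dom = (\<lambda>(X, Y, h). X),
    Cod = (\<lambda>(X, Y, h). Y),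
    Ident = (\<lambda>X. (X, X, i X)),
    Comp = (\<lambda>(Y', Z, k) (X, Y, h). (X, Z, cmp k h))\<rparr>"

text \<open>
  A structured object is encoded as a pair of the underlying object and the additional data, and
  a morphism has the same components as its underlying morphism.  Hence all the forgetful
  functors below are given by the same formula.
\<close>

definition forgetful ::
  "('b \<times> 'e, ('b \<times> 'e) \<times> ('b \<times> 'e) \<times> 'k, 'b, 'b \<times> 'b \<times> 'k) func" where
  "forgetful = (fst, \<lambda>(X, Y, h). (fst X, fst Y, h))"


section \<open>Limits\<close>

text \<open>
  The pullback of \<open>f\<close> and \<open>g\<close> (denoted by the apex \<open>A \<times>\<^sub>B C\<close>) and the object carrying the box
  construction are only determined up to isomorphism, whereas structures such as
  \<open>m : A \<times>\<^sub>B C \<rightarrow> D\<close> refer to fixed ones.  So the category carries a choice of these limits: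
  \<open>Pb f g\<close> is the pair of projections, \<open>Box d c\<close> the quadruple of projections.  Nothing is
  assumed about the choice except that it is a limit whenever one exists.
\<close>

record ('o, 'm) lim_cat = "('o, 'm) cat" +
  Pb :: "'m \<Rightarrow> 'm \<Rightarrow> 'm \<times> 'm"
  Box :: "'m \<Rightarrow> 'm \<Rightarrow> 'm \<times> 'm \<times> 'm \<times> 'm"

context
  fixes \<C> :: "('o, 'm) lim_cat" (structure)
begin

definition is_pullback :: "'m \<Rightarrow> 'm \<Rightarrow> 'm \<Rightarrow> 'm \<Rightarrow> bool" where
  "is_pullback f g p q \<longleftrightarrow>
    (\<exists>A B C P. f \<in> Hom \<C> A B \<and> g \<in> Hom \<C> C B \<and> p \<in> Hom \<C> P A \<and> q \<in> Hom \<C> P C \<and>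
      f \<cdot> p = g \<cdot> q \<and>
      (\<forall>Z. \<forall>x \<in> Hom \<C> Z A. \<forall>y \<in> Hom \<C> Z C. f \<cdot> x = g \<cdot> y \<longrightarrow>
        (\<exists>!h. h \<in> Hom \<C> Z P \<and> p \<cdot> h = x \<and> q \<cdot> h = y)))"

definition is_box :: "'m \<Rightarrow> 'm \<Rightarrow> 'm \<times> 'm \<times> 'm \<times> 'm \<Rightarrow> bool" where
  "is_box d c = (\<lambda>(q1, q2, q3, q4).
    \<exists>D D0 D1 Q. d \<in> Hom \<C> D D0 \<and> c \<in> Hom \<C> D D1 \<and>
      q1 \<in> Hom \<C> Q D \<and> q2 \<in> Hom \<C> Q D \<and> q3 \<in> Hom \<C> Q D \<and> q4 \<in> Hom \<C> Q D \<and>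
      d \<cdot> q1 = d \<cdot> q2 \<and> c \<cdot> q2 = c \<cdot> q3 \<and> d \<cdot> q3 = d \<cdot> q4 \<and> c \<cdot> q4 = c \<cdot> q1 \<and>
      (\<forall>Z. \<forall>x \<in> Hom \<C> Z D. \<forall>y \<in> Hom \<C> Z D. \<forall>z \<in> Hom \<C> Z D. \<forall>w \<in> Hom \<C> Z D.
        d \<cdot> x = d \<cdot> y \<and> c \<cdot> y = c \<cdot> z \<and> d \<cdot> z = d \<cdot> w \<and> c \<cdot> w = c \<cdot> x \<longrightarrow>
        (\<exists>!h. h \<in> Hom \<C> Z Q \<and> q1 \<cdot> h = x \<and> q2 \<cdot> h = y \<and> q3 \<cdot> h = z \<and> q4 \<cdot> h = w)))"

definition chosen_limits :: bool where
  "chosen_limits \<longleftrightarrow>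
    (\<forall>f g. (\<exists>p q. is_pullback f g p q) \<longrightarrow> is_pullback f g (fst (Pb \<C> f g)) (snd (Pb \<C> f g))) \<and>
    (\<forall>d c. (\<exists>q. is_box d c q) \<longrightarrow> is_box d c (Box \<C> d c))"

definition split_epi :: "'m \<Rightarrow> bool" where
  "split_epi f \<longleftrightarrow> (\<exists>A B. f \<in> Hom \<C> A B \<and> (\<exists>r \<in> Hom \<C> B A. f \<cdot> r = Ident \<C> B))"

definition pullbacks_of_split_epis_along_split_epis :: bool where
  "pullbacks_of_split_epis_along_split_epis \<longleftrightarrow>
    (\<forall>f g. split_epi f \<and> split_epi g \<and> Cod \<C> f = Cod \<C> g \<longrightarrow> (\<exists>p q. is_pullback f g p q))"

definition admits_kernel_pair :: "'m \<Rightarrow> bool" where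
  "admits_kernel_pair f \<longleftrightarrow> (\<exists>p q. is_pullback f f p q)"

text \<open>The morphism \<open>\<langle>x, y\<rangle>\<close> into a pullback with projections \<open>p\<close> and \<open>q\<close>:\<close>

definition pairing :: "'m \<Rightarrow> 'm \<Rightarrow> 'm \<Rightarrow> 'm \<Rightarrow> 'm" where
  "pairing p q x y = (THE h. h \<in> Hom \<C> (Dom \<C> x) (Dom \<C> p) \<and> p \<cdot> h = x \<and> q \<cdot> h = y)"

definition pi1 :: "'m \<Rightarrow> 'm \<Rightarrow> 'm" where "pi1 f g = fst (Pb \<C> f g)"
definition pi2 :: "'m \<Rightarrow> 'm \<Rightarrow> 'm" where "pi2 f g = snd (Pb \<C> f g)"
definition pb :: "'m \<Rightarrow> 'm \<Rightarrow> 'o" where "pb f g = Dom \<C> (pi1 f g)"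

definition tup :: "'m \<Rightarrow> 'm \<Rightarrow> 'm \<Rightarrow> 'm \<Rightarrow> 'm" where
  "tup f g x y = pairing (pi1 f g) (pi2 f g) x y"

text \<open>The morphism \<open>h \<times> k\<close> from the pullback of \<open>f, g\<close> to that of \<open>f', g'\<close>:\<close>

definition pb_map :: "'m \<Rightarrow> 'm \<Rightarrow> 'm \<Rightarrow> 'm \<Rightarrow> 'm \<Rightarrow> 'm \<Rightarrow> 'm" where
  "pb_map f g f' g' h k = tup f' g' (h \<cdot> pi1 f g) (k \<cdot> pi2 f g)"


section \<open>Spans, the kernel pair construction and the box construction\<close>

text \<open>A span \<open>(D, d, c)\<close> is encoded as \<open>(d, c)\<close>, its vertex being the domain of \<open>d\<close>.\<close>

definition is_span :: "'m \<times> 'm \<Rightarrow> bool" where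
  "is_span = (\<lambda>(d, c). (\<exists>D D0 D1. d \<in> Hom \<C> D D0 \<and> c \<in> Hom \<C> D D1) \<and>
    admits_kernel_pair d \<and> admits_kernel_pair c)"

definition span_homs :: "'m \<times> 'm \<Rightarrow> 'm \<times> 'm \<Rightarrow> ('m \<times> 'm \<times> 'm) set" where
  "span_homs = (\<lambda>(d, c) (d', c'). {(f, f0, f1).
    f \<in> Hom \<C> (Dom \<C> d) (Dom \<C> d') \<and> f0 \<in> Hom \<C> (Cod \<C> d) (Cod \<C> d') \<and>
    f1 \<in> Hom \<C> (Cod \<C> c) (Cod \<C> c') \<and> d' \<cdot> f = f0 \<cdot> d \<and> c' \<cdot> f = f1 \<cdot> c})"

text \<open>
  \<open>kpc d c\<close> is the object \<open>D(d,c)\<close>, the pullback of \<open>d\<^sub>2 : D(d) \<rightarrow> D\<close> and \<open>c\<^sub>1 : D(c) \<rightarrow> D\<close>; the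
  projections \<open>kpc_dom\<close>, \<open>kpc_mid\<close>, \<open>kpc_cod\<close> send \<open>\<langle>x, y, z\<rangle>\<close> to \<open>x\<close>, \<open>y\<close>, \<open>z\<close>.
\<close>

definition kpc :: "'m \<Rightarrow> 'm \<Rightarrow> 'o" where "kpc d c = pb (pi2 d d) (pi1 c c)"

definition kpc_dom :: "'m \<Rightarrow> 'm \<Rightarrow> 'm" where
  "kpc_dom d c = pi1 d d \<cdot> pi1 (pi2 d d) (pi1 c c)"

definition kpc_mid :: "'m \<Rightarrow> 'm \<Rightarrow> 'm" where
  "kpc_mid d c = pi2 d d \<cdot> pi1 (pi2 d d) (pi1 c c)"

definition kpc_cod :: "'m \<Rightarrow> 'm \<Rightarrow> 'm" where
  "kpc_cod d c = pi2 c c \<cdot> pi2 (pi2 d d) (pi1 c c)"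

definition triple :: "'m \<Rightarrow> 'm \<Rightarrow> 'm \<Rightarrow> 'm \<Rightarrow> 'm \<Rightarrow> 'm" where
  "triple d c x y z = tup (pi2 d d) (pi1 c c) (tup d d x y) (tup c c y z)"

text \<open>The morphism \<open>f \<times> f \<times> f : D(d,c) \<rightarrow> D'(d',c')\<close> induced by a span morphism \<open>(f, f\<^sub>0, f\<^sub>1)\<close>:\<close>

definition kpc_map :: "'m \<times> 'm \<Rightarrow> 'm \<times> 'm \<Rightarrow> 'm \<Rightarrow> 'm" where
  "kpc_map = (\<lambda>(d, c) (d', c') f.
    triple d' c' (f \<cdot> kpc_dom d c) (f \<cdot> kpc_mid d c) (f \<cdot> kpc_cod d c))"

definition box1 :: "'m \<Rightarrow> 'm \<Rightarrow> 'm" where "box1 d c = fst (Box \<C> d c)"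
definition box2 :: "'m \<Rightarrow> 'm \<Rightarrow> 'm" where "box2 d c = fst (snd (Box \<C> d c))"
definition box3 :: "'m \<Rightarrow> 'm \<Rightarrow> 'm" where "box3 d c = fst (snd (snd (Box \<C> d c)))"
definition box4 :: "'m \<Rightarrow> 'm \<Rightarrow> 'm" where "box4 d c = snd (snd (snd (Box \<C> d c)))"
definition box_obj :: "'m \<Rightarrow> 'm \<Rightarrow> 'o" where "box_obj d c = Dom \<C> (box1 d c)"

definition quad :: "'m \<Rightarrow> 'm \<Rightarrow> 'm \<Rightarrow> 'm \<Rightarrow> 'm \<Rightarrow> 'm \<Rightarrow> 'm" where
  "quad d c x y z w = (THE h. h \<in> Hom \<C> (Dom \<C> x) (box_obj d c) \<and>
    box1 d c \<cdot> h = x \<and> box2 d c \<cdot> h = y \<and> box3 d c \<cdot> h = z \<and> box4 d c \<cdot> h = w)"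

definition box_map :: "'m \<times> 'm \<Rightarrow> 'm \<times> 'm \<Rightarrow> 'm \<Rightarrow> 'm" where
  "box_map = (\<lambda>(d, c) (d', c') f.
    quad d' c' (f \<cdot> box1 d c) (f \<cdot> box2 d c) (f \<cdot> box3 d c) (f \<cdot> box4 d c))"

definition admits_box :: "'m \<times> 'm \<Rightarrow> bool" where
  "admits_box = (\<lambda>(d, c). (\<exists>q. is_box d c q) \<and>
    admits_kernel_pair (triple d c (box1 d c) (box2 d c) (box3 d c)))"

definition local_product :: "'m \<Rightarrow> 'm \<Rightarrow> 'm \<Rightarrow> 'm \<Rightarrow> bool" where
  "local_product p1 e1 p2 e2 \<longleftrightarrow>
    (\<exists>A B C E f r g s. p1 \<in> Hom \<C> E A \<and> e1 \<in> Hom \<C> A E \<and> p2 \<in> Hom \<C> E C \<and> e2 \<in> Hom \<C> C E \<and>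
      f \<in> Hom \<C> A B \<and> r \<in> Hom \<C> B A \<and> g \<in> Hom \<C> C B \<and> s \<in> Hom \<C> B C \<and>
      f \<cdot> r = Ident \<C> B \<and> g \<cdot> s = Ident \<C> B \<and> is_pullback f g p1 p2 \<and>
      e1 = pairing p1 p2 (Ident \<C> A) (s \<cdot> f) \<and> e2 = pairing p1 p2 (r \<cdot> g) (Ident \<C> C))"

text \<open>
  The last two equations express that the square commutes also when the projections in one
  direction are combined with the sections in the other, that is, that it is a square of split
  epimorphisms.  They do not follow from the others, and without them condition \<open>split_square_condition\<close>
  below fails even for the class of all spans of abelian groups.
\<close>

definition commutative_split_square ::
  "'m \<Rightarrow> 'm \<Rightarrow> 'm \<Rightarrow> 'm \<Rightarrow> 'm \<Rightarrow> 'm \<Rightarrow> 'm \<Rightarrow> 'm \<Rightarrow> bool" where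
  "commutative_split_square p1 e1 p2 e2 f r g s \<longleftrightarrow>
    (\<exists>A B C E. p1 \<in> Hom \<C> E A \<and> e1 \<in> Hom \<C> A E \<and> p2 \<in> Hom \<C> E C \<and> e2 \<in> Hom \<C> C E \<and>
      f \<in> Hom \<C> A B \<and> r \<in> Hom \<C> B A \<and> g \<in> Hom \<C> C B \<and> s \<in> Hom \<C> B C \<and>
      p1 \<cdot> e1 = Ident \<C> A \<and> p2 \<cdot> e2 = Ident \<C> C \<and>
      f \<cdot> r = Ident \<C> B \<and> g \<cdot> s = Ident \<C> B \<and>
      g \<cdot> p2 = f \<cdot> p1 \<and> e1 \<cdot> r = e2 \<cdot> s \<and>
      p2 \<cdot> e1 = s \<cdot> f \<and> p1 \<cdot> e2 = r \<cdot> g)"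

definition jointly_monic :: "'m \<Rightarrow> 'm \<Rightarrow> bool" where
  "jointly_monic p q \<longleftrightarrow>
    (\<forall>Z. \<forall>h \<in> Hom \<C> Z (Dom \<C> p). \<forall>k \<in> Hom \<C> Z (Dom \<C> p).
      p \<cdot> h = p \<cdot> k \<and> q \<cdot> h = q \<cdot> k \<longrightarrow> h = k)"


section \<open>Reflexive graphs, multiplicative graphs, internal categories and groupoids\<close>

text \<open>
  A reflexive graph \<open>(C\<^sub>1, C\<^sub>0, d, e, c)\<close> is encoded as \<open>(d, e, c)\<close>; multiplicative graphs and internal
  categories are pairs \<open>((d, e, c), m)\<close>, and internal groupoids are \<open>((d, e, c), m, i)\<close>.
\<close>

definition is_reflexive_graph :: "'m \<times> 'm \<times> 'm \<Rightarrow> bool" where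
  "is_reflexive_graph = (\<lambda>(d, e, c).
    \<exists>C1 C0. d \<in> Hom \<C> C1 C0 \<and> e \<in> Hom \<C> C0 C1 \<and> c \<in> Hom \<C> C1 C0 \<and>
      d \<cdot> e = Ident \<C> C0 \<and> c \<cdot> e = Ident \<C> C0)"

definition reflexive_graph_homs :: "'m \<times> 'm \<times> 'm \<Rightarrow> 'm \<times> 'm \<times> 'm \<Rightarrow> ('m \<times> 'm) set" where
  "reflexive_graph_homs = (\<lambda>(d, e, c) (d', e', c'). {(h1, h0).
    h1 \<in> Hom \<C> (Dom \<C> d) (Dom \<C> d') \<and> h0 \<in> Hom \<C> (Cod \<C> d) (Cod \<C> d') \<and>
    d' \<cdot> h1 = h0 \<cdot> d \<and> c' \<cdot> h1 = h0 \<cdot> c \<and> h1 \<cdot> e = e' \<cdot> h0})"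

definition is_multiplicative_graph :: "('m \<times> 'm \<times> 'm) \<times> 'm \<Rightarrow> bool" where
  "is_multiplicative_graph = (\<lambda>((d, e, c), m).
    is_reflexive_graph (d, e, c) \<and> m \<in> Hom \<C> (pb d c) (Dom \<C> d) \<and>
    d \<cdot> m = d \<cdot> pi2 d c \<and> c \<cdot> m = c \<cdot> pi1 d c \<and>
    m \<cdot> tup d c (Ident \<C> (Dom \<C> d)) (e \<cdot> d) = Ident \<C> (Dom \<C> d) \<and>
    m \<cdot> tup d c (e \<cdot> c) (Ident \<C> (Dom \<C> d)) = Ident \<C> (Dom \<C> d))"

definition multiplicative_graph_homs ::
  "('m \<times> 'm \<times> 'm) \<times> 'm \<Rightarrow> ('m \<times> 'm \<times> 'm) \<times> 'm \<Rightarrow> ('m \<times> 'm) set" where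
  "multiplicative_graph_homs = (\<lambda>((d, e, c), m) ((d', e', c'), m'). {(h1, h0).
    (h1, h0) \<in> reflexive_graph_homs (d, e, c) (d', e', c') \<and>
    h1 \<cdot> m = m' \<cdot> pb_map d c d' c' h1 h1})"

definition is_internal_category :: "('m \<times> 'm \<times> 'm) \<times> 'm \<Rightarrow> bool" where
  "is_internal_category = (\<lambda>((d, e, c), m).
    is_multiplicative_graph ((d, e, c), m) \<and>
    (\<forall>Z. \<forall>x \<in> Hom \<C> Z (Dom \<C> d). \<forall>y \<in> Hom \<C> Z (Dom \<C> d). \<forall>z \<in> Hom \<C> Z (Dom \<C> d).
      d \<cdot> x = c \<cdot> y \<and> d \<cdot> y = c \<cdot> z \<longrightarrow>
      m \<cdot> tup d c (m \<cdot> tup d c x y) z = m \<cdot> tup d c x (m \<cdot> tup d c y z)))"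

definition is_internal_groupoid :: "('m \<times> 'm \<times> 'm) \<times> 'm \<times> 'm \<Rightarrow> bool" where
  "is_internal_groupoid = (\<lambda>((d, e, c), m, i).
    is_internal_category ((d, e, c), m) \<and> i \<in> Hom \<C> (Dom \<C> d) (Dom \<C> d) \<and>
    d \<cdot> i = c \<and> c \<cdot> i = d \<and>
    m \<cdot> tup d c (Ident \<C> (Dom \<C> d)) i = e \<cdot> c \<and>
    m \<cdot> tup d c i (Ident \<C> (Dom \<C> d)) = e \<cdot> d)"

definition internal_groupoid_homs ::
  "('m \<times> 'm \<times> 'm) \<times> 'm \<times> 'm \<Rightarrow> ('m \<times> 'm \<times> 'm) \<times> 'm \<times> 'm \<Rightarrow> ('m \<times> 'm) set" where
  "internal_groupoid_homs = (\<lambda>(G, m, i) (G', m', i'). {(h1, h0).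
    (h1, h0) \<in> multiplicative_graph_homs (G, m) (G', m') \<and> h1 \<cdot> i = i' \<cdot> h1})"


section \<open>Pregroupoids, Kock pregroupoids and pseudogroupoids\<close>

definition is_pregroupoid :: "('m \<times> 'm) \<times> 'm \<Rightarrow> bool" where
  "is_pregroupoid = (\<lambda>((d, c), p).
    is_span (d, c) \<and> p \<in> Hom \<C> (kpc d c) (Dom \<C> d) \<and>
    (\<forall>Z. \<forall>x \<in> Hom \<C> Z (Dom \<C> d). \<forall>y \<in> Hom \<C> Z (Dom \<C> d).
      d \<cdot> x = d \<cdot> y \<longrightarrow> p \<cdot> triple d c x y y = x) \<and>
    (\<forall>Z. \<forall>y \<in> Hom \<C> Z (Dom \<C> d). \<forall>z \<in> Hom \<C> Z (Dom \<C> d).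
      c \<cdot> y = c \<cdot> z \<longrightarrow> p \<cdot> triple d c y y z = z) \<and>
    (\<forall>Z. \<forall>x \<in> Hom \<C> Z (Dom \<C> d). \<forall>y \<in> Hom \<C> Z (Dom \<C> d). \<forall>z \<in> Hom \<C> Z (Dom \<C> d).
      d \<cdot> x = d \<cdot> y \<and> c \<cdot> y = c \<cdot> z \<longrightarrow>
      d \<cdot> (p \<cdot> triple d c x y z) = d \<cdot> z \<and> c \<cdot> (p \<cdot> triple d c x y z) = c \<cdot> x))"

definition is_kock_pregroupoid :: "('m \<times> 'm) \<times> 'm \<Rightarrow> bool" where
  "is_kock_pregroupoid = (\<lambda>((d, c), p).
    is_pregroupoid ((d, c), p) \<and>
    (\<forall>Z. \<forall>u \<in> Hom \<C> Z (Dom \<C> d). \<forall>v \<in> Hom \<C> Z (Dom \<C> d). \<forall>x \<in> Hom \<C> Z (Dom \<C> d).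
      \<forall>y \<in> Hom \<C> Z (Dom \<C> d). \<forall>z \<in> Hom \<C> Z (Dom \<C> d).
      d \<cdot> u = d \<cdot> v \<and> c \<cdot> v = c \<cdot> x \<and> d \<cdot> x = d \<cdot> y \<and> c \<cdot> y = c \<cdot> z \<longrightarrow>
      p \<cdot> triple d c u v (p \<cdot> triple d c x y z) = p \<cdot> triple d c (p \<cdot> triple d c u v x) y z))"

definition pregroupoid_homs ::
  "('m \<times> 'm) \<times> 'm \<Rightarrow> ('m \<times> 'm) \<times> 'm \<Rightarrow> ('m \<times> 'm \<times> 'm) set" where
  "pregroupoid_homs = (\<lambda>(S, p) (S', p'). {(f, f0, f1).
    (f, f0, f1) \<in> span_homs S S' \<and> f \<cdot> p = p' \<cdot> kpc_map S S' f})"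

definition is_pseudogroupoid :: "('m \<times> 'm) \<times> 'm \<Rightarrow> bool" where
  "is_pseudogroupoid = (\<lambda>((d, c), m).
    is_span (d, c) \<and> admits_box (d, c) \<and> m \<in> Hom \<C> (box_obj d c) (Dom \<C> d) \<and>
    (\<forall>Z. \<forall>x \<in> Hom \<C> Z (Dom \<C> d). \<forall>y \<in> Hom \<C> Z (Dom \<C> d).
      d \<cdot> x = d \<cdot> y \<longrightarrow> m \<cdot> quad d c x y y x = x) \<and>
    (\<forall>Z. \<forall>y \<in> Hom \<C> Z (Dom \<C> d). \<forall>z \<in> Hom \<C> Z (Dom \<C> d).
      c \<cdot> y = c \<cdot> z \<longrightarrow> m \<cdot> quad d c y y z z = z) \<and>
    (\<forall>Z. \<forall>x \<in> Hom \<C> Z (Dom \<C> d). \<forall>y \<in> Hom \<C> Z (Dom \<C> d). \<forall>z \<in> Hom \<C> Z (Dom \<C> d).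
      \<forall>w \<in> Hom \<C> Z (Dom \<C> d).
      d \<cdot> x = d \<cdot> y \<and> c \<cdot> y = c \<cdot> z \<and> d \<cdot> z = d \<cdot> w \<and> c \<cdot> w = c \<cdot> x \<longrightarrow>
      d \<cdot> (m \<cdot> quad d c x y z w) = d \<cdot> z \<and> c \<cdot> (m \<cdot> quad d c x y z w) = c \<cdot> x) \<and>
    (\<forall>Z. \<forall>x \<in> Hom \<C> Z (Dom \<C> d). \<forall>y \<in> Hom \<C> Z (Dom \<C> d). \<forall>z \<in> Hom \<C> Z (Dom \<C> d).
      \<forall>w \<in> Hom \<C> Z (Dom \<C> d). \<forall>w' \<in> Hom \<C> Z (Dom \<C> d).
      d \<cdot> x = d \<cdot> y \<and> c \<cdot> y = c \<cdot> z \<and> d \<cdot> z = d \<cdot> w \<and> c \<cdot> w = c \<cdot> x \<and>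
      d \<cdot> z = d \<cdot> w' \<and> c \<cdot> w' = c \<cdot> x \<longrightarrow>
      m \<cdot> quad d c x y z w = m \<cdot> quad d c x y z w'))"

definition pseudogroupoid_homs ::
  "('m \<times> 'm) \<times> 'm \<Rightarrow> ('m \<times> 'm) \<times> 'm \<Rightarrow> ('m \<times> 'm \<times> 'm) set" where
  "pseudogroupoid_homs = (\<lambda>(S, m) (S', m'). {(f, f0, f1).
    (f, f0, f1) \<in> span_homs S S' \<and> f \<cdot> m = m' \<cdot> box_map S S' f})"

end


section \<open>Directed kites\<close>

text \<open>
  A dikite is the tuple \<open>(f, r, g, s, \<alpha>, \<beta>, \<gamma>, d, c)\<close>; a dikite with multiplication is a pair of a
  dikite and a morphism \<open>m\<close>.
\<close>

type_synonym 'm kite = "'m \<times> 'm \<times> 'm \<times> 'm \<times> 'm \<times> 'm \<times> 'm \<times> 'm \<times> 'm"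

context
  fixes \<C> :: "('o, 'm) lim_cat" (structure)
begin

definition direction :: "'m kite \<Rightarrow> 'm \<times> 'm" where
  "direction = (\<lambda>(f, r, g, s, \<alpha>, \<beta>, \<gamma>, d, c). (d, c))"

definition is_dikite :: "'m kite \<Rightarrow> bool" where
  "is_dikite = (\<lambda>(f, r, g, s, \<alpha>, \<beta>, \<gamma>, d, c).
    \<exists>A B C D D0 D1. f \<in> Hom \<C> A B \<and> r \<in> Hom \<C> B A \<and> g \<in> Hom \<C> C B \<and> s \<in> Hom \<C> B C \<and>
      \<alpha> \<in> Hom \<C> A D \<and> \<beta> \<in> Hom \<C> B D \<and> \<gamma> \<in> Hom \<C> C D \<and> d \<in> Hom \<C> D D0 \<and> c \<in> Hom \<C> D D1 \<and>
      is_span \<C> (d, c) \<and>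
      f \<cdot> r = Ident \<C> B \<and> g \<cdot> s = Ident \<C> B \<and> \<alpha> \<cdot> r = \<beta> \<and> \<gamma> \<cdot> s = \<beta> \<and>
      d \<cdot> \<alpha> = d \<cdot> \<beta> \<cdot> f \<and> c \<cdot> \<beta> \<cdot> g = c \<cdot> \<gamma>)"

definition is_kite_multiplication :: "'m kite \<Rightarrow> 'm \<Rightarrow> bool" where
  "is_kite_multiplication = (\<lambda>(f, r, g, s, \<alpha>, \<beta>, \<gamma>, d, c) m.
    m \<in> Hom \<C> (pb \<C> f g) (Dom \<C> d) \<and>
    m \<cdot> tup \<C> f g (Ident \<C> (Dom \<C> f)) (s \<cdot> f) = \<alpha> \<and>
    m \<cdot> tup \<C> f g (r \<cdot> g) (Ident \<C> (Dom \<C> g)) = \<gamma> \<and>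
    d \<cdot> m = d \<cdot> \<gamma> \<cdot> pi2 \<C> f g \<and> c \<cdot> m = c \<cdot> \<alpha> \<cdot> pi1 \<C> f g)"

definition dikite_homs :: "'m kite \<Rightarrow> 'm kite \<Rightarrow> ('m \<times> 'm \<times> 'm \<times> 'm \<times> 'm \<times> 'm) set" where
  "dikite_homs = (\<lambda>(f, r, g, s, \<alpha>, \<beta>, \<gamma>, d, c) (f', r', g', s', \<alpha>', \<beta>', \<gamma>', d', c').
    {(hA, hB, hC, hD, h0, h1).
      hA \<in> Hom \<C> (Dom \<C> f) (Dom \<C> f') \<and> hB \<in> Hom \<C> (Cod \<C> f) (Cod \<C> f') \<and>
      hC \<in> Hom \<C> (Dom \<C> g) (Dom \<C> g') \<and> hD \<in> Hom \<C> (Dom \<C> d) (Dom \<C> d') \<and>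
      h0 \<in> Hom \<C> (Cod \<C> d) (Cod \<C> d') \<and> h1 \<in> Hom \<C> (Cod \<C> c) (Cod \<C> c') \<and>
      f' \<cdot> hA = hB \<cdot> f \<and> r' \<cdot> hB = hA \<cdot> r \<and> g' \<cdot> hC = hB \<cdot> g \<and> s' \<cdot> hB = hC \<cdot> s \<and>
      \<alpha>' \<cdot> hA = hD \<cdot> \<alpha> \<and> \<beta>' \<cdot> hB = hD \<cdot> \<beta> \<and> \<gamma>' \<cdot> hC = hD \<cdot> \<gamma> \<and>
      d' \<cdot> hD = h0 \<cdot> d \<and> c' \<cdot> hD = h1 \<cdot> c})"

definition mkite_homs ::
  "'m kite \<times> 'm \<Rightarrow> 'm kite \<times> 'm \<Rightarrow> ('m \<times> 'm \<times> 'm \<times> 'm \<times> 'm \<times> 'm) set" where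
  "mkite_homs = (\<lambda>((f, r, g, s, k), m) ((f', r', g', s', k'), m').
    {(hA, hB, hC, hD, h0, h1).
      (hA, hB, hC, hD, h0, h1) \<in> dikite_homs (f, r, g, s, k) (f', r', g', s', k') \<and>
      hD \<cdot> m = m' \<cdot> pb_map \<C> f g f' g' hA hC})"

end


section \<open>The categories of structures relative to a class of spans\<close>

context
  fixes \<C> :: "('o, 'm) lim_cat" (structure) and \<M> :: "('m \<times> 'm) set"
begin

definition class_of_spans :: bool where
  "class_of_spans \<longleftrightarrow> (\<forall>S \<in> \<M>. is_span \<C> S)"

definition box_defined :: bool where
  "box_defined \<longleftrightarrow> (\<forall>S \<in> \<M>. admits_box \<C> S)"

definition closed_under_kernel_pair_construction :: bool where
  "closed_under_kernel_pair_construction \<longleftrightarrow>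
    (\<forall>(d, c) \<in> \<M>. (kpc_dom \<C> d c, kpc_cod \<C> d c) \<in> \<M>)"

definition contains_local_products :: bool where
  "contains_local_products \<longleftrightarrow> (\<forall>p1 e1 p2 e2. local_product \<C> p1 e1 p2 e2 \<longrightarrow> (p1, p2) \<in> \<M>)"

definition graph_ident :: "'m \<times> 'm \<times> 'm \<Rightarrow> 'm \<times> 'm" where
  "graph_ident = (\<lambda>(d, e, c). (Ident \<C> (Dom \<C> d), Ident \<C> (Cod \<C> d)))"

definition graph_comp :: "'m \<times> 'm \<Rightarrow> 'm \<times> 'm \<Rightarrow> 'm \<times> 'm" where
  "graph_comp = (\<lambda>(k1, k0) (h1, h0). (k1 \<cdot> h1, k0 \<cdot> h0))"

definition span_part :: "'m \<times> 'm \<times> 'm \<Rightarrow> 'm \<times> 'm" where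
  "span_part = (\<lambda>(d, e, c). (d, c))"

definition RG :: "('m \<times> 'm \<times> 'm, _) cat" where
  "RG = structure_cat {G. is_reflexive_graph \<C> G \<and> span_part G \<in> \<M>}
    (reflexive_graph_homs \<C>) graph_ident graph_comp"

definition MG :: "(('m \<times> 'm \<times> 'm) \<times> 'm, _) cat" where
  "MG = structure_cat {G. is_multiplicative_graph \<C> G \<and> span_part (fst G) \<in> \<M>}
    (multiplicative_graph_homs \<C>) (graph_ident \<circ> fst) graph_comp"

definition Cat :: "(('m \<times> 'm \<times> 'm) \<times> 'm, _) cat" where
  "Cat = structure_cat {G. is_internal_category \<C> G \<and> span_part (fst G) \<in> \<M>}
    (multiplicative_graph_homs \<C>) (graph_ident \<circ> fst) graph_comp"

definition Grpd :: "(('m \<times> 'm \<times> 'm) \<times> 'm \<times> 'm, _) cat" where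
  "Grpd = structure_cat {G. is_internal_groupoid \<C> G \<and> span_part (fst G) \<in> \<M>}
    (internal_groupoid_homs \<C>) (graph_ident \<circ> fst) graph_comp"

definition span_ident :: "'m \<times> 'm \<Rightarrow> 'm \<times> 'm \<times> 'm" where
  "span_ident = (\<lambda>(d, c). (Ident \<C> (Dom \<C> d), Ident \<C> (Cod \<C> d), Ident \<C> (Cod \<C> c)))"

definition span_comp :: "'m \<times> 'm \<times> 'm \<Rightarrow> 'm \<times> 'm \<times> 'm \<Rightarrow> 'm \<times> 'm \<times> 'm" where
  "span_comp = (\<lambda>(k, k0, k1) (h, h0, h1). (k \<cdot> h, k0 \<cdot> h0, k1 \<cdot> h1))"

definition Span :: "('m \<times> 'm, _) cat" where
  "Span = structure_cat {S. is_span \<C> S \<and> S \<in> \<M>} (span_homs \<C>) span_ident span_comp"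

definition PreGrpd :: "(('m \<times> 'm) \<times> 'm, _) cat" where
  "PreGrpd = structure_cat {P. is_pregroupoid \<C> P \<and> fst P \<in> \<M>}
    (pregroupoid_homs \<C>) (span_ident \<circ> fst) span_comp"

definition KockGrpd :: "(('m \<times> 'm) \<times> 'm, _) cat" where
  "KockGrpd = structure_cat {P. is_kock_pregroupoid \<C> P \<and> fst P \<in> \<M>}
    (pregroupoid_homs \<C>) (span_ident \<circ> fst) span_comp"

definition PseudoGrpd :: "(('m \<times> 'm) \<times> 'm, _) cat" where
  "PseudoGrpd = structure_cat {P. is_pseudogroupoid \<C> P \<and> fst P \<in> \<M>}
    (pseudogroupoid_homs \<C>) (span_ident \<circ> fst) span_comp"

definition kite_ident :: "'m kite \<Rightarrow> 'm \<times> 'm \<times> 'm \<times> 'm \<times> 'm \<times> 'm" where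
  "kite_ident = (\<lambda>(f, r, g, s, \<alpha>, \<beta>, \<gamma>, d, c).
    (Ident \<C> (Dom \<C> f), Ident \<C> (Cod \<C> f), Ident \<C> (Dom \<C> g),
     Ident \<C> (Dom \<C> d), Ident \<C> (Cod \<C> d), Ident \<C> (Cod \<C> c)))"

definition kite_comp ::
  "'m \<times> 'm \<times> 'm \<times> 'm \<times> 'm \<times> 'm \<Rightarrow> 'm \<times> 'm \<times> 'm \<times> 'm \<times> 'm \<times> 'm \<Rightarrow> 'm \<times> 'm \<times> 'm \<times> 'm \<times> 'm \<times> 'm" where
  "kite_comp = (\<lambda>(kA, kB, kC, kD, k0, k1) (hA, hB, hC, hD, h0, h1).
    (kA \<cdot> hA, kB \<cdot> hB, kC \<cdot> hC, kD \<cdot> hD, k0 \<cdot> h0, k1 \<cdot> h1))"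

definition DiKite :: "('m kite, _) cat" where
  "DiKite = structure_cat {K. is_dikite \<C> K \<and> direction K \<in> \<M>}
    (dikite_homs \<C>) kite_ident kite_comp"

definition MKite :: "('m kite \<times> 'm, _) cat" where
  "MKite = structure_cat
    {(K, m). is_dikite \<C> K \<and> direction K \<in> \<M> \<and> is_kite_multiplication \<C> K m}
    (mkite_homs \<C>) (kite_ident \<circ> fst) kite_comp"


section \<open>The conditions\<close>

definition lawvere_condition :: bool where
  "lawvere_condition \<longleftrightarrow> is_cat_iso Grpd RG forgetful"

definition relation_condition :: bool where
  "relation_condition \<longleftrightarrow>
    (\<forall>A C E D D0 D1 p1 e1 p2 e2 \<alpha> \<gamma> d c.
      p1 \<in> Hom \<C> E A \<and> e1 \<in> Hom \<C> A E \<and> p2 \<in> Hom \<C> E C \<and> e2 \<in> Hom \<C> C E \<and>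
      \<alpha> \<in> Hom \<C> A D \<and> \<gamma> \<in> Hom \<C> C D \<and> d \<in> Hom \<C> D D0 \<and> c \<in> Hom \<C> D D1 \<and>
      jointly_monic \<C> p1 p2 \<and>
      (d, c) \<in> \<M> \<and> (p1, p2) \<in> \<M> \<and>
      p1 \<cdot> e1 = Ident \<C> A \<and> p2 \<cdot> e2 = Ident \<C> C \<and>
      (e1 \<cdot> p1) \<cdot> (e2 \<cdot> p2) = (e2 \<cdot> p2) \<cdot> (e1 \<cdot> p1) \<and>
      \<alpha> \<cdot> p1 \<cdot> (e2 \<cdot> p2) = \<gamma> \<cdot> p2 \<cdot> (e1 \<cdot> p1) \<and>
      d \<cdot> \<alpha> \<cdot> p1 = d \<cdot> \<alpha> \<cdot> p1 \<cdot> (e2 \<cdot> p2) \<and>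
      c \<cdot> \<gamma> \<cdot> p2 = c \<cdot> \<gamma> \<cdot> p2 \<cdot> (e1 \<cdot> p1) \<longrightarrow>
      (\<exists>!m. m \<in> Hom \<C> E D \<and> m \<cdot> e1 = \<alpha> \<and> m \<cdot> e2 = \<gamma> \<and>
        d \<cdot> m = d \<cdot> \<gamma> \<cdot> p2 \<and> c \<cdot> m = c \<cdot> \<alpha> \<cdot> p1))"

definition kite_condition :: bool where
  "kite_condition \<longleftrightarrow>
    (\<forall>A B C D D0 D1 f r g s \<alpha> \<beta> \<gamma> d c.
      f \<in> Hom \<C> A B \<and> r \<in> Hom \<C> B A \<and> g \<in> Hom \<C> C B \<and> s \<in> Hom \<C> B C \<and>
      \<alpha> \<in> Hom \<C> A D \<and> \<beta> \<in> Hom \<C> B D \<and> \<gamma> \<in> Hom \<C> C D \<and> d \<in> Hom \<C> D D0 \<and> c \<in> Hom \<C> D D1 \<and>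
      f \<cdot> r = Ident \<C> B \<and> g \<cdot> s = Ident \<C> B \<and> \<alpha> \<cdot> r = \<beta> \<and> \<gamma> \<cdot> s = \<beta> \<and>
      d \<cdot> \<alpha> = d \<cdot> \<beta> \<cdot> f \<and> c \<cdot> \<beta> \<cdot> g = c \<cdot> \<gamma> \<and> (d, c) \<in> \<M> \<longrightarrow>
      (\<exists>!m. m \<in> Hom \<C> (pb \<C> f g) D \<and>
        m \<cdot> tup \<C> f g (Ident \<C> A) (s \<cdot> f) = \<alpha> \<and>
        m \<cdot> tup \<C> f g (r \<cdot> g) (Ident \<C> C) = \<gamma> \<and>
        d \<cdot> m = d \<cdot> \<gamma> \<cdot> pi2 \<C> f g \<and> c \<cdot> m = c \<cdot> \<alpha> \<cdot> pi1 \<C> f g))"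

definition split_square_condition :: bool where
  "split_square_condition \<longleftrightarrow>
    (\<forall>A B C E D D0 D1 p1 e1 p2 e2 f r g s d c m.
      p1 \<in> Hom \<C> E A \<and> e1 \<in> Hom \<C> A E \<and> p2 \<in> Hom \<C> E C \<and> e2 \<in> Hom \<C> C E \<and>
      f \<in> Hom \<C> A B \<and> r \<in> Hom \<C> B A \<and> g \<in> Hom \<C> C B \<and> s \<in> Hom \<C> B C \<and>
      commutative_split_square \<C> p1 e1 p2 e2 f r g s \<and>
      d \<in> Hom \<C> D D0 \<and> c \<in> Hom \<C> D D1 \<and> (d, c) \<in> \<M> \<and>
      m \<in> Hom \<C> E D \<and> d \<cdot> m = d \<cdot> m \<cdot> e2 \<cdot> p2 \<and> c \<cdot> m = c \<cdot> m \<cdot> e1 \<cdot> p1 \<longrightarrow>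
      (\<exists>!n. n \<in> Hom \<C> (pb \<C> f g) D \<and>
        n \<cdot> tup \<C> f g (Ident \<C> A) (s \<cdot> f) = m \<cdot> e1 \<and>
        n \<cdot> tup \<C> f g (r \<cdot> g) (Ident \<C> C) = m \<cdot> e2 \<and>
        d \<cdot> n = d \<cdot> m \<cdot> e2 \<cdot> pi2 \<C> f g \<and> c \<cdot> n = c \<cdot> m \<cdot> e1 \<cdot> pi1 \<C> f g))"

definition natural_pregroupoid_condition :: bool where
  "natural_pregroupoid_condition \<longleftrightarrow>
    (\<exists>p :: 'm \<times> 'm \<Rightarrow> 'm. \<forall>(d, c) \<in> \<M>.
      p (d, c) \<in> Hom \<C> (kpc \<C> d c) (Dom \<C> d) \<and>
      (\<forall>Z. \<forall>x \<in> Hom \<C> Z (Dom \<C> d). \<forall>y \<in> Hom \<C> Z (Dom \<C> d). \<forall>z \<in> Hom \<C> Z (Dom \<C> d).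
        d \<cdot> x = d \<cdot> y \<and> c \<cdot> y = c \<cdot> z \<longrightarrow>
        d \<cdot> p (d, c) \<cdot> triple \<C> d c x y z = d \<cdot> z \<and>
        c \<cdot> p (d, c) \<cdot> triple \<C> d c x y z = c \<cdot> x \<and>
        p (d, c) \<cdot> triple \<C> d c x y y = x \<and>
        p (d, c) \<cdot> triple \<C> d c y y z = z) \<and>
      (\<forall>(d', c') \<in> \<M>. \<forall>(f, f0, f1) \<in> span_homs \<C> (d, c) (d', c').
        f \<cdot> p (d, c) = p (d', c') \<cdot> kpc_map \<C> (d, c) (d', c') f))"

end

definition all_equivalent :: "bool list \<Rightarrow> bool" where
  "all_equivalent Ps \<longleftrightarrow> (\<forall>P \<in> set Ps. \<forall>Q \<in> set Ps. P \<longleftrightarrow> Q)"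

end

theory Submission
  imports Defs
begin

text \<open>
  Each of the conditions amounts to saying that every span of the class carries exactly one pregroupoid structure
  and that every morphism of spans respects it.  The proof therefore compares each condition with
  the existence of a natural choice of pregroupoid structures \<open>p\<close>, which is the condition
  \<open>natural_pregroupoid_condition\<close>.

  A natural choice has strong consequences because the class contains the local products.  Let
  \<open>m : A \<times>\<^sub>B C \<rightarrow> D\<close> be a multiplication on a directed kite.  The equations
  \<open>d m = d \<gamma> \<pi>\<^sub>2\<close> and \<open>c m = c \<alpha> \<pi>\<^sub>1\<close> say that \<open>m\<close> is a morphism of spans from
  \<open>(A \<times>\<^sub>B C, \<pi>\<^sub>2, \<pi>\<^sub>1)\<close> to \<open>(D, d, c)\<close>.  In the first of these spans the projections are
  jointly monic, hence its pregroupoid operation is forced to be the rectangle rule, and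

    \<open>(a, b) = p\<langle>(a, s f a), (r g b, s g b), (r g b, b)\<rangle>\<close>.

  Applying \<open>m\<close> and naturality gives \<open>m(a, b) = p\<langle>\<alpha> a, \<beta> g b, \<gamma> b\<rangle>\<close>
  (lemma \<open>kite_multiplication_eq_P\<close>).  So a multiplication on a directed kite is unique, and conversely
  this formula defines one.  Everything else is read off from this unique existence:
  the operation \<open>p\<close> of a pregroupoid is itself a multiplication on a kite built from the kernel
  pairs of \<open>d\<close> and \<open>c\<close>; associativity of \<open>p\<close> (lemma \<open>P_assoc\<close>) compares two multiplications on
  a kite of triples; a multiplication on a reflexive graph is a multiplication on a kite, so that
  \<open>m(x, y) = p\<langle>x, e c y, y\<rangle>\<close>, which is associative because \<open>p\<close> is, and
  \<open>x \<mapsto> p\<langle>e d x, x, e c x\<rangle>\<close> is an inverse for it.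

  Conversely, each condition produces a natural choice.  Multiplications on kites give pregroupoid
  structures through the kernel pair kite.  A multiplication on the reflexive graph
  \<open>(D(d,c), D, dom, cod)\<close> composes \<open>\<langle>y, x, x\<rangle>\<close> with \<open>\<langle>z, z, y\<rangle>\<close>, and the middle component of the
  result is \<open>p\<langle>x, y, z\<rangle>\<close>.  A pseudogroupoid structure is a morphism on the corner \<open>D(\<square>)\<close> of a
  split square over the kernel pair kite.  The condition on relations specializes to
  kites because local products are relations in the class.

  Equations between morphisms are verified on generalized elements: morphisms \<open>x\<close>
  with a fixed codomain, so that \<open>\<langle>x, y\<rangle>\<close>, \<open>\<langle>x, y, z\<rangle>\<close> and the operations above behave like functions
  of elements and a composite is kept in the form \<open>h \<cdot> (g \<cdot> (f \<cdot> x))\<close>.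
\<close>

section \<open>Sections and inverses of forgetful functors\<close>

lemma has_section_if_is_cat_iso: "is_cat_iso A B F \<Longrightarrow> has_section A B F"
  unfolding is_cat_iso_def has_section_def by blast

lemma is_functor_forgetful:
  assumes "\<And>X e. (X, e) \<in> SA \<Longrightarrow> X \<in> SB"
    and "\<And>X e Y e'. (X, e) \<in> SA \<Longrightarrow> (Y, e') \<in> SA \<Longrightarrow> HA (X, e) (Y, e') \<subseteq> HB X Y"
  shows "is_functor (structure_cat SA HA (i \<circ> fst) cmp) (structure_cat SB HB i cmp) forgetful"
  using assms unfolding is_functor_def structure_cat_def forgetful_def Hom_def by fastforce

lemma is_functor_lift:
  assumes "\<And>X. X \<in> SB \<Longrightarrow> (X, \<sigma> X) \<in> SA"
    and "\<And>X Y. X \<in> SB \<Longrightarrow> Y \<in> SB \<Longrightarrow> HB X Y \<subseteq> HA (X, \<sigma> X) (Y, \<sigma> Y)"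
  shows "is_functor (structure_cat SB HB i cmp) (structure_cat SA HA (i \<circ> fst) cmp)
    (\<lambda>X. (X, \<sigma> X), \<lambda>(X, Y, h). ((X, \<sigma> X), (Y, \<sigma> Y), h))"
  using assms unfolding is_functor_def structure_cat_def Hom_def by fastforce

lemma has_section_forgetfulI:
  assumes "\<And>X e. (X, e) \<in> SA \<Longrightarrow> X \<in> SB"
    and "\<And>X e Y e'. (X, e) \<in> SA \<Longrightarrow> (Y, e') \<in> SA \<Longrightarrow> HA (X, e) (Y, e') \<subseteq> HB X Y"
    and "\<And>X. X \<in> SB \<Longrightarrow> (X, \<sigma> X) \<in> SA"
    and "\<And>X Y. X \<in> SB \<Longrightarrow> Y \<in> SB \<Longrightarrow> HB X Y \<subseteq> HA (X, \<sigma> X) (Y, \<sigma> Y)"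
  shows "has_section (structure_cat SA HA (i \<circ> fst) cmp) (structure_cat SB HB i cmp) forgetful"
  unfolding has_section_def
proof (intro conjI exI)
  show "is_functor (structure_cat SA HA (i \<circ> fst) cmp) (structure_cat SB HB i cmp) forgetful"
    using assms(1,2) by (rule is_functor_forgetful)
  show "is_functor (structure_cat SB HB i cmp) (structure_cat SA HA (i \<circ> fst) cmp)
    (\<lambda>X. (X, \<sigma> X), \<lambda>(X, Y, h). ((X, \<sigma> X), (Y, \<sigma> Y), h))"
    using assms(3,4) by (rule is_functor_lift)
qed (auto simp: structure_cat_def forgetful_def)

text \<open>
  A section of a forgetful functor has no freedom on morphisms, which are determined by
  their ends and their components.  It amounts to a choice of the additional data which all
  morphisms of the underlying objects respect.
\<close>
lemma has_section_forgetfulE: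
  fixes SA :: "('b \<times> 'e) set" and SB :: "'b set" and HB :: "'b \<Rightarrow> 'b \<Rightarrow> 'k set"
  assumes "has_section (structure_cat SA HA iA cA) (structure_cat SB HB iB cB) forgetful"
  obtains \<sigma> where "\<And>X. X \<in> SB \<Longrightarrow> (X, \<sigma> X) \<in> SA"
    and "\<And>X Y h. X \<in> SB \<Longrightarrow> Y \<in> SB \<Longrightarrow> h \<in> HB X Y \<Longrightarrow> h \<in> HA (X, \<sigma> X) (Y, \<sigma> Y)"
proof -
  let ?A = "structure_cat SA HA iA cA" and ?B = "structure_cat SB HB iB cB"
  let ?F = "forgetful :: ('b \<times> 'e, ('b \<times> 'e) \<times> ('b \<times> 'e) \<times> 'k, 'b, 'b \<times> 'b \<times> 'k) func"
  obtain S where S: "is_functor ?B ?A S" "\<forall>Y \<in> Obj ?B. fst ?F (fst S Y) = Y"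
    "\<forall>g \<in> Arr ?B. snd ?F (snd S g) = g"
    using assms unfolding has_section_def by blast
  have obj: "(X, snd (fst S X)) = fst S X" if "X \<in> SB" for X
    using S(2) that by (simp add: structure_cat_def forgetful_def prod_eq_iff)
  show thesis
  proof (rule that[of "\<lambda>X. snd (fst S X)"])
    show "(X, snd (fst S X)) \<in> SA" if "X \<in> SB" for X
      using S(1) that obj[OF that] by (simp add: is_functor_def structure_cat_def)
    show "h \<in> HA (X, snd (fst S X)) (Y, snd (fst S Y))"
      if X: "X \<in> SB" and Y: "Y \<in> SB" and h: "h \<in> HB X Y" for X Y h
    proof -
      have g: "(X, Y, h) \<in> Arr ?B" using X Y h by (simp add: structure_cat_def)
      obtain X' Y' h' where S': "snd S (X, Y, h) = (X', Y', h')" by (metis prod_cases3)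
      have "snd S (X, Y, h) \<in> Hom ?A (fst S X) (fst S Y)"
        using S(1) g unfolding is_functor_def by (auto simp: structure_cat_def)
      moreover have "h' = h" using S(3) g S' by (auto simp: forgetful_def)
      ultimately show ?thesis
        using S' obj[OF X] obj[OF Y] by (auto simp: Hom_def structure_cat_def)
    qed
  qed
qed

text \<open>
  The inverse functor adds the only possible data; this is functorial since the two kinds
  of morphisms coincide.
\<close>
lemma is_cat_iso_forgetfulI:
  assumes base: "\<And>X e. (X, e) \<in> SA \<Longrightarrow> X \<in> SB"
    and homs: "\<And>X e Y e'. (X, e) \<in> SA \<Longrightarrow> (Y, e') \<in> SA \<Longrightarrow> HA (X, e) (Y, e') = HB X Y"
    and ex: "\<And>X. X \<in> SB \<Longrightarrow> \<exists>e. (X, e) \<in> SA"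
    and unique: "\<And>X e e'. (X, e) \<in> SA \<Longrightarrow> (X, e') \<in> SA \<Longrightarrow> e = e'"
  shows "is_cat_iso (structure_cat SA HA (i \<circ> fst) cmp) (structure_cat SB HB i cmp) forgetful"
proof -
  obtain \<sigma> where \<sigma>: "\<And>X. X \<in> SB \<Longrightarrow> (X, \<sigma> X) \<in> SA" using ex by metis
  have eq: "\<sigma> X = e" if "(X, e) \<in> SA" for X e
    using \<sigma> base unique that by blast
  show ?thesis
    unfolding is_cat_iso_def
  proof (intro conjI exI)
    show "is_functor (structure_cat SA HA (i \<circ> fst) cmp) (structure_cat SB HB i cmp) forgetful"
      using base homs by (intro is_functor_forgetful) blast+
    show "is_functor (structure_cat SB HB i cmp) (structure_cat SA HA (i \<circ> fst) cmp)
      (\<lambda>X. (X, \<sigma> X), \<lambda>(X, Y, h). ((X, \<sigma> X), (Y, \<sigma> Y), h))"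
      using \<sigma> homs by (intro is_functor_lift) blast+
  qed (auto simp: structure_cat_def forgetful_def eq)
qed

section \<open>Computing with generalized elements\<close>

context category
begin

lemma obj_arr [simp]:
  "f \<in> Arr \<C> \<Longrightarrow> Dom \<C> f \<in> Obj \<C>"
  "f \<in> Arr \<C> \<Longrightarrow> Cod \<C> f \<in> Obj \<C>"
  by (simp_all add: Dom_closed Cod_closed)

lemma ident [simp]:
  assumes "X \<in> Obj \<C>"
  shows "Ident \<C> X \<in> Arr \<C>" "Dom \<C> (Ident \<C> X) = X" "Cod \<C> (Ident \<C> X) = X"
  using Ident_closed[OF assms] by (simp_all add: Hom_def)

lemma comp [simp]:
  assumes "f \<in> Arr \<C>" "g \<in> Arr \<C>" "Cod \<C> f = Dom \<C> g"
  shows "g \<cdot> f \<in> Arr \<C>" "Dom \<C> (g \<cdot> f) = Dom \<C> f" "Cod \<C> (g \<cdot> f) = Cod \<C> g"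
  using Comp_closed[of f "Dom \<C> f" "Dom \<C> g" g "Cod \<C> g"] assms by (simp_all add: Hom_def)

lemma ident_comp [simp]:
  assumes "f \<in> Arr \<C>"
  shows "Cod \<C> f = X \<Longrightarrow> Ident \<C> X \<cdot> f = f" "Dom \<C> f = X \<Longrightarrow> f \<cdot> Ident \<C> X = f"
  using Ident_left[of f "Dom \<C> f" "Cod \<C> f"] Ident_right[of f "Dom \<C> f" "Cod \<C> f"] assms
  by (simp_all add: Hom_def)

lemma assoc [simp]:
  assumes "f \<in> Arr \<C>" "g \<in> Arr \<C>" "h \<in> Arr \<C>" "Cod \<C> f = Dom \<C> g" "Cod \<C> g = Dom \<C> h"
  shows "(h \<cdot> g) \<cdot> f = h \<cdot> (g \<cdot> f)"
  using Comp_assoc[of f "Dom \<C> f" "Dom \<C> g" g "Dom \<C> h" h "Cod \<C> h"] assms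
  by (simp add: Hom_def)

text \<open>
  Composites are kept nested to the right, so an equation between composites applies inside a
  longer composite only once it has been evaluated at an element \<open>x\<close>.
\<close>
lemma at_element:
  assumes "g \<cdot> f = k" "f \<in> Arr \<C>" "g \<in> Arr \<C>" "Cod \<C> f = Dom \<C> g"
    "x \<in> Arr \<C>" "Cod \<C> x = Dom \<C> f"
  shows "g \<cdot> (f \<cdot> x) = k \<cdot> x"
  using assms by (metis assoc)

end

section \<open>Pullbacks and the kernel pair construction\<close>

locale split_pullback_category = category \<C> for \<C> :: "('o, 'm) lim_cat" (structure) +
  assumes chosen: "chosen_limits \<C>"
    and split_pullbacks: "pullbacks_of_split_epis_along_split_epis \<C>"
begin

definition has_pullback :: "'m \<Rightarrow> 'm \<Rightarrow> bool" where
  "has_pullback f g \<longleftrightarrow> is_pullback \<C> f g (pi1 \<C> f g) (pi2 \<C> f g)"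

lemma has_pullbackI: "is_pullback \<C> f g p q \<Longrightarrow> has_pullback f g"
  using chosen unfolding chosen_limits_def has_pullback_def pi1_def pi2_def by blast

lemma is_pullbackD:
  assumes "is_pullback \<C> f g p q"
  shows "f \<in> Arr \<C>" "g \<in> Arr \<C>" "p \<in> Arr \<C>" "q \<in> Arr \<C>" "Cod \<C> g = Cod \<C> f"
    "Cod \<C> p = Dom \<C> f" "Cod \<C> q = Dom \<C> g" "Dom \<C> q = Dom \<C> p" "f \<cdot> p = g \<cdot> q"
  using assms unfolding is_pullback_def Hom_def by auto

lemma is_pullback_ex1:
  assumes "is_pullback \<C> f g p q" "x \<in> Arr \<C>" "y \<in> Arr \<C>" "Dom \<C> y = Dom \<C> x"
    "Cod \<C> x = Dom \<C> f" "Cod \<C> y = Dom \<C> g" "f \<cdot> x = g \<cdot> y"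
  shows "\<exists>!h. h \<in> Hom \<C> (Dom \<C> x) (Dom \<C> p) \<and> p \<cdot> h = x \<and> q \<cdot> h = y"
proof -
  obtain A B C P where "f \<in> Hom \<C> A B" "g \<in> Hom \<C> C B" "p \<in> Hom \<C> P A"
    and univ: "\<forall>Z. \<forall>x \<in> Hom \<C> Z A. \<forall>y \<in> Hom \<C> Z C. f \<cdot> x = g \<cdot> y \<longrightarrow>
        (\<exists>!h. h \<in> Hom \<C> Z P \<and> p \<cdot> h = x \<and> q \<cdot> h = y)"
    using assms(1) unfolding is_pullback_def by blast
  then have "Dom \<C> p = P" "x \<in> Hom \<C> (Dom \<C> x) A" "y \<in> Hom \<C> (Dom \<C> x) C"
    using assms(2-6) by (simp_all add: Hom_def)
  with univ assms(7) show ?thesis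
    by simp
qed

lemma pairing:
  assumes "is_pullback \<C> f g p q" "x \<in> Arr \<C>" "y \<in> Arr \<C>" "Dom \<C> y = Dom \<C> x"
    "Cod \<C> x = Dom \<C> f" "Cod \<C> y = Dom \<C> g" "f \<cdot> x = g \<cdot> y"
  shows "pairing \<C> p q x y \<in> Arr \<C>" "Dom \<C> (pairing \<C> p q x y) = Dom \<C> x"
    "Cod \<C> (pairing \<C> p q x y) = Dom \<C> p"
    "p \<cdot> pairing \<C> p q x y = x" "q \<cdot> pairing \<C> p q x y = y"
  using theI'[OF is_pullback_ex1[OF assms]] unfolding pairing_def Hom_def by auto

lemma is_pullback_ext:
  assumes pb: "is_pullback \<C> f g p q" and "h \<in> Arr \<C>" "k \<in> Arr \<C>" "Dom \<C> h = Dom \<C> k"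
    "Cod \<C> h = Dom \<C> p" "Cod \<C> k = Dom \<C> p" "p \<cdot> h = p \<cdot> k" "q \<cdot> h = q \<cdot> k"
  shows "h = k"
proof -
  note [simp] = is_pullbackD(1-8)[OF pb]
  have "f \<cdot> (p \<cdot> k) = g \<cdot> (q \<cdot> k)"
    using at_element[OF is_pullbackD(9)[OF pb], of k] assms by simp
  then have "\<exists>!h. h \<in> Hom \<C> (Dom \<C> (p \<cdot> k)) (Dom \<C> p) \<and> p \<cdot> h = p \<cdot> k \<and> q \<cdot> h = q \<cdot> k"
    using assms by (intro is_pullback_ex1[OF pb]) simp_all
  moreover have "h \<in> Hom \<C> (Dom \<C> (p \<cdot> k)) (Dom \<C> p)" "k \<in> Hom \<C> (Dom \<C> (p \<cdot> k)) (Dom \<C> p)"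
    using assms by (simp_all add: Hom_def)
  ultimately show ?thesis
    using assms(7,8) by blast
qed

lemma is_pullback_sym:
  assumes "is_pullback \<C> f g p q" shows "is_pullback \<C> g f q p"
proof -
  obtain A B C P where "f \<in> Hom \<C> A B" "g \<in> Hom \<C> C B" "p \<in> Hom \<C> P A" "q \<in> Hom \<C> P C"
      "f \<cdot> p = g \<cdot> q"
      "\<forall>Z. \<forall>x \<in> Hom \<C> Z A. \<forall>y \<in> Hom \<C> Z C. f \<cdot> x = g \<cdot> y \<longrightarrow>
        (\<exists>!h. h \<in> Hom \<C> Z P \<and> p \<cdot> h = x \<and> q \<cdot> h = y)"
    using assms unfolding is_pullback_def by blast
  note pb = this
  have "\<exists>!h. h \<in> Hom \<C> Z P \<and> q \<cdot> h = y \<and> p \<cdot> h = x"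
    if "y \<in> Hom \<C> Z C" "x \<in> Hom \<C> Z A" "g \<cdot> y = f \<cdot> x" for x y Z
  proof -
    have "\<exists>!h. h \<in> Hom \<C> Z P \<and> p \<cdot> h = x \<and> q \<cdot> h = y"
      using pb(6) that by simp
    then show ?thesis by (simp add: conj_commute)
  qed
  with pb(1-5) show ?thesis
    unfolding is_pullback_def
    by (intro exI[of _ C] exI[of _ B] exI[of _ A] exI[of _ P] conjI) auto
qed

lemma has_pullbackD:
  assumes "has_pullback f g"
  shows "f \<in> Arr \<C>" "g \<in> Arr \<C>" "Cod \<C> g = Cod \<C> f"
  using is_pullbackD[OF assms[unfolded has_pullback_def]] by simp_all

lemma projections [simp]:
  assumes "has_pullback f g"
  shows "pi1 \<C> f g \<in> Arr \<C>" "pi2 \<C> f g \<in> Arr \<C>"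
    "Dom \<C> (pi1 \<C> f g) = pb \<C> f g" "Dom \<C> (pi2 \<C> f g) = pb \<C> f g"
    "Cod \<C> (pi1 \<C> f g) = Dom \<C> f" "Cod \<C> (pi2 \<C> f g) = Dom \<C> g" "pb \<C> f g \<in> Obj \<C>"
  using is_pullbackD[OF assms[unfolded has_pullback_def]] by (auto simp: pb_def)

lemma projections_eq:
  assumes "has_pullback f g"
  shows "f \<cdot> pi1 \<C> f g = g \<cdot> pi2 \<C> f g"
    "x \<in> Arr \<C> \<Longrightarrow> Cod \<C> x = pb \<C> f g \<Longrightarrow> f \<cdot> (pi1 \<C> f g \<cdot> x) = g \<cdot> (pi2 \<C> f g \<cdot> x)"
proof -
  show eq: "f \<cdot> pi1 \<C> f g = g \<cdot> pi2 \<C> f g"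
    using is_pullbackD[OF assms[unfolded has_pullback_def]] by simp
  show "f \<cdot> (pi1 \<C> f g \<cdot> x) = g \<cdot> (pi2 \<C> f g \<cdot> x)" if "x \<in> Arr \<C>" "Cod \<C> x = pb \<C> f g"
    using at_element[OF eq, of x] assms that has_pullbackD[OF assms] by simp
qed

lemma tup [simp]:
  assumes "has_pullback f g" "x \<in> Arr \<C>" "y \<in> Arr \<C>" "Dom \<C> y = Dom \<C> x"
    "Cod \<C> x = Dom \<C> f" "Cod \<C> y = Dom \<C> g" "f \<cdot> x = g \<cdot> y"
  shows "tup \<C> f g x y \<in> Arr \<C>" "Dom \<C> (tup \<C> f g x y) = Dom \<C> x"
    "Cod \<C> (tup \<C> f g x y) = pb \<C> f g"
    "pi1 \<C> f g \<cdot> tup \<C> f g x y = x" "pi2 \<C> f g \<cdot> tup \<C> f g x y = y"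
  using pairing[OF assms(1)[unfolded has_pullback_def] assms(2-)]
  unfolding tup_def pb_def by this+

lemma pb_ext:
  assumes "has_pullback f g" "h \<in> Arr \<C>" "k \<in> Arr \<C>" "Dom \<C> h = Dom \<C> k"
    "Cod \<C> h = pb \<C> f g" "Cod \<C> k = pb \<C> f g"
    "pi1 \<C> f g \<cdot> h = pi1 \<C> f g \<cdot> k" "pi2 \<C> f g \<cdot> h = pi2 \<C> f g \<cdot> k"
  shows "h = k"
  by (rule is_pullback_ext[OF assms(1)[unfolded has_pullback_def]]) (use assms in simp_all)

lemma tup_at [simp]:
  assumes "has_pullback f g" "x \<in> Arr \<C>" "y \<in> Arr \<C>" "Dom \<C> y = Dom \<C> x"
    "Cod \<C> x = Dom \<C> f" "Cod \<C> y = Dom \<C> g" "f \<cdot> x = g \<cdot> y" "w \<in> Arr \<C>" "Cod \<C> w = Dom \<C> x"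
  shows "pi1 \<C> f g \<cdot> (tup \<C> f g x y \<cdot> w) = x \<cdot> w" "pi2 \<C> f g \<cdot> (tup \<C> f g x y \<cdot> w) = y \<cdot> w"
  using assms at_element[OF tup(4)[OF assms(1-7)], of w] at_element[OF tup(5)[OF assms(1-7)], of w]
  by simp_all

lemma tup_comp:
  assumes "has_pullback f g" "x \<in> Arr \<C>" "y \<in> Arr \<C>" "Dom \<C> y = Dom \<C> x"
    "Cod \<C> x = Dom \<C> f" "Cod \<C> y = Dom \<C> g" "f \<cdot> x = g \<cdot> y" "w \<in> Arr \<C>" "Cod \<C> w = Dom \<C> x"
  shows "tup \<C> f g x y \<cdot> w = tup \<C> f g (x \<cdot> w) (y \<cdot> w)"
proof -
  have eq: "f \<cdot> (x \<cdot> w) = g \<cdot> (y \<cdot> w)"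
    using assms at_element[OF assms(7), of w] has_pullbackD[OF assms(1)] by simp
  show ?thesis
    by (rule pb_ext[OF assms(1)]) (use assms eq in simp_all)
qed

lemma tup_eta [simp]:
  assumes "has_pullback f g"
  shows "tup \<C> f g (pi1 \<C> f g) (pi2 \<C> f g) = Ident \<C> (pb \<C> f g)"
    "x \<in> Arr \<C> \<Longrightarrow> Cod \<C> x = pb \<C> f g \<Longrightarrow> tup \<C> f g (pi1 \<C> f g \<cdot> x) (pi2 \<C> f g \<cdot> x) = x"
  by (rule pb_ext[OF assms]; use assms in \<open>simp add: projections_eq\<close>)+

lemma has_pullback_split:
  assumes "f \<in> Hom \<C> A B" "r \<in> Hom \<C> B A" "f \<cdot> r = Ident \<C> B"
    "g \<in> Hom \<C> C B" "s \<in> Hom \<C> B C" "g \<cdot> s = Ident \<C> B"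
  shows "has_pullback f g"
proof -
  have "split_epi \<C> f" "split_epi \<C> g"
    using assms unfolding split_epi_def by blast+
  moreover have "Cod \<C> f = Cod \<C> g" using assms by (simp add: Hom_def)
  ultimately show ?thesis
    using split_pullbacks has_pullbackI
    unfolding pullbacks_of_split_epis_along_split_epis_def by blast
qed

abbreviation span :: "'m \<Rightarrow> 'm \<Rightarrow> bool" where
  "span d c \<equiv> is_span \<C> (d, c)"

abbreviation diag :: "'m \<Rightarrow> 'm" where
  "diag d \<equiv> tup \<C> d d (Ident \<C> (Dom \<C> d)) (Ident \<C> (Dom \<C> d))"

lemma spanD:
  assumes "span d c"
  shows "d \<in> Arr \<C>" "c \<in> Arr \<C>" "Dom \<C> c = Dom \<C> d" "has_pullback d d" "has_pullback c c"
proof -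
  obtain D D0 D1 where "d \<in> Hom \<C> D D0" "c \<in> Hom \<C> D D1"
    "admits_kernel_pair \<C> d" "admits_kernel_pair \<C> c"
    using assms unfolding is_span_def by blast
  then show "d \<in> Arr \<C>" "c \<in> Arr \<C>" "Dom \<C> c = Dom \<C> d" "has_pullback d d" "has_pullback c c"
    unfolding admits_kernel_pair_def by (auto simp: Hom_def dest: has_pullbackI)
qed

lemma diag:
  assumes "has_pullback d d"
  shows "diag d \<in> Arr \<C>" "Dom \<C> (diag d) = Dom \<C> d" "Cod \<C> (diag d) = pb \<C> d d"
    "pi1 \<C> d d \<cdot> diag d = Ident \<C> (Dom \<C> d)" "pi2 \<C> d d \<cdot> diag d = Ident \<C> (Dom \<C> d)"
  using assms has_pullbackD[OF assms] by simp_all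

lemma diag_at:
  assumes "has_pullback d d" "x \<in> Arr \<C>" "Cod \<C> x = X" "Dom \<C> d = X"
  shows "tup \<C> d d (Ident \<C> X) (Ident \<C> X) \<cdot> x = tup \<C> d d x x"
  using assms has_pullbackD[OF assms(1)] obj_arr(1)[of d] by (simp add: tup_comp)

text \<open>
  A kernel pair consists of epimorphisms split by the diagonal, so the pullback defining
  \<open>D(d,c)\<close> is one along split epimorphisms.
\<close>
lemma has_pullback_kpc:
  assumes "span d c"
  shows "has_pullback (pi2 \<C> d d) (pi1 \<C> c c)"
proof (rule has_pullback_split)
  note [simp] = spanD[OF assms] diag(1-3)
  show "pi2 \<C> d d \<in> Hom \<C> (pb \<C> d d) (Dom \<C> d)" "diag d \<in> Hom \<C> (Dom \<C> d) (pb \<C> d d)"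
    "pi2 \<C> d d \<cdot> diag d = Ident \<C> (Dom \<C> d)"
    "pi1 \<C> c c \<in> Hom \<C> (pb \<C> c c) (Dom \<C> d)" "diag c \<in> Hom \<C> (Dom \<C> d) (pb \<C> c c)"
    "pi1 \<C> c c \<cdot> diag c = Ident \<C> (Dom \<C> d)"
    by (simp_all add: Hom_def)
qed

lemma kpc_projections [simp]:
  assumes "span d c"
  shows "kpc_dom \<C> d c \<in> Arr \<C>" "kpc_mid \<C> d c \<in> Arr \<C>" "kpc_cod \<C> d c \<in> Arr \<C>"
    "Dom \<C> (kpc_dom \<C> d c) = kpc \<C> d c" "Dom \<C> (kpc_mid \<C> d c) = kpc \<C> d c"
    "Dom \<C> (kpc_cod \<C> d c) = kpc \<C> d c"
    "Cod \<C> (kpc_dom \<C> d c) = Dom \<C> d" "Cod \<C> (kpc_mid \<C> d c) = Dom \<C> d"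
    "Cod \<C> (kpc_cod \<C> d c) = Dom \<C> d" "kpc \<C> d c \<in> Obj \<C>"
  using spanD[OF assms] has_pullback_kpc[OF assms]
  by (simp_all add: kpc_def kpc_dom_def kpc_mid_def kpc_cod_def)

lemma kpc_eq_at [simp]:
  assumes "span d c" "t \<in> Arr \<C>" "Cod \<C> t = kpc \<C> d c"
  shows "d \<cdot> (kpc_dom \<C> d c \<cdot> t) = d \<cdot> (kpc_mid \<C> d c \<cdot> t)"
    "c \<cdot> (kpc_cod \<C> d c \<cdot> t) = c \<cdot> (kpc_mid \<C> d c \<cdot> t)"
proof -
  let ?p = "pi1 \<C> (pi2 \<C> d d) (pi1 \<C> c c)" and ?q = "pi2 \<C> (pi2 \<C> d d) (pi1 \<C> c c)"
  note [simp] = spanD[OF assms(1)] has_pullback_kpc[OF assms(1)] assms(2,3)[unfolded kpc_def]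
  show "d \<cdot> (kpc_dom \<C> d c \<cdot> t) = d \<cdot> (kpc_mid \<C> d c \<cdot> t)"
    using projections_eq(2)[of d d "?p \<cdot> t"] by (simp add: kpc_dom_def kpc_mid_def)
  have "c \<cdot> (kpc_cod \<C> d c \<cdot> t) = c \<cdot> (pi1 \<C> c c \<cdot> (?q \<cdot> t))"
    using projections_eq(2)[of c c "?q \<cdot> t"] by (simp add: kpc_cod_def)
  also have "pi1 \<C> c c \<cdot> (?q \<cdot> t) = kpc_mid \<C> d c \<cdot> t"
    using projections_eq(2)[OF has_pullback_kpc[OF assms(1)], of t] by (simp add: kpc_mid_def)
  finally show "c \<cdot> (kpc_cod \<C> d c \<cdot> t) = c \<cdot> (kpc_mid \<C> d c \<cdot> t)" .
qed

lemma kpc_eq [simp]: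
  assumes "span d c"
  shows "d \<cdot> kpc_dom \<C> d c = d \<cdot> kpc_mid \<C> d c" "c \<cdot> kpc_cod \<C> d c = c \<cdot> kpc_mid \<C> d c"
  using kpc_eq_at[OF assms, of "Ident \<C> (kpc \<C> d c)"] assms by simp_all

text \<open>Exactly the generalized elements of \<open>D(d,c)\<close> are the \<open>\<langle>x, y, z\<rangle>\<close> with this property.\<close>

abbreviation matching :: "'m \<Rightarrow> 'm \<Rightarrow> 'm \<Rightarrow> 'm \<Rightarrow> 'm \<Rightarrow> bool" where
  "matching d c x y z \<equiv> x \<in> Arr \<C> \<and> y \<in> Arr \<C> \<and> z \<in> Arr \<C> \<and>
    Dom \<C> y = Dom \<C> x \<and> Dom \<C> z = Dom \<C> x \<and>
    Cod \<C> x = Dom \<C> d \<and> Cod \<C> y = Dom \<C> d \<and> Cod \<C> z = Dom \<C> d \<and> d \<cdot> x = d \<cdot> y \<and> c \<cdot> y = c \<cdot> z"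

lemma triple [simp]:
  assumes "span d c" "matching d c x y z"
  shows "triple \<C> d c x y z \<in> Arr \<C>" "Dom \<C> (triple \<C> d c x y z) = Dom \<C> x"
    "Cod \<C> (triple \<C> d c x y z) = kpc \<C> d c"
    "kpc_dom \<C> d c \<cdot> triple \<C> d c x y z = x" "kpc_mid \<C> d c \<cdot> triple \<C> d c x y z = y"
    "kpc_cod \<C> d c \<cdot> triple \<C> d c x y z = z"
  using assms spanD[OF assms(1)] has_pullback_kpc[OF assms(1)]
  by (simp_all add: triple_def kpc_def kpc_dom_def kpc_mid_def kpc_cod_def)

text \<open>
  The middle component occurs twice in the iterated pullback, as the second projection of
  one kernel pair and the first projection of the other; three components therefore suffice.
\<close>
lemma kpc_ext:
  assumes "span d c" "h \<in> Arr \<C>" "k \<in> Arr \<C>" "Dom \<C> h = Dom \<C> k"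
    "Cod \<C> h = kpc \<C> d c" "Cod \<C> k = kpc \<C> d c"
    "kpc_dom \<C> d c \<cdot> h = kpc_dom \<C> d c \<cdot> k" "kpc_mid \<C> d c \<cdot> h = kpc_mid \<C> d c \<cdot> k"
    "kpc_cod \<C> d c \<cdot> h = kpc_cod \<C> d c \<cdot> k"
  shows "h = k"
proof -
  note [simp] = spanD[OF assms(1)] has_pullback_kpc[OF assms(1)] assms(2-6)[unfolded kpc_def]
  let ?p = "pi1 \<C> (pi2 \<C> d d) (pi1 \<C> c c)" and ?q = "pi2 \<C> (pi2 \<C> d d) (pi1 \<C> c c)"
  have mid: "pi2 \<C> d d \<cdot> (?p \<cdot> t) = pi1 \<C> c c \<cdot> (?q \<cdot> t)"
    if "t \<in> Arr \<C>" "Cod \<C> t = pb \<C> (pi2 \<C> d d) (pi1 \<C> c c)" for t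
    using that by (simp add: projections_eq(2)[OF has_pullback_kpc[OF assms(1)]])
  have eqs: "pi1 \<C> d d \<cdot> (?p \<cdot> h) = pi1 \<C> d d \<cdot> (?p \<cdot> k)"
    "pi2 \<C> d d \<cdot> (?p \<cdot> h) = pi2 \<C> d d \<cdot> (?p \<cdot> k)" "pi2 \<C> c c \<cdot> (?q \<cdot> h) = pi2 \<C> c c \<cdot> (?q \<cdot> k)"
    using assms(7-9) by (simp_all add: kpc_dom_def kpc_mid_def kpc_cod_def)
  have p: "?p \<cdot> h = ?p \<cdot> k"
    by (rule pb_ext[of d d]) (use eqs in simp_all)
  have q: "?q \<cdot> h = ?q \<cdot> k"
    by (rule pb_ext[of c c]) (use eqs mid[of h] mid[of k] in simp_all)
  show ?thesis
    by (rule pb_ext[OF has_pullback_kpc[OF assms(1)]]) (use p q in simp_all)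
qed

lemma matching_comp:
  assumes "span d c" "matching d c x y z" "w \<in> Arr \<C>" "Cod \<C> w = Dom \<C> x"
  shows "matching d c (x \<cdot> w) (y \<cdot> w) (z \<cdot> w)"
  using assms spanD[OF assms(1)] at_element[of d x "d \<cdot> y" w] at_element[of c y "c \<cdot> z" w] by simp

lemma triple_at [simp]:
  assumes "span d c" "matching d c x y z" "w \<in> Arr \<C>" "Cod \<C> w = Dom \<C> x"
  shows "kpc_dom \<C> d c \<cdot> (triple \<C> d c x y z \<cdot> w) = x \<cdot> w"
    "kpc_mid \<C> d c \<cdot> (triple \<C> d c x y z \<cdot> w) = y \<cdot> w"
    "kpc_cod \<C> d c \<cdot> (triple \<C> d c x y z \<cdot> w) = z \<cdot> w"
  using at_element[of "kpc_dom \<C> d c" "triple \<C> d c x y z" x w]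
    at_element[of "kpc_mid \<C> d c" "triple \<C> d c x y z" y w]
    at_element[of "kpc_cod \<C> d c" "triple \<C> d c x y z" z w] assms by simp_all

lemma triple_comp:
  assumes "span d c" "matching d c x y z" "w \<in> Arr \<C>" "Cod \<C> w = Dom \<C> x"
  shows "triple \<C> d c x y z \<cdot> w = triple \<C> d c (x \<cdot> w) (y \<cdot> w) (z \<cdot> w)"
  by (rule kpc_ext[OF assms(1)]) (use assms matching_comp[OF assms] in simp_all)

lemma triple_eta [simp]:
  assumes "span d c"
  shows "triple \<C> d c (kpc_dom \<C> d c) (kpc_mid \<C> d c) (kpc_cod \<C> d c) = Ident \<C> (kpc \<C> d c)"
    "t \<in> Arr \<C> \<Longrightarrow> Cod \<C> t = kpc \<C> d c \<Longrightarrow>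
      triple \<C> d c (kpc_dom \<C> d c \<cdot> t) (kpc_mid \<C> d c \<cdot> t) (kpc_cod \<C> d c \<cdot> t) = t"
  by (rule kpc_ext[OF assms]; use assms spanD[OF assms] in simp)+

lemma span_homsD:
  assumes "(f, f0, f1) \<in> span_homs \<C> (d, c) (d', c')" "span d c" "span d' c'"
  shows "f \<in> Arr \<C>" "Dom \<C> f = Dom \<C> d" "Cod \<C> f = Dom \<C> d'"
    "f0 \<in> Arr \<C>" "Dom \<C> f0 = Cod \<C> d" "Cod \<C> f0 = Cod \<C> d'"
    "f1 \<in> Arr \<C>" "Dom \<C> f1 = Cod \<C> c" "Cod \<C> f1 = Cod \<C> c'"
    "d' \<cdot> f = f0 \<cdot> d" "c' \<cdot> f = f1 \<cdot> c"
    "x \<in> Arr \<C> \<Longrightarrow> Cod \<C> x = Dom \<C> d \<Longrightarrow> d' \<cdot> (f \<cdot> x) = f0 \<cdot> (d \<cdot> x)"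
    "x \<in> Arr \<C> \<Longrightarrow> Cod \<C> x = Dom \<C> d \<Longrightarrow> c' \<cdot> (f \<cdot> x) = f1 \<cdot> (c \<cdot> x)"
proof -
  show 1: "f \<in> Arr \<C>" "Dom \<C> f = Dom \<C> d" "Cod \<C> f = Dom \<C> d'"
    "f0 \<in> Arr \<C>" "Dom \<C> f0 = Cod \<C> d" "Cod \<C> f0 = Cod \<C> d'"
    "f1 \<in> Arr \<C>" "Dom \<C> f1 = Cod \<C> c" "Cod \<C> f1 = Cod \<C> c'"
    "d' \<cdot> f = f0 \<cdot> d" "c' \<cdot> f = f1 \<cdot> c"
    using assms(1) by (auto simp: span_homs_def Hom_def)
  show "x \<in> Arr \<C> \<Longrightarrow> Cod \<C> x = Dom \<C> d \<Longrightarrow> d' \<cdot> (f \<cdot> x) = f0 \<cdot> (d \<cdot> x)"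
    "x \<in> Arr \<C> \<Longrightarrow> Cod \<C> x = Dom \<C> d \<Longrightarrow> c' \<cdot> (f \<cdot> x) = f1 \<cdot> (c \<cdot> x)"
    using at_element[OF 1(10), of x] at_element[OF 1(11), of x] 1
      spanD[OF assms(2)] spanD[OF assms(3)] by simp_all
qed

end

section \<open>Multiplications on directed kites\<close>

context split_pullback_category
begin

lemma dikiteD:
  assumes "is_dikite \<C> (f, r, g, s, \<alpha>, \<beta>, \<gamma>, d, c)"
  shows "f \<in> Arr \<C>" "r \<in> Arr \<C>" "g \<in> Arr \<C>" "s \<in> Arr \<C>"
    "\<alpha> \<in> Arr \<C>" "\<beta> \<in> Arr \<C>" "\<gamma> \<in> Arr \<C>" "span d c"
    "Dom \<C> r = Cod \<C> f" "Cod \<C> r = Dom \<C> f" "Cod \<C> g = Cod \<C> f"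
    "Dom \<C> s = Cod \<C> f" "Cod \<C> s = Dom \<C> g"
    "Dom \<C> \<alpha> = Dom \<C> f" "Dom \<C> \<beta> = Cod \<C> f" "Dom \<C> \<gamma> = Dom \<C> g"
    "Cod \<C> \<alpha> = Dom \<C> d" "Cod \<C> \<beta> = Dom \<C> d" "Cod \<C> \<gamma> = Dom \<C> d"
    "f \<cdot> r = Ident \<C> (Cod \<C> f)" "g \<cdot> s = Ident \<C> (Cod \<C> f)" "\<alpha> \<cdot> r = \<beta>" "\<gamma> \<cdot> s = \<beta>"
    "d \<cdot> \<alpha> = d \<cdot> (\<beta> \<cdot> f)" "c \<cdot> \<gamma> = c \<cdot> (\<beta> \<cdot> g)" "has_pullback f g"
proof -
  obtain A B C D D0 D1 where K: "f \<in> Hom \<C> A B" "r \<in> Hom \<C> B A" "g \<in> Hom \<C> C B" "s \<in> Hom \<C> B C"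
      "\<alpha> \<in> Hom \<C> A D" "\<beta> \<in> Hom \<C> B D" "\<gamma> \<in> Hom \<C> C D" "d \<in> Hom \<C> D D0" "c \<in> Hom \<C> D D1"
      "span d c" "f \<cdot> r = Ident \<C> B" "g \<cdot> s = Ident \<C> B" "\<alpha> \<cdot> r = \<beta>" "\<gamma> \<cdot> s = \<beta>"
      "d \<cdot> \<alpha> = d \<cdot> \<beta> \<cdot> f" "c \<cdot> \<beta> \<cdot> g = c \<cdot> \<gamma>"
    using assms unfolding is_dikite_def by auto
  show "has_pullback f g"
    using K has_pullback_split by blast
  show "f \<in> Arr \<C>" "r \<in> Arr \<C>" "g \<in> Arr \<C>" "s \<in> Arr \<C>"
    "\<alpha> \<in> Arr \<C>" "\<beta> \<in> Arr \<C>" "\<gamma> \<in> Arr \<C>" "span d c"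
    "Dom \<C> r = Cod \<C> f" "Cod \<C> r = Dom \<C> f" "Cod \<C> g = Cod \<C> f"
    "Dom \<C> s = Cod \<C> f" "Cod \<C> s = Dom \<C> g"
    "Dom \<C> \<alpha> = Dom \<C> f" "Dom \<C> \<beta> = Cod \<C> f" "Dom \<C> \<gamma> = Dom \<C> g"
    "Cod \<C> \<alpha> = Dom \<C> d" "Cod \<C> \<beta> = Dom \<C> d" "Cod \<C> \<gamma> = Dom \<C> d"
    "f \<cdot> r = Ident \<C> (Cod \<C> f)" "g \<cdot> s = Ident \<C> (Cod \<C> f)" "\<alpha> \<cdot> r = \<beta>" "\<gamma> \<cdot> s = \<beta>"
    using K by (simp_all add: Hom_def)
  show "d \<cdot> \<alpha> = d \<cdot> (\<beta> \<cdot> f)" "c \<cdot> \<gamma> = c \<cdot> (\<beta> \<cdot> g)"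
    using K(15,16) K(1-9) by (simp_all add: Hom_def)
qed

lemma dikite_at:
  assumes K: "is_dikite \<C> (f, r, g, s, \<alpha>, \<beta>, \<gamma>, d, c)" and "x \<in> Arr \<C>"
  shows "Cod \<C> x = Cod \<C> f \<Longrightarrow> f \<cdot> (r \<cdot> x) = x" "Cod \<C> x = Cod \<C> f \<Longrightarrow> g \<cdot> (s \<cdot> x) = x"
    "Cod \<C> x = Cod \<C> f \<Longrightarrow> \<alpha> \<cdot> (r \<cdot> x) = \<beta> \<cdot> x" "Cod \<C> x = Cod \<C> f \<Longrightarrow> \<gamma> \<cdot> (s \<cdot> x) = \<beta> \<cdot> x"
    "Cod \<C> x = Dom \<C> f \<Longrightarrow> d \<cdot> (\<alpha> \<cdot> x) = d \<cdot> (\<beta> \<cdot> (f \<cdot> x))"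
    "Cod \<C> x = Dom \<C> g \<Longrightarrow> c \<cdot> (\<gamma> \<cdot> x) = c \<cdot> (\<beta> \<cdot> (g \<cdot> x))"
  using at_element[OF dikiteD(20)[OF K], of x] at_element[OF dikiteD(21)[OF K], of x]
    at_element[OF dikiteD(22)[OF K], of x] at_element[OF dikiteD(23)[OF K], of x]
    at_element[OF dikiteD(24)[OF K], of x] at_element[OF dikiteD(25)[OF K], of x]
    dikiteD(1-19)[OF K] spanD[OF dikiteD(8)[OF K]] assms(2)
  by simp_all

lemma dikiteI:
  assumes "f \<in> Arr \<C>" "r \<in> Arr \<C>" "g \<in> Arr \<C>" "s \<in> Arr \<C>"
    "\<alpha> \<in> Arr \<C>" "\<beta> \<in> Arr \<C>" "\<gamma> \<in> Arr \<C>" "span d c"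
    "Dom \<C> r = Cod \<C> f" "Cod \<C> r = Dom \<C> f" "Cod \<C> g = Cod \<C> f"
    "Dom \<C> s = Cod \<C> f" "Cod \<C> s = Dom \<C> g"
    "Dom \<C> \<alpha> = Dom \<C> f" "Dom \<C> \<beta> = Cod \<C> f" "Dom \<C> \<gamma> = Dom \<C> g"
    "Cod \<C> \<alpha> = Dom \<C> d" "Cod \<C> \<beta> = Dom \<C> d" "Cod \<C> \<gamma> = Dom \<C> d"
    "f \<cdot> r = Ident \<C> (Cod \<C> f)" "g \<cdot> s = Ident \<C> (Cod \<C> f)" "\<alpha> \<cdot> r = \<beta>" "\<gamma> \<cdot> s = \<beta>"
    "d \<cdot> \<alpha> = d \<cdot> (\<beta> \<cdot> f)" "c \<cdot> \<gamma> = c \<cdot> (\<beta> \<cdot> g)"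
  shows "is_dikite \<C> (f, r, g, s, \<alpha>, \<beta>, \<gamma>, d, c)"
proof -
  have eqs: "d \<cdot> \<alpha> = d \<cdot> \<beta> \<cdot> f" "c \<cdot> \<beta> \<cdot> g = c \<cdot> \<gamma>"
    using assms spanD[OF assms(8)] by simp_all
  show ?thesis
    unfolding is_dikite_def split_conv
    by (rule exI[of _ "Dom \<C> f"], rule exI[of _ "Cod \<C> f"], rule exI[of _ "Dom \<C> g"],
        rule exI[of _ "Dom \<C> d"], rule exI[of _ "Cod \<C> d"], rule exI[of _ "Cod \<C> c"])
      (use assms(1-23) spanD(1-3)[OF assms(8)] eqs in \<open>auto simp: Hom_def\<close>)
qed

lemma kite_multiplicationD:
  assumes K: "is_dikite \<C> (f, r, g, s, \<alpha>, \<beta>, \<gamma>, d, c)"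
    and m: "is_kite_multiplication \<C> (f, r, g, s, \<alpha>, \<beta>, \<gamma>, d, c) m"
  shows "m \<in> Arr \<C>" "Dom \<C> m = pb \<C> f g" "Cod \<C> m = Dom \<C> d"
    and "\<And>x. x \<in> Arr \<C> \<Longrightarrow> Cod \<C> x = Dom \<C> f \<Longrightarrow> m \<cdot> tup \<C> f g x (s \<cdot> (f \<cdot> x)) = \<alpha> \<cdot> x"
    and "\<And>y. y \<in> Arr \<C> \<Longrightarrow> Cod \<C> y = Dom \<C> g \<Longrightarrow> m \<cdot> tup \<C> f g (r \<cdot> (g \<cdot> y)) y = \<gamma> \<cdot> y"
    and "\<And>t. t \<in> Arr \<C> \<Longrightarrow> Cod \<C> t = pb \<C> f g \<Longrightarrow> d \<cdot> (m \<cdot> t) = d \<cdot> (\<gamma> \<cdot> (pi2 \<C> f g \<cdot> t))"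
    and "\<And>t. t \<in> Arr \<C> \<Longrightarrow> Cod \<C> t = pb \<C> f g \<Longrightarrow> c \<cdot> (m \<cdot> t) = c \<cdot> (\<alpha> \<cdot> (pi1 \<C> f g \<cdot> t))"
proof -
  note [simp] = dikiteD(1-21,26)[OF K] spanD[OF dikiteD(8)[OF K]] dikite_at[OF K]
  show *[simp]: "m \<in> Arr \<C>" "Dom \<C> m = pb \<C> f g" "Cod \<C> m = Dom \<C> d"
    using m by (simp_all add: is_kite_multiplication_def Hom_def)
  have e: "m \<cdot> tup \<C> f g (Ident \<C> (Dom \<C> f)) (s \<cdot> f) = \<alpha>"
    "m \<cdot> tup \<C> f g (r \<cdot> g) (Ident \<C> (Dom \<C> g)) = \<gamma>"
    "d \<cdot> m = d \<cdot> \<gamma> \<cdot> pi2 \<C> f g" "c \<cdot> m = c \<cdot> \<alpha> \<cdot> pi1 \<C> f g"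
    using m by (simp_all add: is_kite_multiplication_def)
  show "m \<cdot> tup \<C> f g x (s \<cdot> (f \<cdot> x)) = \<alpha> \<cdot> x" if "x \<in> Arr \<C>" "Cod \<C> x = Dom \<C> f" for x
    using at_element[OF e(1), of x] that by (simp add: tup_comp)
  show "m \<cdot> tup \<C> f g (r \<cdot> (g \<cdot> y)) y = \<gamma> \<cdot> y" if "y \<in> Arr \<C>" "Cod \<C> y = Dom \<C> g" for y
    using at_element[OF e(2), of y] that by (simp add: tup_comp)
  show "d \<cdot> (m \<cdot> t) = d \<cdot> (\<gamma> \<cdot> (pi2 \<C> f g \<cdot> t))" if "t \<in> Arr \<C>" "Cod \<C> t = pb \<C> f g" for t
    using at_element[OF e(3), of t] that by simp
  show "c \<cdot> (m \<cdot> t) = c \<cdot> (\<alpha> \<cdot> (pi1 \<C> f g \<cdot> t))" if "t \<in> Arr \<C>" "Cod \<C> t = pb \<C> f g" for t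
    using at_element[OF e(4), of t] that by simp
qed

lemma kite_multiplicationI:
  assumes K: "is_dikite \<C> (f, r, g, s, \<alpha>, \<beta>, \<gamma>, d, c)"
    and "m \<in> Arr \<C>" "Dom \<C> m = pb \<C> f g" "Cod \<C> m = Dom \<C> d"
    and "m \<cdot> tup \<C> f g (Ident \<C> (Dom \<C> f)) (s \<cdot> f) = \<alpha>"
    and "m \<cdot> tup \<C> f g (r \<cdot> g) (Ident \<C> (Dom \<C> g)) = \<gamma>"
    and "d \<cdot> m = d \<cdot> (\<gamma> \<cdot> pi2 \<C> f g)" "c \<cdot> m = c \<cdot> (\<alpha> \<cdot> pi1 \<C> f g)"
  shows "is_kite_multiplication \<C> (f, r, g, s, \<alpha>, \<beta>, \<gamma>, d, c) m"
  using assms dikiteD(1-21,26)[OF K] spanD[OF dikiteD(8)[OF K]]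
  by (simp add: is_kite_multiplication_def Hom_def)

text \<open>
  The base is formed by the kernel pairs of \<open>d\<close> and \<open>c\<close> over their common vertex \<open>D\<close>, so that the
  pullback of the base is \<open>D(d,c)\<close>.  A multiplication sends \<open>\<langle>x, y, y\<rangle>\<close> to \<open>h x\<close> and \<open>\<langle>y, y, z\<rangle>\<close> to
  \<open>h z\<close>.  For the identity \<open>h\<close> it is a pregroupoid structure; for a morphism of spans \<open>h\<close>, both
  sides of the equation expressing that \<open>h\<close> preserves pregroupoid structures are multiplications
  on the same kite.
\<close>
definition kernel_kite :: "'m \<Rightarrow> 'm \<Rightarrow> 'm \<Rightarrow> 'm \<Rightarrow> 'm \<Rightarrow> 'm kite" where
  "kernel_kite d c h d' c' = (pi2 \<C> d d, diag d, pi1 \<C> c c, diag c,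
    h \<cdot> pi1 \<C> d d, h, h \<cdot> pi2 \<C> c c, d', c')"

lemma is_dikite_kernel_kite:
  assumes "span d c" "span d' c'" "h \<in> Arr \<C>" "Dom \<C> h = Dom \<C> d" "Cod \<C> h = Dom \<C> d'"
    "d' \<cdot> (h \<cdot> pi1 \<C> d d) = d' \<cdot> (h \<cdot> pi2 \<C> d d)" "c' \<cdot> (h \<cdot> pi1 \<C> c c) = c' \<cdot> (h \<cdot> pi2 \<C> c c)"
  shows "is_dikite \<C> (kernel_kite d c h d' c')"
  unfolding kernel_kite_def using assms spanD[OF assms(1)] spanD[OF assms(2)]
  by (intro dikiteI) (simp_all add: diag)

lemma is_dikite_kernel_kite_hom:
  assumes "(h, h0, h1) \<in> span_homs \<C> (d, c) (d', c')" "span d c" "span d' c'"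
  shows "is_dikite \<C> (kernel_kite d c h d' c')"
  using assms(2,3) span_homsD[OF assms] spanD[OF assms(2)] spanD[OF assms(3)]
  by (intro is_dikite_kernel_kite) (simp_all add: projections_eq)

lemma kernel_kite_multiplicationI:
  assumes K: "is_dikite \<C> (kernel_kite d c h d' c')"
    and "span d c" "n \<in> Arr \<C>" "Dom \<C> n = kpc \<C> d c" "Cod \<C> n = Dom \<C> d'"
    and x: "\<And>x y. matching d c x y y \<Longrightarrow> n \<cdot> triple \<C> d c x y y = h \<cdot> x"
    and z: "\<And>y z. matching d c y y z \<Longrightarrow> n \<cdot> triple \<C> d c y y z = h \<cdot> z"
    and "d' \<cdot> n = d' \<cdot> (h \<cdot> kpc_cod \<C> d c)" "c' \<cdot> n = c' \<cdot> (h \<cdot> kpc_dom \<C> d c)"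
  shows "is_kite_multiplication \<C> (kernel_kite d c h d' c') n"
  unfolding kernel_kite_def
proof (rule kite_multiplicationI[OF K[unfolded kernel_kite_def]])
  note s = spanD[OF assms(2)]
  note [simp] = s has_pullback_kpc[OF assms(2)] dikiteD(1-21)[OF K[unfolded kernel_kite_def]]
    projections_eq[of d d] projections_eq[of c c]
  show "n \<in> Arr \<C>" "Dom \<C> n = pb \<C> (pi2 \<C> d d) (pi1 \<C> c c)" "Cod \<C> n = Dom \<C> d'"
    using assms by (simp_all add: kpc_def)
  show "n \<cdot> tup \<C> (pi2 \<C> d d) (pi1 \<C> c c) (Ident \<C> (Dom \<C> (pi2 \<C> d d))) (diag c \<cdot> pi2 \<C> d d)
    = h \<cdot> pi1 \<C> d d"
    using x[of "pi1 \<C> d d" "pi2 \<C> d d"] by (simp add: triple_def diag_at)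
  show "n \<cdot> tup \<C> (pi2 \<C> d d) (pi1 \<C> c c) (diag d \<cdot> pi1 \<C> c c) (Ident \<C> (Dom \<C> (pi1 \<C> c c)))
    = h \<cdot> pi2 \<C> c c"
    using z[of "pi1 \<C> c c" "pi2 \<C> c c"] by (simp add: triple_def diag_at)
  show "d' \<cdot> n = d' \<cdot> (h \<cdot> pi2 \<C> c c \<cdot> pi2 \<C> (pi2 \<C> d d) (pi1 \<C> c c))"
    "c' \<cdot> n = c' \<cdot> (h \<cdot> pi1 \<C> d d \<cdot> pi1 \<C> (pi2 \<C> d d) (pi1 \<C> c c))"
    using assms(8,9) dikiteD(6,15,18)[OF K[unfolded kernel_kite_def]]
    by (simp_all add: kpc_dom_def kpc_cod_def)
qed

lemma kernel_kite_multiplicationD: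
  assumes K: "is_dikite \<C> (kernel_kite d c h d' c')" and "span d c"
    and n: "is_kite_multiplication \<C> (kernel_kite d c h d' c') n"
  shows "n \<in> Arr \<C>" "Dom \<C> n = kpc \<C> d c" "Cod \<C> n = Dom \<C> d'"
    and "\<And>x y. matching d c x y y \<Longrightarrow> n \<cdot> triple \<C> d c x y y = h \<cdot> x"
    and "\<And>y z. matching d c y y z \<Longrightarrow> n \<cdot> triple \<C> d c y y z = h \<cdot> z"
    and "\<And>x y z. matching d c x y z \<Longrightarrow> d' \<cdot> (n \<cdot> triple \<C> d c x y z) = d' \<cdot> (h \<cdot> z)"
    and "\<And>x y z. matching d c x y z \<Longrightarrow> c' \<cdot> (n \<cdot> triple \<C> d c x y z) = c' \<cdot> (h \<cdot> x)"
proof -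
  note s = spanD[OF assms(2)] and K' = K[unfolded kernel_kite_def]
  note [simp] = s has_pullback_kpc[OF assms(2)] dikiteD(1-21)[OF K']
  have h [simp]: "h \<in> Arr \<C>" "Dom \<C> h = Dom \<C> d" "Cod \<C> h = Dom \<C> d'"
    using dikiteD(6,15,18)[OF K'] by simp_all
  note D = kite_multiplicationD[OF K' n[unfolded kernel_kite_def]]
  show "n \<in> Arr \<C>" "Dom \<C> n = kpc \<C> d c" "Cod \<C> n = Dom \<C> d'"
    using D(1-3) by (simp_all add: kpc_def)
  show "n \<cdot> triple \<C> d c x y y = h \<cdot> x" if "matching d c x y y" for x y
    using D(4)[of "tup \<C> d d x y"] that by (simp add: triple_def diag_at)
  show "n \<cdot> triple \<C> d c y y z = h \<cdot> z" if "matching d c y y z" for y z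
    using D(5)[of "tup \<C> c c y z"] that by (simp add: triple_def diag_at)
  show "d' \<cdot> (n \<cdot> triple \<C> d c x y z) = d' \<cdot> (h \<cdot> z)" if "matching d c x y z" for x y z
    using D(6)[of "triple \<C> d c x y z"] that by (simp add: triple_def)
  show "c' \<cdot> (n \<cdot> triple \<C> d c x y z) = c' \<cdot> (h \<cdot> x)" if "matching d c x y z" for x y z
    using D(7)[of "triple \<C> d c x y z"] that by (simp add: triple_def)
qed

lemma kernel_kite_identity:
  assumes "span d c"
  shows "is_dikite \<C> (kernel_kite d c (Ident \<C> (Dom \<C> d)) d c)"
    and "is_kite_multiplication \<C> (kernel_kite d c (Ident \<C> (Dom \<C> d)) d c) p \<longleftrightarrow>
      is_pregroupoid \<C> ((d, c), p)"
proof -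
  let ?I = "Ident \<C> (Dom \<C> d)"
  note s [simp] = spanD[OF assms] and [simp] = assms
  show K: "is_dikite \<C> (kernel_kite d c ?I d c)"
    using projections_eq[OF s(4)] projections_eq[OF s(5)]
    by (intro is_dikite_kernel_kite) simp_all
  show "is_kite_multiplication \<C> (kernel_kite d c ?I d c) p \<longleftrightarrow> is_pregroupoid \<C> ((d, c), p)"
  proof
    assume "is_kite_multiplication \<C> (kernel_kite d c ?I d c) p"
    note D = kernel_kite_multiplicationD[OF K assms this]
    show "is_pregroupoid \<C> ((d, c), p)"
      unfolding is_pregroupoid_def using D by (auto simp: Hom_def)
  next
    assume p: "is_pregroupoid \<C> ((d, c), p)"
    then have h [simp]: "p \<in> Arr \<C>" "Dom \<C> p = kpc \<C> d c" "Cod \<C> p = Dom \<C> d"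
      by (simp_all add: is_pregroupoid_def Hom_def)
    have x: "p \<cdot> triple \<C> d c x y y = ?I \<cdot> x" if "matching d c x y y" for x y
      using p that by (simp add: is_pregroupoid_def Hom_def)
    have z: "p \<cdot> triple \<C> d c y y z = ?I \<cdot> z" if "matching d c y y z" for y z
      using p that by (simp add: is_pregroupoid_def Hom_def)
    have xyz: "d \<cdot> (p \<cdot> triple \<C> d c x y z) = d \<cdot> z \<and> c \<cdot> (p \<cdot> triple \<C> d c x y z) = c \<cdot> x"
      if "matching d c x y z" for x y z
      using p that unfolding is_pregroupoid_def by (simp add: Hom_def)
    show "is_kite_multiplication \<C> (kernel_kite d c ?I d c) p"
      by (rule kernel_kite_multiplicationI[OF K assms h x z])
        (use xyz[of "kpc_dom \<C> d c" "kpc_mid \<C> d c" "kpc_cod \<C> d c"] in simp_all)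
  qed
qed

text \<open>
  The span condition contained in \<open>is_dikite\<close> follows from membership in the class, so that
  both sides quantify over the same diagrams.
\<close>
lemma kite_condition_iff:
  assumes "class_of_spans \<C> \<M>"
  shows "kite_condition \<C> \<M> \<longleftrightarrow>
    (\<forall>K. is_dikite \<C> K \<and> direction K \<in> \<M> \<longrightarrow> (\<exists>!m. is_kite_multiplication \<C> K m))"
proof
  assume H: "kite_condition \<C> \<M>"
  show "\<forall>K. is_dikite \<C> K \<and> direction K \<in> \<M> \<longrightarrow> (\<exists>!m. is_kite_multiplication \<C> K m)"
  proof (intro allI impI)
    fix K assume K: "is_dikite \<C> K \<and> direction K \<in> \<M>"
    obtain f r g s \<alpha> \<beta> \<gamma> d c where K_eq: "K = (f, r, g, s, \<alpha>, \<beta>, \<gamma>, d, c)"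
      by (cases K) auto
    obtain A B C D D0 D1 where "f \<in> Hom \<C> A B" "r \<in> Hom \<C> B A" "g \<in> Hom \<C> C B" "s \<in> Hom \<C> B C"
      "\<alpha> \<in> Hom \<C> A D" "\<beta> \<in> Hom \<C> B D" "\<gamma> \<in> Hom \<C> C D" "d \<in> Hom \<C> D D0" "c \<in> Hom \<C> D D1"
      "f \<cdot> r = Ident \<C> B" "g \<cdot> s = Ident \<C> B" "\<alpha> \<cdot> r = \<beta>" "\<gamma> \<cdot> s = \<beta>"
      "d \<cdot> \<alpha> = d \<cdot> \<beta> \<cdot> f" "c \<cdot> \<beta> \<cdot> g = c \<cdot> \<gamma>" "(d, c) \<in> \<M>"
      using K unfolding K_eq is_dikite_def direction_def by auto
    note * = this
    have "Dom \<C> f = A" "Dom \<C> g = C" "Dom \<C> d = D"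
      using * by (simp_all add: Hom_def)
    then show "\<exists>!m. is_kite_multiplication \<C> K m"
      using H[unfolded kite_condition_def, rule_format, of f A B r g C s \<alpha> D \<beta> \<gamma> d D0 c D1] *
      unfolding K_eq is_kite_multiplication_def split_conv by simp
  qed
next
  assume H: "\<forall>K. is_dikite \<C> K \<and> direction K \<in> \<M> \<longrightarrow> (\<exists>!m. is_kite_multiplication \<C> K m)"
  show "kite_condition \<C> \<M>"
    unfolding kite_condition_def
  proof (intro allI impI)
    fix A B C D D0 D1 f r g s \<alpha> \<beta> \<gamma> d c
    assume *: "f \<in> Hom \<C> A B \<and> r \<in> Hom \<C> B A \<and> g \<in> Hom \<C> C B \<and> s \<in> Hom \<C> B C \<and>
      \<alpha> \<in> Hom \<C> A D \<and> \<beta> \<in> Hom \<C> B D \<and> \<gamma> \<in> Hom \<C> C D \<and> d \<in> Hom \<C> D D0 \<and> c \<in> Hom \<C> D D1 \<and>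
      f \<cdot> r = Ident \<C> B \<and> g \<cdot> s = Ident \<C> B \<and> \<alpha> \<cdot> r = \<beta> \<and> \<gamma> \<cdot> s = \<beta> \<and>
      d \<cdot> \<alpha> = d \<cdot> \<beta> \<cdot> f \<and> c \<cdot> \<beta> \<cdot> g = c \<cdot> \<gamma> \<and> (d, c) \<in> \<M>"
    have "span d c" using * assms unfolding class_of_spans_def by blast
    then have "is_dikite \<C> (f, r, g, s, \<alpha>, \<beta>, \<gamma>, d, c)"
      unfolding is_dikite_def split_conv using * by blast
    moreover have "Dom \<C> f = A" "Dom \<C> g = C" "Dom \<C> d = D"
      using * by (simp_all add: Hom_def)
    ultimately show "\<exists>!m. m \<in> Hom \<C> (pb \<C> f g) D \<and>
        m \<cdot> tup \<C> f g (Ident \<C> A) (s \<cdot> f) = \<alpha> \<and>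
        m \<cdot> tup \<C> f g (r \<cdot> g) (Ident \<C> C) = \<gamma> \<and>
        d \<cdot> m = d \<cdot> \<gamma> \<cdot> pi2 \<C> f g \<and> c \<cdot> m = c \<cdot> \<alpha> \<cdot> pi1 \<C> f g"
      using H[rule_format, of "(f, r, g, s, \<alpha>, \<beta>, \<gamma>, d, c)"] *
      unfolding is_kite_multiplication_def direction_def split_conv by simp
  qed
qed

end

section \<open>Reflexive graphs as directed kites\<close>

context split_pullback_category
begin

lemma reflexive_graphD:
  assumes "is_reflexive_graph \<C> (d, e, c)"
  shows "d \<in> Arr \<C>" "e \<in> Arr \<C>" "c \<in> Arr \<C>" "Dom \<C> c = Dom \<C> d" "Cod \<C> c = Cod \<C> d"
    "Dom \<C> e = Cod \<C> d" "Cod \<C> e = Dom \<C> d" "d \<cdot> e = Ident \<C> (Cod \<C> d)" "c \<cdot> e = Ident \<C> (Cod \<C> d)"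
    "x \<in> Arr \<C> \<Longrightarrow> Cod \<C> x = Cod \<C> d \<Longrightarrow> d \<cdot> (e \<cdot> x) = x"
    "x \<in> Arr \<C> \<Longrightarrow> Cod \<C> x = Cod \<C> d \<Longrightarrow> c \<cdot> (e \<cdot> x) = x"
proof -
  show 1: "d \<in> Arr \<C>" "e \<in> Arr \<C>" "c \<in> Arr \<C>" "Dom \<C> c = Dom \<C> d" "Cod \<C> c = Cod \<C> d"
    "Dom \<C> e = Cod \<C> d" "Cod \<C> e = Dom \<C> d" "d \<cdot> e = Ident \<C> (Cod \<C> d)" "c \<cdot> e = Ident \<C> (Cod \<C> d)"
    using assms by (auto simp: is_reflexive_graph_def Hom_def)
  show "d \<cdot> (e \<cdot> x) = x" "c \<cdot> (e \<cdot> x) = x" if "x \<in> Arr \<C>" "Cod \<C> x = Cod \<C> d"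
    using at_element[OF 1(8), of x] at_element[OF 1(9), of x] 1 that by simp_all
qed

text \<open>
  Here \<open>A \<times>\<^sub>B C\<close> is the object of composable pairs, and the unit laws of a multiplicative graph
  are the two equations for the legs \<open>\<alpha> = \<gamma> = 1\<close>.
\<close>
definition graph_kite :: "'m \<Rightarrow> 'm \<Rightarrow> 'm \<Rightarrow> 'm kite" where
  "graph_kite d e c = (d, e, c, e, Ident \<C> (Dom \<C> d), e, Ident \<C> (Dom \<C> d), d, c)"

lemma is_dikite_graph_kite:
  assumes "is_reflexive_graph \<C> (d, e, c)" "span d c"
  shows "is_dikite \<C> (graph_kite d e c)"
  unfolding graph_kite_def using assms(2) reflexive_graphD[OF assms(1)] by (intro dikiteI) simp_all

lemma is_multiplicative_graph_iff:
  assumes "is_reflexive_graph \<C> (d, e, c)" "span d c"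
  shows "is_multiplicative_graph \<C> ((d, e, c), m) \<longleftrightarrow> is_kite_multiplication \<C> (graph_kite d e c) m"
  using assms reflexive_graphD[OF assms(1)]
    dikiteD(26)[OF is_dikite_graph_kite[OF assms, unfolded graph_kite_def]]
  by (auto simp: is_multiplicative_graph_def is_kite_multiplication_def graph_kite_def)

text \<open>
  The usual computation \<open>i = i (x j) = (i x) j = j\<close>, applied to the generic element \<open>x = 1\<close>.
\<close>
lemma groupoid_inverse_unique:
  assumes "is_internal_groupoid \<C> ((d, e, c), m, i)" "is_internal_groupoid \<C> ((d, e, c), m, j)"
    and s: "span d c"
  shows "i = j"
proof -
  have G: "is_reflexive_graph \<C> (d, e, c)" "is_multiplicative_graph \<C> ((d, e, c), m)"
    "is_internal_category \<C> ((d, e, c), m)"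
    using assms(1)
    by (simp_all add: is_internal_groupoid_def is_internal_category_def is_multiplicative_graph_def)
  let ?I = "Ident \<C> (Dom \<C> d)"
  note g [simp] = reflexive_graphD[OF G(1)]
  note K = is_dikite_graph_kite[OF G(1) s, unfolded graph_kite_def]
  note [simp] = dikiteD(26)[OF K]
  note m = kite_multiplicationD[OF K G(2)[unfolded is_multiplicative_graph_iff[OF G(1) s] graph_kite_def]]
  have i [simp]: "i \<in> Arr \<C>" "Dom \<C> i = Dom \<C> d" "Cod \<C> i = Dom \<C> d" "d \<cdot> i = c" "c \<cdot> i = d"
    "m \<cdot> tup \<C> d c i ?I = e \<cdot> d"
    using assms(1) by (simp_all add: is_internal_groupoid_def Hom_def)
  have j [simp]: "j \<in> Arr \<C>" "Dom \<C> j = Dom \<C> d" "Cod \<C> j = Dom \<C> d" "d \<cdot> j = c" "c \<cdot> j = d"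
    "m \<cdot> tup \<C> d c ?I j = e \<cdot> c"
    using assms(2) by (simp_all add: is_internal_groupoid_def Hom_def)
  have "m \<cdot> tup \<C> d c (m \<cdot> tup \<C> d c i ?I) j = m \<cdot> tup \<C> d c i (m \<cdot> tup \<C> d c ?I j)"
    by (rule G(3)[unfolded is_internal_category_def split_conv, THEN conjunct2, rule_format,
          where Z = "Dom \<C> d"]) (simp_all add: Hom_def)
  then show ?thesis
    using m(4)[of i] m(5)[of j] by simp
qed

end

section \<open>The box construction\<close>

context split_pullback_category
begin

abbreviation box_matching :: "'m \<Rightarrow> 'm \<Rightarrow> 'm \<Rightarrow> 'm \<Rightarrow> 'm \<Rightarrow> 'm \<Rightarrow> bool" where
  "box_matching d c x y z w \<equiv> matching d c x y z \<and> w \<in> Arr \<C> \<and> Dom \<C> w = Dom \<C> x \<and>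
    Cod \<C> w = Dom \<C> d \<and> d \<cdot> z = d \<cdot> w \<and> c \<cdot> w = c \<cdot> x"

lemma is_box_chosen:
  assumes "admits_box \<C> (d, c)"
  shows "is_box \<C> d c (box1 \<C> d c, box2 \<C> d c, box3 \<C> d c, box4 \<C> d c)"
  using assms chosen
  by (simp add: admits_box_def chosen_limits_def box1_def box2_def box3_def box4_def)

lemma box_projections:
  assumes "admits_box \<C> (d, c)"
  shows "box_matching d c (box1 \<C> d c) (box2 \<C> d c) (box3 \<C> d c) (box4 \<C> d c)"
    "Dom \<C> (box1 \<C> d c) = box_obj \<C> d c" "box_obj \<C> d c \<in> Obj \<C>"
  using is_box_chosen[OF assms] by (auto simp: is_box_def Hom_def box_obj_def)

lemma box_ex1:
  assumes "admits_box \<C> (d, c)" "box_matching d c x y z w"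
  shows "\<exists>!h. h \<in> Hom \<C> (Dom \<C> x) (box_obj \<C> d c) \<and> box1 \<C> d c \<cdot> h = x \<and>
    box2 \<C> d c \<cdot> h = y \<and> box3 \<C> d c \<cdot> h = z \<and> box4 \<C> d c \<cdot> h = w"
proof -
  let ?q1 = "box1 \<C> d c" and ?q2 = "box2 \<C> d c" and ?q3 = "box3 \<C> d c" and ?q4 = "box4 \<C> d c"
  obtain D D0 D1 Q where *: "d \<in> Hom \<C> D D0" "?q1 \<in> Hom \<C> Q D"
    and univ: "\<forall>Z. \<forall>x \<in> Hom \<C> Z D. \<forall>y \<in> Hom \<C> Z D. \<forall>z \<in> Hom \<C> Z D. \<forall>w \<in> Hom \<C> Z D.
        d \<cdot> x = d \<cdot> y \<and> c \<cdot> y = c \<cdot> z \<and> d \<cdot> z = d \<cdot> w \<and> c \<cdot> w = c \<cdot> x \<longrightarrow>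
        (\<exists>!h. h \<in> Hom \<C> Z Q \<and> ?q1 \<cdot> h = x \<and> ?q2 \<cdot> h = y \<and> ?q3 \<cdot> h = z \<and> ?q4 \<cdot> h = w)"
    using is_box_chosen[OF assms(1)] unfolding is_box_def split_conv by blast
  have Q: "Q = box_obj \<C> d c" "D = Dom \<C> d"
    using * by (simp_all add: Hom_def box_obj_def)
  show ?thesis
    using assms(2) by (intro univ[unfolded Q, rule_format]) (simp_all add: Hom_def)
qed

lemma quad:
  assumes "admits_box \<C> (d, c)" "box_matching d c x y z w"
  shows "quad \<C> d c x y z w \<in> Arr \<C>" "Dom \<C> (quad \<C> d c x y z w) = Dom \<C> x"
    "Cod \<C> (quad \<C> d c x y z w) = box_obj \<C> d c"
    "box1 \<C> d c \<cdot> quad \<C> d c x y z w = x" "box2 \<C> d c \<cdot> quad \<C> d c x y z w = y"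
    "box3 \<C> d c \<cdot> quad \<C> d c x y z w = z" "box4 \<C> d c \<cdot> quad \<C> d c x y z w = w"
  using theI'[OF box_ex1[OF assms]] unfolding quad_def by (auto simp: Hom_def)

lemma box_ext:
  assumes box: "admits_box \<C> (d, c)" and "h \<in> Arr \<C>" "k \<in> Arr \<C>" "Dom \<C> h = Dom \<C> k"
    "Cod \<C> h = box_obj \<C> d c" "Cod \<C> k = box_obj \<C> d c"
    "box1 \<C> d c \<cdot> h = box1 \<C> d c \<cdot> k" "box2 \<C> d c \<cdot> h = box2 \<C> d c \<cdot> k"
    "box3 \<C> d c \<cdot> h = box3 \<C> d c \<cdot> k" "box4 \<C> d c \<cdot> h = box4 \<C> d c \<cdot> k"
  shows "h = k"
proof -
  let ?q1 = "box1 \<C> d c" and ?q2 = "box2 \<C> d c" and ?q3 = "box3 \<C> d c" and ?q4 = "box4 \<C> d c"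
  note q [simp] = box_projections[OF box]
  have dc [simp]: "d \<in> Arr \<C>" "c \<in> Arr \<C>" "Dom \<C> c = Dom \<C> d"
    using is_box_chosen[OF box] by (auto simp: is_box_def Hom_def)
  have "box_matching d c (?q1 \<cdot> k) (?q2 \<cdot> k) (?q3 \<cdot> k) (?q4 \<cdot> k)"
    using at_element[of d ?q1 "d \<cdot> ?q2" k] at_element[of c ?q2 "c \<cdot> ?q3" k]
      at_element[of d ?q3 "d \<cdot> ?q4" k] at_element[of c ?q4 "c \<cdot> ?q1" k] assms(3,6) by simp
  from box_ex1[OF box this] show ?thesis
    using assms by (auto simp: Hom_def)
qed

lemma quad_projections:
  assumes "admits_box \<C> (d, c)"
  shows "quad \<C> d c (box1 \<C> d c) (box2 \<C> d c) (box3 \<C> d c) (box4 \<C> d c) = Ident \<C> (box_obj \<C> d c)"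
  unfolding quad_def
  by (rule the1_equality[OF box_ex1[OF assms box_projections(1)[OF assms]]])
    (use box_projections[OF assms] in \<open>simp add: Hom_def\<close>)

end

section \<open>Choosing pregroupoid structures naturally\<close>

locale span_class = split_pullback_category +
  fixes \<M> :: "('b \<times> 'b) set"
  assumes spans: "class_of_spans \<C> \<M>"
    and local_products: "contains_local_products \<C> \<M>"
begin

lemma M_span: "(d, c) \<in> \<M> \<Longrightarrow> span d c"
  using spans unfolding class_of_spans_def by blast

text \<open>
  The hypotheses are symmetric in \<open>f\<close> and \<open>g\<close>, so the span with the projections exchanged belongs to
  the class too; it is the one that multiplications on kites start from.
\<close>
lemma local_product_in_M:
  assumes "is_pullback \<C> f g p q" "r \<in> Arr \<C>" "Dom \<C> r = Cod \<C> f" "Cod \<C> r = Dom \<C> f"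
    "s \<in> Arr \<C>" "Dom \<C> s = Cod \<C> f" "Cod \<C> s = Dom \<C> g"
    "f \<cdot> r = Ident \<C> (Cod \<C> f)" "g \<cdot> s = Ident \<C> (Cod \<C> f)"
  shows "(p, q) \<in> \<M>"
proof -
  note D = is_pullbackD[OF assms(1)]
  have fr: "f \<cdot> (r \<cdot> x) = x" if "x \<in> Arr \<C>" "Cod \<C> x = Cod \<C> f" for x
    using at_element[OF assms(8), of x] that D assms by simp
  have gs: "g \<cdot> (s \<cdot> x) = x" if "x \<in> Arr \<C>" "Cod \<C> x = Cod \<C> f" for x
    using at_element[OF assms(9), of x] that D assms by simp
  let ?e1 = "pairing \<C> p q (Ident \<C> (Dom \<C> f)) (s \<cdot> f)"
  let ?e2 = "pairing \<C> p q (r \<cdot> g) (Ident \<C> (Dom \<C> g))"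
  have "?e1 \<in> Hom \<C> (Dom \<C> f) (Dom \<C> p)" "?e2 \<in> Hom \<C> (Dom \<C> g) (Dom \<C> p)"
    using pairing(1-3)[OF assms(1), of "Ident \<C> (Dom \<C> f)" "s \<cdot> f"]
      pairing(1-3)[OF assms(1), of "r \<cdot> g" "Ident \<C> (Dom \<C> g)"] D(1-8) assms(2-9) fr gs
    by (simp_all add: Hom_def)
  moreover have "p \<in> Hom \<C> (Dom \<C> p) (Dom \<C> f)" "q \<in> Hom \<C> (Dom \<C> p) (Dom \<C> g)"
    "f \<in> Hom \<C> (Dom \<C> f) (Cod \<C> f)" "r \<in> Hom \<C> (Cod \<C> f) (Dom \<C> f)"
    "g \<in> Hom \<C> (Dom \<C> g) (Cod \<C> f)" "s \<in> Hom \<C> (Cod \<C> f) (Dom \<C> g)"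
    using D assms by (simp_all add: Hom_def)
  ultimately have "local_product \<C> p ?e1 q ?e2"
    unfolding local_product_def using assms(1,8,9) by blast
  then show ?thesis
    using local_products unfolding contains_local_products_def by blast
qed

text \<open>
  In the condition the unit laws are stated for matching triples \<open>x, y, z\<close>; repeating an entry gives
  them for the pairs that occur in the definition of a pregroupoid.
\<close>
lemma natural_pregroupoid_condition_iff:
  "natural_pregroupoid_condition \<C> \<M> \<longleftrightarrow> (\<exists>p.
    (\<forall>d c. (d, c) \<in> \<M> \<longrightarrow> is_pregroupoid \<C> ((d, c), p (d, c))) \<and>
    (\<forall>d c d' c' f f0 f1. (d, c) \<in> \<M> \<longrightarrow> (d', c') \<in> \<M> \<longrightarrow>
      (f, f0, f1) \<in> span_homs \<C> (d, c) (d', c') \<longrightarrow>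
      f \<cdot> p (d, c) = p (d', c') \<cdot> kpc_map \<C> (d, c) (d', c') f))"
proof -
  have "is_pregroupoid \<C> ((d, c), p (d, c)) \<longleftrightarrow>
    p (d, c) \<in> Hom \<C> (kpc \<C> d c) (Dom \<C> d) \<and>
      (\<forall>Z. \<forall>x \<in> Hom \<C> Z (Dom \<C> d). \<forall>y \<in> Hom \<C> Z (Dom \<C> d). \<forall>z \<in> Hom \<C> Z (Dom \<C> d).
        d \<cdot> x = d \<cdot> y \<and> c \<cdot> y = c \<cdot> z \<longrightarrow>
        d \<cdot> p (d, c) \<cdot> triple \<C> d c x y z = d \<cdot> z \<and>
        c \<cdot> p (d, c) \<cdot> triple \<C> d c x y z = c \<cdot> x \<and>
        p (d, c) \<cdot> triple \<C> d c x y y = x \<and>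
        p (d, c) \<cdot> triple \<C> d c y y z = z)" (is "?L \<longleftrightarrow> ?h \<and> ?R")
    if "(d, c) \<in> \<M>" for d c and p :: "'b \<times> 'b \<Rightarrow> 'b"
  proof
    note s = M_span[OF that] spanD[OF M_span[OF that]]
    { assume L: ?L
      then show "?h \<and> ?R" using s unfolding is_pregroupoid_def split_conv
        by (auto simp: Hom_def) }
    { assume R: "?h \<and> ?R"
      have a: "d \<cdot> p (d, c) \<cdot> triple \<C> d c x y z = d \<cdot> (p (d, c) \<cdot> triple \<C> d c x y z)"
        "c \<cdot> p (d, c) \<cdot> triple \<C> d c x y z = c \<cdot> (p (d, c) \<cdot> triple \<C> d c x y z)"
        if "matching d c x y z" for x y z
        using s R that by (simp_all add: Hom_def)
      show ?L unfolding is_pregroupoid_def split_conv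
      proof (intro conjI allI ballI impI)
        show "span d c" by (rule s(1))
        show ?h using R by blast
        fix Z x y z assume el: "x \<in> Hom \<C> Z (Dom \<C> d)" "y \<in> Hom \<C> Z (Dom \<C> d)"
        show "p (d, c) \<cdot> triple \<C> d c x y y = x" if "d \<cdot> x = d \<cdot> y"
          using R el that by blast
        show "p (d, c) \<cdot> triple \<C> d c x x y = y" if "c \<cdot> x = c \<cdot> y"
          using R el that by blast
        assume "z \<in> Hom \<C> Z (Dom \<C> d)" "d \<cdot> x = d \<cdot> y \<and> c \<cdot> y = c \<cdot> z"
        moreover from this el have "matching d c x y z" by (simp add: Hom_def)
        ultimately show "d \<cdot> (p (d, c) \<cdot> triple \<C> d c x y z) = d \<cdot> z"
          "c \<cdot> (p (d, c) \<cdot> triple \<C> d c x y z) = c \<cdot> x"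
          using R el a by metis+
      qed }
  qed
  note eq = this
  show ?thesis
    unfolding natural_pregroupoid_condition_def
  proof (rule arg_cong[where f = Ex], rule ext, goal_cases)
    case (1 p)
    show ?case using eq[where p = p] by (auto split: prod.splits) blast
  qed
qed

text \<open>
  Existence for identities provides the structures, and uniqueness for a general morphism
  of spans \<open>h\<close> provides naturality: for the structures \<open>p\<close> of the source and \<open>p'\<close> of the target,
  \<open>h p\<close> and \<open>p' (h \<times> h \<times> h)\<close> are multiplications on the same kite.
\<close>
lemma natural_pregroupoid_condition_if_unique:
  assumes "\<And>d c d' c' h h0 h1. (d, c) \<in> \<M> \<Longrightarrow> (d', c') \<in> \<M> \<Longrightarrow>
    (h, h0, h1) \<in> span_homs \<C> (d, c) (d', c') \<Longrightarrow>
    \<exists>!n. is_kite_multiplication \<C> (kernel_kite d c h d' c') n"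
  shows "natural_pregroupoid_condition \<C> \<M>"
proof -
  define p where "p = (\<lambda>(d, c). THE n.
    is_kite_multiplication \<C> (kernel_kite d c (Ident \<C> (Dom \<C> d)) d c) n)"
  have p: "is_pregroupoid \<C> ((d, c), p (d, c))" if dc: "(d, c) \<in> \<M>" for d c
  proof -
    note s = M_span[OF dc] spanD[OF M_span[OF dc]]
    have "(Ident \<C> (Dom \<C> d), Ident \<C> (Cod \<C> d), Ident \<C> (Cod \<C> c)) \<in> span_homs \<C> (d, c) (d, c)"
      using s by (simp add: span_homs_def Hom_def)
    then have "is_kite_multiplication \<C> (kernel_kite d c (Ident \<C> (Dom \<C> d)) d c) (p (d, c))"
      unfolding p_def split_conv by (rule theI'[OF assms[OF dc dc]])
    then show ?thesis
      by (simp only: kernel_kite_identity(2)[OF s(1)])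
  qed
  have "f \<cdot> p (d, c) = p (d', c') \<cdot> kpc_map \<C> (d, c) (d', c') f"
    if dc: "(d, c) \<in> \<M>" and dc': "(d', c') \<in> \<M>" and f: "(f, f0, f1) \<in> span_homs \<C> (d, c) (d', c')"
    for d c d' c' f f0 f1
  proof -
    note s = M_span[OF dc] spanD[OF M_span[OF dc]] and s' = M_span[OF dc'] spanD[OF M_span[OF dc']]
    note [simp] = s s' projections_eq[OF s(5)] projections_eq[OF s(6)]
    note [simp] = span_homsD[OF f s(1) s'(1)]
    have K: "is_dikite \<C> (kernel_kite d c f d' c')"
      by (rule is_dikite_kernel_kite_hom[OF f s(1) s'(1)])
    note D = kernel_kite_multiplicationD[OF kernel_kite_identity(1)[OF s(1)] s(1)
        p[OF dc, folded kernel_kite_identity(2)[OF s(1)]]]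
    note D' = kernel_kite_multiplicationD[OF kernel_kite_identity(1)[OF s'(1)] s'(1)
        p[OF dc', folded kernel_kite_identity(2)[OF s'(1)]]]
    note [simp] = D D'
    have Dxyz: "d \<cdot> p (d, c) = d \<cdot> kpc_cod \<C> d c" "c \<cdot> p (d, c) = c \<cdot> kpc_dom \<C> d c"
      using D(6)[of "kpc_dom \<C> d c" "kpc_mid \<C> d c" "kpc_cod \<C> d c"]
        D(7)[of "kpc_dom \<C> d c" "kpc_mid \<C> d c" "kpc_cod \<C> d c"] by simp_all
    have "is_kite_multiplication \<C> (kernel_kite d c f d' c') (f \<cdot> p (d, c))"
      by (rule kernel_kite_multiplicationI[OF K]) (simp_all add: Dxyz)
    moreover
    have "is_kite_multiplication \<C> (kernel_kite d c f d' c')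
      (p (d', c') \<cdot> kpc_map \<C> (d, c) (d', c') f)"
      by (rule kernel_kite_multiplicationI[OF K]) (simp_all add: kpc_map_def triple_comp)
    ultimately show ?thesis using assms[OF dc dc' f] by blast
  qed
  with p show ?thesis
    unfolding natural_pregroupoid_condition_iff by blast
qed

end

section \<open>Calculus of a natural pregroupoid structure\<close>

locale natural_pregroupoids = span_class +
  fixes p :: "'b \<times> 'b \<Rightarrow> 'b"
  assumes p_pregroupoid: "(d, c) \<in> \<M> \<Longrightarrow> is_pregroupoid \<C> ((d, c), p (d, c))"
    and p_natural: "(d, c) \<in> \<M> \<Longrightarrow> (d', c') \<in> \<M> \<Longrightarrow>
      (f, f0, f1) \<in> span_homs \<C> (d, c) (d', c') \<Longrightarrow>
      f \<cdot> p (d, c) = p (d', c') \<cdot> kpc_map \<C> (d, c) (d', c') f"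
begin

definition P :: "'b \<Rightarrow> 'b \<Rightarrow> 'b \<Rightarrow> 'b \<Rightarrow> 'b \<Rightarrow> 'b" where
  "P d c x y z = p (d, c) \<cdot> triple \<C> d c x y z"

lemma p_arr [simp]:
  assumes "(d, c) \<in> \<M>"
  shows "p (d, c) \<in> Arr \<C>" "Dom \<C> (p (d, c)) = kpc \<C> d c" "Cod \<C> (p (d, c)) = Dom \<C> d"
  using p_pregroupoid[OF assms] by (simp_all add: is_pregroupoid_def Hom_def)

lemma P [simp]:
  assumes "(d, c) \<in> \<M>" "matching d c x y z"
  shows "P d c x y z \<in> Arr \<C>" "Dom \<C> (P d c x y z) = Dom \<C> x" "Cod \<C> (P d c x y z) = Dom \<C> d"
    "d \<cdot> P d c x y z = d \<cdot> z" "c \<cdot> P d c x y z = c \<cdot> x"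
proof -
  note s = M_span[OF assms(1)]
  note D = kernel_kite_multiplicationD[OF kernel_kite_identity(1)[OF s] s
      p_pregroupoid[OF assms(1), folded kernel_kite_identity(2)[OF s]]]
  show "P d c x y z \<in> Arr \<C>" "Dom \<C> (P d c x y z) = Dom \<C> x" "Cod \<C> (P d c x y z) = Dom \<C> d"
    using assms s by (simp_all add: P_def)
  show "d \<cdot> P d c x y z = d \<cdot> z" "c \<cdot> P d c x y z = c \<cdot> x"
    using D(6,7)[OF assms(2)] assms(2) by (simp_all add: P_def)
qed

lemma P_cancel [simp]:
  assumes "(d, c) \<in> \<M>"
  shows "matching d c x y y \<Longrightarrow> P d c x y y = x" "matching d c y y z \<Longrightarrow> P d c y y z = z"
proof -
  note s = M_span[OF assms(1)]
  note D = kernel_kite_multiplicationD[OF kernel_kite_identity(1)[OF s] s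
      p_pregroupoid[OF assms(1), folded kernel_kite_identity(2)[OF s]]]
  show "matching d c x y y \<Longrightarrow> P d c x y y = x" "matching d c y y z \<Longrightarrow> P d c y y z = z"
    using D(4)[of x y] D(5)[of y z] by (simp_all add: P_def)
qed

lemma P_comp:
  assumes "(d, c) \<in> \<M>" "matching d c x y z" "w \<in> Arr \<C>" "Cod \<C> w = Dom \<C> x"
  shows "P d c x y z \<cdot> w = P d c (x \<cdot> w) (y \<cdot> w) (z \<cdot> w)"
  using assms triple_comp[OF M_span[OF assms(1)] assms(2-4)] M_span[OF assms(1)] by (simp add: P_def)

lemma P_natural:
  assumes dc: "(d, c) \<in> \<M>" and dc': "(d', c') \<in> \<M>"
    and f: "f \<in> Arr \<C>" "Dom \<C> f = Dom \<C> d" "Cod \<C> f = Dom \<C> d'"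
    and f0: "f0 \<in> Arr \<C>" "Dom \<C> f0 = Cod \<C> d" "Cod \<C> f0 = Cod \<C> d'" "d' \<cdot> f = f0 \<cdot> d"
    and f1: "f1 \<in> Arr \<C>" "Dom \<C> f1 = Cod \<C> c" "Cod \<C> f1 = Cod \<C> c'" "c' \<cdot> f = f1 \<cdot> c"
    and xyz: "matching d c x y z"
  shows "f \<cdot> P d c x y z = P d' c' (f \<cdot> x) (f \<cdot> y) (f \<cdot> z)"
proof -
  note s = M_span[OF dc] and s' = M_span[OF dc']
  note [simp] = s s' spanD[OF s] spanD[OF s'] f f0(1-3) f1(1-3) dc dc'
  have eqs [simp]: "d' \<cdot> (f \<cdot> x) = f0 \<cdot> (d \<cdot> x)" "c' \<cdot> (f \<cdot> x) = f1 \<cdot> (c \<cdot> x)"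
    if "x \<in> Arr \<C>" "Cod \<C> x = Dom \<C> d" for x
    using at_element[OF f0(4), of x] at_element[OF f1(4), of x] that by simp_all
  have "(f, f0, f1) \<in> span_homs \<C> (d, c) (d', c')"
    using f f0 f1 by (simp add: span_homs_def Hom_def)
  note nat = p_natural[OF dc dc' this]
  have "f \<cdot> P d c x y z = (f \<cdot> p (d, c)) \<cdot> triple \<C> d c x y z"
    using xyz by (simp add: P_def)
  also have "\<dots> = P d' c' (f \<cdot> x) (f \<cdot> y) (f \<cdot> z)"
    unfolding nat using xyz by (simp add: P_def kpc_map_def triple_comp)
  finally show ?thesis .
qed

text \<open>
  The key step.  By naturality with respect to \<open>m\<close>, seen as a morphism of spans from the
  local product \<open>(A \<times>\<^sub>B C, \<pi>\<^sub>2, \<pi>\<^sub>1)\<close>, it suffices to write \<open>\<langle>x, y\<rangle>\<close> as the value of the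
  pregroupoid operation of that span at three elements on which \<open>m\<close> is prescribed.  Its two
  projections force this operation to complete the rectangle with corners \<open>\<langle>x, s f x\<rangle>\<close>,
  \<open>\<langle>r g y, s g y\<rangle>\<close>, \<open>\<langle>r g y, y\<rangle>\<close> to \<open>\<langle>x, y\<rangle>\<close>.
\<close>
lemma kite_multiplication_eq_P:
  assumes K: "is_dikite \<C> (f, r, g, s, \<alpha>, \<beta>, \<gamma>, d, c)" and dc: "(d, c) \<in> \<M>"
    and m: "is_kite_multiplication \<C> (f, r, g, s, \<alpha>, \<beta>, \<gamma>, d, c) m"
    and xy: "x \<in> Arr \<C>" "y \<in> Arr \<C>" "Dom \<C> y = Dom \<C> x" "Cod \<C> x = Dom \<C> f" "Cod \<C> y = Dom \<C> g"
      "f \<cdot> x = g \<cdot> y"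
  shows "m \<cdot> tup \<C> f g x y = P d c (\<alpha> \<cdot> x) (\<beta> \<cdot> (g \<cdot> y)) (\<gamma> \<cdot> y)"
proof -
  note [simp] = dikiteD(1-19,26)[OF K] spanD[OF dikiteD(8)[OF K]] dikite_at[OF K] xy
  note M = kite_multiplicationD[OF K m]
  note [simp] = M(1-3)
  let ?p = "pi1 \<C> f g" and ?q = "pi2 \<C> f g"
  have pq: "is_pullback \<C> f g ?p ?q"
    using dikiteD(26)[OF K] by (simp add: has_pullback_def)
  \<comment> \<open>The roles of \<open>f\<close> and \<open>g\<close> are exchanged, since \<open>m\<close> goes from the span with legs \<open>\<pi>\<^sub>2, \<pi>\<^sub>1\<close>.\<close>
  have E: "(?q, ?p) \<in> \<M>"
    by (rule local_product_in_M[OF is_pullback_sym[OF pq], of s r])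
      (simp_all add: dikiteD(20,21)[OF K])
  have m_span: "d \<cdot> m = (d \<cdot> \<gamma>) \<cdot> ?q" "c \<cdot> m = (c \<cdot> \<alpha>) \<cdot> ?p"
    using m by (simp_all add: is_kite_multiplication_def)
  let ?x = "tup \<C> f g x (s \<cdot> (f \<cdot> x))" and ?y = "tup \<C> f g (r \<cdot> (g \<cdot> y)) (s \<cdot> (g \<cdot> y))"
    and ?z = "tup \<C> f g (r \<cdot> (g \<cdot> y)) y"
  have xyz: "matching ?q ?p ?x ?y ?z" by simp
  have "P ?q ?p ?x ?y ?z = tup \<C> f g x y"
    by (rule pb_ext[OF dikiteD(26)[OF K]]) (use P[OF E xyz] in simp_all)
  moreover have "m \<cdot> P ?q ?p ?x ?y ?z = P d c (m \<cdot> ?x) (m \<cdot> ?y) (m \<cdot> ?z)"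
    by (rule P_natural[OF E dc, of m "d \<cdot> \<gamma>" "c \<cdot> \<alpha>"]) (use m_span in simp_all)
  moreover have "m \<cdot> ?x = \<alpha> \<cdot> x" "m \<cdot> ?z = \<gamma> \<cdot> y"
    using M(4)[of x] M(5)[of y] by simp_all
  moreover have "m \<cdot> ?y = \<beta> \<cdot> (g \<cdot> y)"
    using M(4)[of "r \<cdot> (g \<cdot> y)"] by simp
  ultimately show ?thesis by simp
qed

lemma kite_multiplication_unique:
  assumes K: "is_dikite \<C> K" and dir: "direction K \<in> \<M>"
    and "is_kite_multiplication \<C> K m" "is_kite_multiplication \<C> K m'"
  shows "m = m'"
proof -
  obtain f r g s \<alpha> \<beta> \<gamma> d c where K_eq: "K = (f, r, g, s, \<alpha>, \<beta>, \<gamma>, d, c)"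
    by (cases K) auto
  note K = K[unfolded K_eq] and m = assms(3,4)[unfolded K_eq]
  have dc: "(d, c) \<in> \<M>" using dir by (simp add: K_eq direction_def)
  note D = dikiteD[OF K]
  have "n = P d c (\<alpha> \<cdot> pi1 \<C> f g) (\<beta> \<cdot> (g \<cdot> pi2 \<C> f g)) (\<gamma> \<cdot> pi2 \<C> f g)"
    if n: "is_kite_multiplication \<C> (f, r, g, s, \<alpha>, \<beta>, \<gamma>, d, c) n" for n
    using kite_multiplication_eq_P[OF K dc n, of "pi1 \<C> f g" "pi2 \<C> f g"] D
      kite_multiplicationD(1,2)[OF K n] projections_eq[OF D(26)] by simp
  then show ?thesis using m by blast
qed

text \<open>Conversely the formula just obtained, at the generic element of \<open>A \<times>\<^sub>B C\<close>, is a multiplication.\<close>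
lemma is_kite_multiplication_P:
  assumes K: "is_dikite \<C> (f, r, g, s, \<alpha>, \<beta>, \<gamma>, d, c)" and dc: "(d, c) \<in> \<M>"
  shows "is_kite_multiplication \<C> (f, r, g, s, \<alpha>, \<beta>, \<gamma>, d, c)
    (P d c (\<alpha> \<cdot> pi1 \<C> f g) (\<beta> \<cdot> (g \<cdot> pi2 \<C> f g)) (\<gamma> \<cdot> pi2 \<C> f g))"
proof -
  note [simp] = dikiteD(1-19,26)[OF K] spanD[OF dikiteD(8)[OF K]] dikite_at[OF K] dc
    projections_eq[OF dikiteD(26)[OF K]]
  have [simp]: "\<alpha> \<cdot> r = \<beta>" "\<gamma> \<cdot> s = \<beta>" "f \<cdot> r = Ident \<C> (Cod \<C> f)" "g \<cdot> s = Ident \<C> (Cod \<C> f)"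
    "d \<cdot> \<alpha> = d \<cdot> (\<beta> \<cdot> f)" "c \<cdot> \<gamma> = c \<cdot> (\<beta> \<cdot> g)"
    by (rule dikiteD[OF K])+
  show ?thesis
    by (rule kite_multiplicationI[OF K]) (simp_all add: P_comp)
qed

lemma kite_condition_holds: "kite_condition \<C> \<M>"
  unfolding kite_condition_iff[OF spans]
proof (intro allI impI)
  fix K assume K: "is_dikite \<C> K \<and> direction K \<in> \<M>"
  obtain f r g s \<alpha> \<beta> \<gamma> d c where "K = (f, r, g, s, \<alpha>, \<beta>, \<gamma>, d, c)"
    by (cases K) auto
  with K have "\<exists>m. is_kite_multiplication \<C> K m"
    using is_kite_multiplication_P[of f r g s \<alpha> \<beta> \<gamma> d c]
    by (intro exI) (auto simp: direction_def)
  then show "\<exists>!m. is_kite_multiplication \<C> K m"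
    using K kite_multiplication_unique by blast
qed

lemma pregroupoid_eq_P:
  assumes "is_pregroupoid \<C> ((d, c), q)" "(d, c) \<in> \<M>"
  shows "q = p (d, c)"
  using kite_multiplication_unique[of "kernel_kite d c (Ident \<C> (Dom \<C> d)) d c"] assms
    kernel_kite_identity[OF M_span[OF assms(2)]] p_pregroupoid[OF assms(2)]
  by (simp add: kernel_kite_def direction_def)

text \<open>
  Five elements \<open>u, v, x, y, z\<close> as in the statement form a pair of elements \<open>\<langle>u, v, x\<rangle>\<close>, \<open>\<langle>x, y, z\<rangle>\<close> of
  \<open>D(d,c)\<close> that agree in \<open>x\<close>, an element of the pullback of \<open>cod\<close> and \<open>dom\<close>.  Both are split by the
  diagonal, and both sides of the equation are multiplications on the resulting kite with \<open>\<alpha> = \<gamma> = p\<close>.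
\<close>
lemma P_assoc:
  assumes dc: "(d, c) \<in> \<M>" and "matching d c u v x" "matching d c x y z" "Dom \<C> u = Dom \<C> x"
  shows "P d c u v (P d c x y z) = P d c (P d c u v x) y z"
proof -
  note s = M_span[OF dc]
  let ?I = "Ident \<C> (Dom \<C> d)"
  let ?\<Delta> = "triple \<C> d c ?I ?I ?I" and ?dom = "kpc_dom \<C> d c" and ?mid = "kpc_mid \<C> d c"
    and ?cod = "kpc_cod \<C> d c"
  let ?p = "pi1 \<C> ?cod ?dom" and ?q = "pi2 \<C> ?cod ?dom"
  note [simp] = s dc spanD[OF s]
  have p_eta: "p (d, c) = P d c ?dom ?mid ?cod" by (simp add: P_def)
  have K: "is_dikite \<C> (?cod, ?\<Delta>, ?dom, ?\<Delta>, p (d, c), ?I, p (d, c), d, c)"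
    by (rule dikiteI) (simp_all add: p_eta P_comp)
  note pb [simp] = dikiteD(26)[OF K]
  note [simp] = projections_eq[OF pb]
  have \<Delta> [simp]: "?\<Delta> \<cdot> w = triple \<C> d c w w w" if "w \<in> Arr \<C>" "Cod \<C> w = Dom \<C> d" for w
    using that by (simp add: triple_comp)
  \<comment> \<open>The shared entry is \<open>cod ?p = dom ?q\<close>, and \<open>c\<close> identifies \<open>cod ?p\<close> with \<open>mid ?p\<close>.\<close>
  have [simp]: "c \<cdot> (?dom \<cdot> ?q) = c \<cdot> (?mid \<cdot> ?p)"
    using kpc_eq_at(2)[OF s, of ?p] by simp
  let ?m = "P d c (?dom \<cdot> ?p) (?mid \<cdot> ?p) (P d c (?dom \<cdot> ?q) (?mid \<cdot> ?q) (?cod \<cdot> ?q))"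
  let ?n = "P d c (P d c (?dom \<cdot> ?p) (?mid \<cdot> ?p) (?cod \<cdot> ?p)) (?mid \<cdot> ?q) (?cod \<cdot> ?q)"
  have "is_kite_multiplication \<C> (?cod, ?\<Delta>, ?dom, ?\<Delta>, p (d, c), ?I, p (d, c), d, c) ?m"
    by (rule kite_multiplicationI[OF K]) (simp_all add: p_eta P_comp)
  moreover
  have "is_kite_multiplication \<C> (?cod, ?\<Delta>, ?dom, ?\<Delta>, p (d, c), ?I, p (d, c), d, c) ?n"
    by (rule kite_multiplicationI[OF K]) (simp_all add: p_eta P_comp)
  ultimately have eq: "?m = ?n"
    using kite_multiplication_unique[OF K] by (simp add: direction_def)
  let ?w = "tup \<C> ?cod ?dom (triple \<C> d c u v x) (triple \<C> d c x y z)"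
  have "?m \<cdot> ?w = P d c u v (P d c x y z)" "?n \<cdot> ?w = P d c (P d c u v x) y z"
    using assms by (simp_all add: P_comp)
  with eq show ?thesis by simp
qed

end

section \<open>Spans and kites under a natural pregroupoid structure\<close>

context natural_pregroupoids
begin

lemma is_cat_iso_PreGrpd: "is_cat_iso (PreGrpd \<C> \<M>) (Span \<C> \<M>) forgetful"
  unfolding PreGrpd_def Span_def
proof (rule is_cat_iso_forgetfulI)
  fix X e assume X: "(X, e) \<in> {P. is_pregroupoid \<C> P \<and> fst P \<in> \<M>}"
  then show "X \<in> {S. is_span \<C> S \<and> S \<in> \<M>}"
    using spans by (simp add: class_of_spans_def)
  fix Y e' assume Y: "(Y, e') \<in> {P. is_pregroupoid \<C> P \<and> fst P \<in> \<M>}"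
  have e: "e = p X" "e' = p Y"
    using pregroupoid_eq_P X Y by (cases X; cases Y; simp)+
  show "pregroupoid_homs \<C> (X, e) (Y, e') = span_homs \<C> X Y"
    using p_natural X Y unfolding e pregroupoid_homs_def by (cases X; cases Y; auto)
next
  fix X assume "X \<in> {S. is_span \<C> S \<and> S \<in> \<M>}"
  then show "\<exists>e. (X, e) \<in> {P. is_pregroupoid \<C> P \<and> fst P \<in> \<M>}"
    using p_pregroupoid by (cases X) auto
next
  fix X e e'
  assume "(X, e) \<in> {P. is_pregroupoid \<C> P \<and> fst P \<in> \<M>}" "(X, e') \<in> {P. is_pregroupoid \<C> P \<and> fst P \<in> \<M>}"
  then show "e = e'" using pregroupoid_eq_P[of "fst X" "snd X"] by auto
qed

lemma is_kock_pregroupoid_iff: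
  assumes "(d, c) \<in> \<M>"
  shows "is_kock_pregroupoid \<C> ((d, c), q) \<longleftrightarrow> is_pregroupoid \<C> ((d, c), q)"
proof
  assume q: "is_pregroupoid \<C> ((d, c), q)"
  have "q \<cdot> triple \<C> d c u v (q \<cdot> triple \<C> d c x y z) = q \<cdot> triple \<C> d c (q \<cdot> triple \<C> d c u v x) y z"
    if "u \<in> Hom \<C> Z (Dom \<C> d)" "v \<in> Hom \<C> Z (Dom \<C> d)" "x \<in> Hom \<C> Z (Dom \<C> d)"
      "y \<in> Hom \<C> Z (Dom \<C> d)" "z \<in> Hom \<C> Z (Dom \<C> d)"
      "d \<cdot> u = d \<cdot> v \<and> c \<cdot> v = c \<cdot> x \<and> d \<cdot> x = d \<cdot> y \<and> c \<cdot> y = c \<cdot> z" for Z u v x y z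
    using P_assoc[OF assms, of u v x y z] that pregroupoid_eq_P[OF q assms]
    by (simp add: P_def Hom_def)
  then show "is_kock_pregroupoid \<C> ((d, c), q)"
    unfolding is_kock_pregroupoid_def split_conv using q by blast
qed (simp add: is_kock_pregroupoid_def)

lemma is_cat_iso_KockGrpd: "is_cat_iso (KockGrpd \<C> \<M>) (Span \<C> \<M>) forgetful"
proof -
  have "{P. is_kock_pregroupoid \<C> P \<and> fst P \<in> \<M>} = {P. is_pregroupoid \<C> P \<and> fst P \<in> \<M>}"
    using is_kock_pregroupoid_iff by auto
  then have "KockGrpd \<C> \<M> = PreGrpd \<C> \<M>"
    by (simp add: KockGrpd_def PreGrpd_def)
  then show ?thesis using is_cat_iso_PreGrpd by simp
qed

lemma is_cat_iso_MKite: "is_cat_iso (MKite \<C> \<M>) (DiKite \<C> \<M>) forgetful"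
  unfolding MKite_def DiKite_def
proof (rule is_cat_iso_forgetfulI)
  let ?S = "{(K, m). is_dikite \<C> K \<and> direction K \<in> \<M> \<and> is_kite_multiplication \<C> K m}"
  fix X m assume X: "(X, m) \<in> ?S"
  then show "X \<in> {K. is_dikite \<C> K \<and> direction K \<in> \<M>}" by simp
  show "m = m'" if "(X, m') \<in> ?S" for m'
    using kite_multiplication_unique[of X m m'] X that by simp
  fix Y m' assume Y: "(Y, m') \<in> ?S"
  obtain f r g s \<alpha> \<beta> \<gamma> d c where X_eq: "X = (f, r, g, s, \<alpha>, \<beta>, \<gamma>, d, c)"
    by (cases X) auto
  obtain f' r' g' s' \<alpha>' \<beta>' \<gamma>' d' c' where Y_eq: "Y = (f', r', g', s', \<alpha>', \<beta>', \<gamma>', d', c')"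
    by (cases Y) auto
  have K: "is_dikite \<C> (f, r, g, s, \<alpha>, \<beta>, \<gamma>, d, c)" and dc: "(d, c) \<in> \<M>"
    and m: "is_kite_multiplication \<C> (f, r, g, s, \<alpha>, \<beta>, \<gamma>, d, c) m"
    using X by (simp_all add: X_eq direction_def)
  have K': "is_dikite \<C> (f', r', g', s', \<alpha>', \<beta>', \<gamma>', d', c')" and dc': "(d', c') \<in> \<M>"
    and m': "is_kite_multiplication \<C> (f', r', g', s', \<alpha>', \<beta>', \<gamma>', d', c') m'"
    using Y by (simp_all add: Y_eq direction_def)
  note [simp] = dikiteD(1-19,26)[OF K] spanD[OF dikiteD(8)[OF K]] dikite_at[OF K] dc
    projections_eq[OF dikiteD(26)[OF K]] kite_multiplicationD(1-3)[OF K m]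
  note [simp] = dikiteD(1-19,26)[OF K'] spanD[OF dikiteD(8)[OF K']] dikite_at[OF K'] dc'
  have "hD \<cdot> m = m' \<cdot> pb_map \<C> f g f' g' hA hC"
    if h: "(hA, hB, hC, hD, h0, h1) \<in> dikite_homs \<C> X Y" for hA hB hC hD h0 h1
  proof -
    have h [simp]: "hA \<in> Arr \<C>" "Dom \<C> hA = Dom \<C> f" "Cod \<C> hA = Dom \<C> f'"
      "hB \<in> Arr \<C>" "Dom \<C> hB = Cod \<C> f" "Cod \<C> hB = Cod \<C> f'"
      "hC \<in> Arr \<C>" "Dom \<C> hC = Dom \<C> g" "Cod \<C> hC = Dom \<C> g'"
      "hD \<in> Arr \<C>" "Dom \<C> hD = Dom \<C> d" "Cod \<C> hD = Dom \<C> d'"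
      "h0 \<in> Arr \<C>" "Dom \<C> h0 = Cod \<C> d" "Cod \<C> h0 = Cod \<C> d'"
      "h1 \<in> Arr \<C>" "Dom \<C> h1 = Cod \<C> c" "Cod \<C> h1 = Cod \<C> c'"
      and eq: "f' \<cdot> hA = hB \<cdot> f" "g' \<cdot> hC = hB \<cdot> g" "\<alpha>' \<cdot> hA = hD \<cdot> \<alpha>" "\<beta>' \<cdot> hB = hD \<cdot> \<beta>"
      "\<gamma>' \<cdot> hC = hD \<cdot> \<gamma>" "d' \<cdot> hD = h0 \<cdot> d" "c' \<cdot> hD = h1 \<cdot> c"
      using h unfolding X_eq Y_eq dikite_homs_def by (auto simp: Hom_def)
    have [simp]: "f' \<cdot> (hA \<cdot> x) = hB \<cdot> (f \<cdot> x)" "\<alpha>' \<cdot> (hA \<cdot> x) = hD \<cdot> (\<alpha> \<cdot> x)"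
      if "x \<in> Arr \<C>" "Cod \<C> x = Dom \<C> f" for x
      using at_element[OF eq(1), of x] at_element[OF eq(3), of x] that by simp_all
    have [simp]: "g' \<cdot> (hC \<cdot> x) = hB \<cdot> (g \<cdot> x)" "\<gamma>' \<cdot> (hC \<cdot> x) = hD \<cdot> (\<gamma> \<cdot> x)"
      if "x \<in> Arr \<C>" "Cod \<C> x = Dom \<C> g" for x
      using at_element[OF eq(2), of x] at_element[OF eq(5), of x] that by simp_all
    have [simp]: "\<beta>' \<cdot> (hB \<cdot> x) = hD \<cdot> (\<beta> \<cdot> x)" if "x \<in> Arr \<C>" "Cod \<C> x = Cod \<C> f" for x
      using at_element[OF eq(4), of x] that by simp
    let ?p = "pi1 \<C> f g" and ?q = "pi2 \<C> f g"
    have "hD \<cdot> m = hD \<cdot> P d c (\<alpha> \<cdot> ?p) (\<beta> \<cdot> (g \<cdot> ?q)) (\<gamma> \<cdot> ?q)"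
      using kite_multiplication_eq_P[OF K dc m, of ?p ?q] by simp
    also have "\<dots> = P d' c' (hD \<cdot> (\<alpha> \<cdot> ?p)) (hD \<cdot> (\<beta> \<cdot> (g \<cdot> ?q))) (hD \<cdot> (\<gamma> \<cdot> ?q))"
      by (rule P_natural[OF dc dc', of hD h0 h1]) (use eq in simp_all)
    also have "\<dots> = m' \<cdot> pb_map \<C> f g f' g' hA hC"
      using kite_multiplication_eq_P[OF K' dc' m', of "hA \<cdot> ?p" "hC \<cdot> ?q"] by (simp add: pb_map_def)
    finally show ?thesis .
  qed
  then show "mkite_homs \<C> (X, m) (Y, m') = dikite_homs \<C> X Y"
    unfolding mkite_homs_def X_eq Y_eq split_conv by blast
next
  fix X assume "X \<in> {K. is_dikite \<C> K \<and> direction K \<in> \<M>}"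
  then show "\<exists>m. (X, m) \<in> {(K, m). is_dikite \<C> K \<and> direction K \<in> \<M> \<and> is_kite_multiplication \<C> K m}"
    using kite_condition_holds unfolding kite_condition_iff[OF spans] by blast
qed

lemma kernel_kite_multiplication_eq_P:
  assumes "span d0 c0" and K: "is_dikite \<C> (kernel_kite d0 c0 h d c)" and dc: "(d, c) \<in> \<M>"
    and n: "is_kite_multiplication \<C> (kernel_kite d0 c0 h d c) n"
    and xyz: "matching d0 c0 x y z"
  shows "n \<cdot> triple \<C> d0 c0 x y z = P d c (h \<cdot> x) (h \<cdot> y) (h \<cdot> z)"
proof -
  note [simp] = spanD[OF assms(1)] has_pullback_kpc[OF assms(1)] dikiteD(5-7,14-19)[OF K[unfolded kernel_kite_def]]
  have h [simp]: "h \<in> Arr \<C>" "Dom \<C> h = Dom \<C> d0"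
    using dikiteD(6,15)[OF K[unfolded kernel_kite_def]] by simp_all
  show ?thesis
    using kite_multiplication_eq_P[OF K[unfolded kernel_kite_def] dc n[unfolded kernel_kite_def],
        of "tup \<C> d0 d0 x y" "tup \<C> c0 c0 y z"] xyz
    by (simp add: triple_def)
qed

text \<open>
  Put \<open>u = e\<^sub>1 p\<^sub>1\<close>, \<open>v = e\<^sub>2 p\<^sub>2\<close>, commuting idempotents on \<open>E\<close>, and \<open>w = u v\<close>.  The morphism is
  \<open>p\<langle>\<alpha> p\<^sub>1, \<alpha> p\<^sub>1 v, \<gamma> p\<^sub>2\<rangle>\<close>.  For uniqueness, joint monicity gives \<open>1 = p\<^sub>E\<langle>v, w, u\<rangle>\<close>, but a solution
  \<open>m'\<close> is a morphism of spans from \<open>(E, p\<^sub>2, p\<^sub>1)\<close>, which need not belong to the class, and not from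
  \<open>(E, p\<^sub>1, p\<^sub>2)\<close>; naturality of \<open>p\<close> is thus not available for \<open>m'\<close>.  Instead,
  \<open>\<langle>z, y, x\<rangle> \<mapsto> m' p\<^sub>E\<langle>x, y, z\<rangle>\<close> is a multiplication on the kite of the kernel pairs of \<open>p\<^sub>2\<close> and \<open>p\<^sub>1\<close>,
  and is hence equal to \<open>p\<langle>m' z, m' y, m' x\<rangle>\<close>.
\<close>
lemma relation_condition_holds: "relation_condition \<C> \<M>"
  unfolding relation_condition_def
proof (intro allI impI, elim conjE)
  fix A C E D D0 D1 p1 e1 p2 e2 \<alpha> \<gamma> d c
  assume homs: "p1 \<in> Hom \<C> E A" "e1 \<in> Hom \<C> A E" "p2 \<in> Hom \<C> E C" "e2 \<in> Hom \<C> C E"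
      "\<alpha> \<in> Hom \<C> A D" "\<gamma> \<in> Hom \<C> C D" "d \<in> Hom \<C> D D0" "c \<in> Hom \<C> D D1"
    and mono: "jointly_monic \<C> p1 p2"
    and dc: "(d, c) \<in> \<M>" and pp: "(p1, p2) \<in> \<M>"
    and sections: "p1 \<cdot> e1 = Ident \<C> A" "p2 \<cdot> e2 = Ident \<C> C"
    and commute: "(e1 \<cdot> p1) \<cdot> (e2 \<cdot> p2) = (e2 \<cdot> p2) \<cdot> (e1 \<cdot> p1)"
    and mid: "\<alpha> \<cdot> p1 \<cdot> (e2 \<cdot> p2) = \<gamma> \<cdot> p2 \<cdot> (e1 \<cdot> p1)"
    and left: "d \<cdot> \<alpha> \<cdot> p1 = d \<cdot> \<alpha> \<cdot> p1 \<cdot> (e2 \<cdot> p2)"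
    and right: "c \<cdot> \<gamma> \<cdot> p2 = c \<cdot> \<gamma> \<cdot> p2 \<cdot> (e1 \<cdot> p1)"
  note s = M_span[OF pp]
  have s': "span p2 p1" using s by (auto simp: is_span_def)
  have [simp]: "p1 \<in> Arr \<C>" "Dom \<C> p1 = E" "Cod \<C> p1 = A" "e1 \<in> Arr \<C>" "Dom \<C> e1 = A" "Cod \<C> e1 = E"
    "p2 \<in> Arr \<C>" "Dom \<C> p2 = E" "Cod \<C> p2 = C" "e2 \<in> Arr \<C>" "Dom \<C> e2 = C" "Cod \<C> e2 = E"
    "\<alpha> \<in> Arr \<C>" "Dom \<C> \<alpha> = A" "Cod \<C> \<alpha> = D" "\<gamma> \<in> Arr \<C>" "Dom \<C> \<gamma> = C" "Cod \<C> \<gamma> = D"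
    "d \<in> Arr \<C>" "Dom \<C> d = D" "Cod \<C> d = D0" "c \<in> Arr \<C>" "Dom \<C> c = D" "Cod \<C> c = D1"
    using homs by (simp_all add: Hom_def)
  have [simp]: "E \<in> Obj \<C>" "A \<in> Obj \<C>" "C \<in> Obj \<C>"
    using obj_arr(1)[of p1] obj_arr(1)[of e1] obj_arr(1)[of e2] by simp_all
  note [simp] = dc pp s s' sections
  have sec_at [simp]: "p1 \<cdot> (e1 \<cdot> x) = x" if "x \<in> Arr \<C>" "Cod \<C> x = A" for x
    using at_element[OF sections(1), of x] that by simp
  have sec_at' [simp]: "p2 \<cdot> (e2 \<cdot> x) = x" if "x \<in> Arr \<C>" "Cod \<C> x = C" for x
    using at_element[OF sections(2), of x] that by simp
  let ?u = "e1 \<cdot> p1" and ?v = "e2 \<cdot> p2" and ?w = "e1 \<cdot> (p1 \<cdot> (e2 \<cdot> p2))"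
  let ?\<beta> = "\<alpha> \<cdot> (p1 \<cdot> (e2 \<cdot> p2))"
  have comm: "e2 \<cdot> (p2 \<cdot> (e1 \<cdot> p1)) = ?w"
    using commute by simp
  have beta: "\<gamma> \<cdot> (p2 \<cdot> (e1 \<cdot> p1)) = ?\<beta>" using mid by simp
  have d_eq: "d \<cdot> (\<alpha> \<cdot> p1) = d \<cdot> ?\<beta>" using left by simp
  have c_eq: "c \<cdot> (\<gamma> \<cdot> p2) = c \<cdot> ?\<beta>" using right beta by simp
  let ?m = "P d c (\<alpha> \<cdot> p1) ?\<beta> (\<gamma> \<cdot> p2)"
  have match: "matching d c (\<alpha> \<cdot> p1) ?\<beta> (\<gamma> \<cdot> p2)"
    using d_eq c_eq by simp
  have m [simp]: "?m \<in> Arr \<C>" "Dom \<C> ?m = E" "Cod \<C> ?m = D"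
    "d \<cdot> ?m = d \<cdot> (\<gamma> \<cdot> p2)" "c \<cdot> ?m = c \<cdot> (\<alpha> \<cdot> p1)"
    using P[OF dc match] by simp_all
  have "\<gamma> \<cdot> (p2 \<cdot> e1) = \<alpha> \<cdot> (p1 \<cdot> (e2 \<cdot> (p2 \<cdot> e1)))"
    using at_element[OF beta, of e1] by simp
  moreover have "matching d c \<alpha> (\<alpha> \<cdot> (p1 \<cdot> (e2 \<cdot> (p2 \<cdot> e1)))) (\<alpha> \<cdot> (p1 \<cdot> (e2 \<cdot> (p2 \<cdot> e1))))"
    using matching_comp[OF M_span[OF dc] match, of e1] by simp
  ultimately have me1: "?m \<cdot> e1 = \<alpha>"
    using P_comp[OF dc match, of e1] by simp
  have "matching d c (\<alpha> \<cdot> (p1 \<cdot> e2)) (\<alpha> \<cdot> (p1 \<cdot> e2)) \<gamma>"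
    using matching_comp[OF M_span[OF dc] match, of e2] by simp
  then have me2: "?m \<cdot> e2 = \<gamma>"
    using P_comp[OF dc match, of e2] by simp
  have unique: "m' = ?m"
    if m': "m' \<in> Hom \<C> E D" "m' \<cdot> e1 = \<alpha>" "m' \<cdot> e2 = \<gamma>"
      "d \<cdot> m' = d \<cdot> \<gamma> \<cdot> p2" "c \<cdot> m' = c \<cdot> \<alpha> \<cdot> p1" for m'
  proof -
    have [simp]: "m' \<in> Arr \<C>" "Dom \<C> m' = E" "Cod \<C> m' = D"
      using m'(1) by (simp_all add: Hom_def)
    have d_at [simp]: "d \<cdot> (m' \<cdot> x) = d \<cdot> (\<gamma> \<cdot> (p2 \<cdot> x))" "c \<cdot> (m' \<cdot> x) = c \<cdot> (\<alpha> \<cdot> (p1 \<cdot> x))"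
      if "x \<in> Arr \<C>" "Cod \<C> x = E" for x
      using at_element[OF m'(4), of x] at_element[OF m'(5), of x] that by simp_all
    have e_at [simp]: "x \<in> Arr \<C> \<Longrightarrow> Cod \<C> x = A \<Longrightarrow> m' \<cdot> (e1 \<cdot> x) = \<alpha> \<cdot> x"
      "x \<in> Arr \<C> \<Longrightarrow> Cod \<C> x = C \<Longrightarrow> m' \<cdot> (e2 \<cdot> x) = \<gamma> \<cdot> x" for x
      using at_element[OF m'(2), of x] at_element[OF m'(3), of x] by simp_all
    let ?x = "kpc_dom \<C> p2 p1" and ?y = "kpc_mid \<C> p2 p1" and ?z = "kpc_cod \<C> p2 p1"
    let ?n = "m' \<cdot> P p1 p2 ?z ?y ?x"
    have K: "is_dikite \<C> (kernel_kite p2 p1 m' d c)"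
      by (rule is_dikite_kernel_kite)
        (simp_all add: M_span[OF dc] spanD[OF s'] projections_eq[of p1 p1] projections_eq[of p2 p2])
    have n: "is_kite_multiplication \<C> (kernel_kite p2 p1 m' d c) ?n"
      by (rule kernel_kite_multiplicationI[OF K s']) (simp_all add: P_comp)
    \<comment> \<open>The first projection of \<open>p\<^sub>E\<langle>v, w, u\<rangle>\<close> is \<open>p\<^sub>1 u = p\<^sub>1\<close>, the second \<open>p\<^sub>2 v = p\<^sub>2\<close>.\<close>
    have p2w: "p2 \<cdot> ?w = p2 \<cdot> ?u"
      using comm[symmetric] by simp
    then have "matching p1 p2 ?v ?w ?u" by simp
    note P_id = P[OF pp this]
    have "P p1 p2 ?v ?w ?u = Ident \<C> E"
      using mono[unfolded jointly_monic_def, rule_format, of "P p1 p2 ?v ?w ?u" E "Ident \<C> E"] P_id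
      by (simp add: Hom_def)
    moreover have "?n \<cdot> triple \<C> p2 p1 ?u ?w ?v = m' \<cdot> P p1 p2 ?v ?w ?u"
      using p2w by (simp add: P_comp)
    moreover have "?n \<cdot> triple \<C> p2 p1 ?u ?w ?v = P d c (m' \<cdot> ?u) (m' \<cdot> ?w) (m' \<cdot> ?v)"
      using p2w by (intro kernel_kite_multiplication_eq_P[OF s' K dc n]) simp
    ultimately show ?thesis by simp
  qed
  show "\<exists>!m. m \<in> Hom \<C> E D \<and> m \<cdot> e1 = \<alpha> \<and> m \<cdot> e2 = \<gamma> \<and>
      d \<cdot> m = d \<cdot> \<gamma> \<cdot> p2 \<and> c \<cdot> m = c \<cdot> \<alpha> \<cdot> p1"
    by (rule ex1I[of _ ?m]) (use me1 me2 unique in \<open>auto simp: Hom_def\<close>)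
qed

text \<open>A pregroupoid structure is a pseudogroupoid structure that ignores the fourth vertex of a box.\<close>
lemma has_section_PseudoGrpd:
  assumes box: "box_defined \<C> \<M>"
  shows "has_section (PseudoGrpd \<C> \<M>) (Span \<C> \<M>) forgetful"
  unfolding PseudoGrpd_def Span_def
proof (rule has_section_forgetfulI)
  let ?S = "{P. is_pseudogroupoid \<C> P \<and> fst P \<in> \<M>}"
  let ?\<sigma> = "\<lambda>(d, c). P d c (box1 \<C> d c) (box2 \<C> d c) (box3 \<C> d c)"
  show "X \<in> {S. is_span \<C> S \<and> S \<in> \<M>}" if "(X, e) \<in> ?S" for X e
    using that spans by (simp add: class_of_spans_def)
  show "pseudogroupoid_homs \<C> (X, e) (Y, e') \<subseteq> span_homs \<C> X Y" for X e Y e'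
    by (auto simp: pseudogroupoid_homs_def)
  have box': "admits_box \<C> (d, c)" if "(d, c) \<in> \<M>" for d c
    using box that by (auto simp: box_defined_def)
  show "(X, ?\<sigma> X) \<in> ?S" if X: "X \<in> {S. is_span \<C> S \<and> S \<in> \<M>}" for X
  proof -
    obtain d c where X_eq: "X = (d, c)" by (cases X)
    have dc [simp]: "(d, c) \<in> \<M>" using X by (simp add: X_eq)
    note [simp] = box'[OF dc] box_projections[OF box'[OF dc]] quad[OF box'[OF dc]] M_span[OF dc]
    show ?thesis
      by (auto simp: X_eq is_pseudogroupoid_def Hom_def P_comp)
  qed
  show "span_homs \<C> X Y \<subseteq> pseudogroupoid_homs \<C> (X, ?\<sigma> X) (Y, ?\<sigma> Y)"
    if X: "X \<in> {S. is_span \<C> S \<and> S \<in> \<M>}" and Y: "Y \<in> {S. is_span \<C> S \<and> S \<in> \<M>}" for X Y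
  proof -
    obtain d c where X_eq: "X = (d, c)" by (cases X)
    have dc [simp]: "(d, c) \<in> \<M>" using X by (simp add: X_eq)
    obtain d' c' where Y_eq: "Y = (d', c')" by (cases Y)
    have dc' [simp]: "(d', c') \<in> \<M>" using Y by (simp add: Y_eq)
    note [simp] = spanD[OF M_span[OF dc]] spanD[OF M_span[OF dc']]
      box_projections[OF box'[OF dc]] quad[OF box'[OF dc']] box_projections[OF box'[OF dc']]
    have "f \<cdot> ?\<sigma> X = ?\<sigma> Y \<cdot> box_map \<C> X Y f" if f: "(f, f0, f1) \<in> span_homs \<C> X Y" for f f0 f1
    proof -
      note [simp] = span_homsD[OF f[unfolded X_eq Y_eq] M_span[OF dc] M_span[OF dc']]
      have "f \<cdot> P d c (box1 \<C> d c) (box2 \<C> d c) (box3 \<C> d c) =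
        P d' c' (f \<cdot> box1 \<C> d c) (f \<cdot> box2 \<C> d c) (f \<cdot> box3 \<C> d c)"
        by (rule P_natural[OF dc dc', of f f0 f1]) simp_all
      then show ?thesis
        by (simp add: X_eq Y_eq box_map_def P_comp)
    qed
    then show ?thesis by (auto simp: pseudogroupoid_homs_def)
  qed
qed

end

section \<open>Categories and groupoids under a natural pregroupoid structure\<close>

context natural_pregroupoids
begin

text \<open>The general formula for the kite of a reflexive graph, where \<open>\<beta>\<close> is \<open>e\<close>.\<close>
lemma graph_multiplication_eq_P:
  assumes "is_multiplicative_graph \<C> ((d, e, c), m)" "(d, c) \<in> \<M>"
    and "x \<in> Arr \<C>" "y \<in> Arr \<C>" "Dom \<C> y = Dom \<C> x" "Cod \<C> x = Dom \<C> d" "Cod \<C> y = Dom \<C> d"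
      "d \<cdot> x = c \<cdot> y"
  shows "m \<cdot> tup \<C> d c x y = P d c x (e \<cdot> (c \<cdot> y)) y"
proof -
  have G: "is_reflexive_graph \<C> (d, e, c)"
    using assms(1) by (simp add: is_multiplicative_graph_def)
  note s = M_span[OF assms(2)]
  show ?thesis
    using kite_multiplication_eq_P[OF is_dikite_graph_kite[OF G s, unfolded graph_kite_def] assms(2)
        assms(1)[unfolded is_multiplicative_graph_iff[OF G s] graph_kite_def], of x y]
      assms reflexive_graphD[OF G] by simp
qed

lemma multiplicative_graph_ex:
  assumes "is_reflexive_graph \<C> (d, e, c)" "(d, c) \<in> \<M>"
  shows "\<exists>m. is_multiplicative_graph \<C> ((d, e, c), m)"
proof -
  note s = M_span[OF assms(2)]
  have "direction (graph_kite d e c) \<in> \<M>"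
    using assms(2) by (simp add: graph_kite_def direction_def)
  then show ?thesis
    using is_dikite_graph_kite[OF assms(1) s] is_multiplicative_graph_iff[OF assms(1) s]
      kite_condition_holds[unfolded kite_condition_iff[OF spans]] by blast
qed

lemma graph_multiplication_unique:
  assumes "is_multiplicative_graph \<C> ((d, e, c), m)" "is_multiplicative_graph \<C> ((d, e, c), m')"
    "(d, c) \<in> \<M>"
  shows "m = m'"
proof -
  have G: "is_reflexive_graph \<C> (d, e, c)"
    using assms(1) by (simp add: is_multiplicative_graph_def)
  note s = M_span[OF assms(3)]
  have "direction (graph_kite d e c) \<in> \<M>"
    using assms(3) by (simp add: graph_kite_def direction_def)
  then show ?thesis
    using is_dikite_graph_kite[OF G s] assms(1,2)[unfolded is_multiplicative_graph_iff[OF G s]]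
      kite_multiplication_unique by blast
qed

lemma graph_homsD:
  assumes G: "is_reflexive_graph \<C> (d, e, c)" and G': "is_reflexive_graph \<C> (d', e', c')"
    and h: "(h1, h0) \<in> reflexive_graph_homs \<C> (d, e, c) (d', e', c')"
  shows "h1 \<in> Arr \<C>" "Dom \<C> h1 = Dom \<C> d" "Cod \<C> h1 = Dom \<C> d'"
    "h0 \<in> Arr \<C>" "Dom \<C> h0 = Cod \<C> d" "Cod \<C> h0 = Cod \<C> d'"
    "d' \<cdot> h1 = h0 \<cdot> d" "c' \<cdot> h1 = h0 \<cdot> c" "h1 \<cdot> e = e' \<cdot> h0"
    "x \<in> Arr \<C> \<Longrightarrow> Cod \<C> x = Dom \<C> d \<Longrightarrow> d' \<cdot> (h1 \<cdot> x) = h0 \<cdot> (d \<cdot> x)"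
    "x \<in> Arr \<C> \<Longrightarrow> Cod \<C> x = Dom \<C> d \<Longrightarrow> c' \<cdot> (h1 \<cdot> x) = h0 \<cdot> (c \<cdot> x)"
    "x \<in> Arr \<C> \<Longrightarrow> Cod \<C> x = Cod \<C> d \<Longrightarrow> h1 \<cdot> (e \<cdot> x) = e' \<cdot> (h0 \<cdot> x)"
proof -
  note [simp] = reflexive_graphD(1-7)[OF G] reflexive_graphD(1-7)[OF G']
  show 1: "h1 \<in> Arr \<C>" "Dom \<C> h1 = Dom \<C> d" "Cod \<C> h1 = Dom \<C> d'"
    "h0 \<in> Arr \<C>" "Dom \<C> h0 = Cod \<C> d" "Cod \<C> h0 = Cod \<C> d'"
    "d' \<cdot> h1 = h0 \<cdot> d" "c' \<cdot> h1 = h0 \<cdot> c" "h1 \<cdot> e = e' \<cdot> h0"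
    using h by (auto simp: reflexive_graph_homs_def Hom_def)
  show "x \<in> Arr \<C> \<Longrightarrow> Cod \<C> x = Dom \<C> d \<Longrightarrow> d' \<cdot> (h1 \<cdot> x) = h0 \<cdot> (d \<cdot> x)"
    "x \<in> Arr \<C> \<Longrightarrow> Cod \<C> x = Dom \<C> d \<Longrightarrow> c' \<cdot> (h1 \<cdot> x) = h0 \<cdot> (c \<cdot> x)"
    "x \<in> Arr \<C> \<Longrightarrow> Cod \<C> x = Cod \<C> d \<Longrightarrow> h1 \<cdot> (e \<cdot> x) = e' \<cdot> (h0 \<cdot> x)"
    using at_element[OF 1(7), of x] at_element[OF 1(8), of x] at_element[OF 1(9), of x] 1 by simp_all
qed

lemma multiplicative_graph_homs_eq:
  assumes m: "is_multiplicative_graph \<C> ((d, e, c), m)" and dc: "(d, c) \<in> \<M>"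
    and m': "is_multiplicative_graph \<C> ((d', e', c'), m')" and dc': "(d', c') \<in> \<M>"
  shows "multiplicative_graph_homs \<C> ((d, e, c), m) ((d', e', c'), m') =
    reflexive_graph_homs \<C> (d, e, c) (d', e', c')"
proof -
  have G: "is_reflexive_graph \<C> (d, e, c)" and G': "is_reflexive_graph \<C> (d', e', c')"
    and m_arr [simp]: "m \<in> Arr \<C>" "Dom \<C> m = pb \<C> d c" "Cod \<C> m = Dom \<C> d"
    using m m' by (simp_all add: is_multiplicative_graph_def Hom_def)
  note K = is_dikite_graph_kite[OF G M_span[OF dc], unfolded graph_kite_def]
    and K' = is_dikite_graph_kite[OF G' M_span[OF dc'], unfolded graph_kite_def]
  note [simp] = reflexive_graphD[OF G] reflexive_graphD[OF G'] dikiteD(26)[OF K] dikiteD(26)[OF K']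
    projections_eq[OF dikiteD(26)[OF K]] dc dc'
  let ?p = "pi1 \<C> d c" and ?q = "pi2 \<C> d c"
  have "h1 \<cdot> m = m' \<cdot> pb_map \<C> d c d' c' h1 h1"
    if h: "(h1, h0) \<in> reflexive_graph_homs \<C> (d, e, c) (d', e', c')" for h1 h0
  proof -
    note h [simp] = graph_homsD[OF G G' h]
    have "h1 \<cdot> m = h1 \<cdot> P d c ?p (e \<cdot> (c \<cdot> ?q)) ?q"
      using graph_multiplication_eq_P[OF m dc, of ?p ?q] by simp
    also have "\<dots> = P d' c' (h1 \<cdot> ?p) (h1 \<cdot> (e \<cdot> (c \<cdot> ?q))) (h1 \<cdot> ?q)"
      by (rule P_natural[OF dc dc', of h1 h0 h0]) simp_all
    also have "\<dots> = m' \<cdot> pb_map \<C> d c d' c' h1 h1"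
      using graph_multiplication_eq_P[OF m' dc', of "h1 \<cdot> ?p" "h1 \<cdot> ?q"] by (simp add: pb_map_def)
    finally show ?thesis .
  qed
  then show ?thesis
    unfolding multiplicative_graph_homs_def by auto
qed

text \<open>
  Both ways of composing three arrows \<open>x, y, z\<close> become an iterated \<open>p\<close> of
  \<open>x, e c y, y, e c z, z\<close>, so associativity of \<open>p\<close> gives that of \<open>m\<close>.
\<close>
lemma is_internal_category_iff:
  assumes "(d, c) \<in> \<M>"
  shows "is_internal_category \<C> ((d, e, c), m) \<longleftrightarrow> is_multiplicative_graph \<C> ((d, e, c), m)"
proof
  assume m: "is_multiplicative_graph \<C> ((d, e, c), m)"
  then have G: "is_reflexive_graph \<C> (d, e, c)"
    by (simp add: is_multiplicative_graph_def)
  note [simp] = reflexive_graphD[OF G] assms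
  note mP = graph_multiplication_eq_P[OF m assms]
  have "m \<cdot> tup \<C> d c (m \<cdot> tup \<C> d c x y) z = m \<cdot> tup \<C> d c x (m \<cdot> tup \<C> d c y z)"
    if "x \<in> Hom \<C> Z (Dom \<C> d)" "y \<in> Hom \<C> Z (Dom \<C> d)" "z \<in> Hom \<C> Z (Dom \<C> d)"
      "d \<cdot> x = c \<cdot> y \<and> d \<cdot> y = c \<cdot> z" for Z x y z
    using that P_assoc[OF assms, of x "e \<cdot> (c \<cdot> y)" y "e \<cdot> (c \<cdot> z)" z] by (simp add: mP Hom_def)
  then show "is_internal_category \<C> ((d, e, c), m)"
    unfolding is_internal_category_def split_conv using m by blast
qed (simp add: is_internal_category_def)

text \<open>On elements this is \<open>x \<mapsto> p\<langle>e d x, x, e c x\<rangle>\<close>, the heap expression for \<open>1 \<cdot> x\<inverse> \<cdot> 1\<close>.\<close>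
definition graph_inverse :: "'b \<times> 'b \<times> 'b \<Rightarrow> 'b" where
  "graph_inverse = (\<lambda>(d, e, c). P d c (e \<cdot> d) (Ident \<C> (Dom \<C> d)) (e \<cdot> c))"

text \<open>
  The products of \<open>x\<close> and its inverse collapse after regrouping by associativity of \<open>p\<close>:
  \<open>p\<langle>x, e d x, p\<langle>e d x, x, e c x\<rangle>\<rangle> = p\<langle>p\<langle>x, e d x, e d x\<rangle>, x, e c x\<rangle> = e c x\<close>, and dually.
\<close>
lemma is_internal_groupoid_iff:
  assumes dc: "(d, c) \<in> \<M>"
  shows "is_internal_groupoid \<C> ((d, e, c), m, i) \<longleftrightarrow>
    is_multiplicative_graph \<C> ((d, e, c), m) \<and> i = graph_inverse (d, e, c)"
proof -
  let ?I = "Ident \<C> (Dom \<C> d)"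
  have inv: "is_internal_groupoid \<C> ((d, e, c), m, graph_inverse (d, e, c))"
    if m: "is_multiplicative_graph \<C> ((d, e, c), m)"
  proof -
    have G: "is_reflexive_graph \<C> (d, e, c)"
      using m by (simp add: is_multiplicative_graph_def)
    note [simp] = reflexive_graphD[OF G] dc
    let ?i = "graph_inverse (d, e, c)"
    have i [simp]: "?i \<in> Arr \<C>" "Dom \<C> ?i = Dom \<C> d" "Cod \<C> ?i = Dom \<C> d" "d \<cdot> ?i = c" "c \<cdot> ?i = d"
      by (simp_all add: graph_inverse_def)
    have "P d c ?I (e \<cdot> d) (P d c (e \<cdot> d) ?I (e \<cdot> c)) = P d c (P d c ?I (e \<cdot> d) (e \<cdot> d)) ?I (e \<cdot> c)"
      by (rule P_assoc[OF dc]) simp_all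
    then have "P d c ?I (e \<cdot> d) ?i = e \<cdot> c"
      by (simp add: graph_inverse_def)
    then have "m \<cdot> tup \<C> d c ?I ?i = e \<cdot> c"
      using graph_multiplication_eq_P[OF m dc, of ?I ?i] by simp
    moreover
    have "P d c (e \<cdot> d) ?I (P d c (e \<cdot> c) (e \<cdot> c) ?I) = P d c (P d c (e \<cdot> d) ?I (e \<cdot> c)) (e \<cdot> c) ?I"
      by (rule P_assoc[OF dc]) simp_all
    then have "P d c ?i (e \<cdot> c) ?I = e \<cdot> d"
      by (simp add: graph_inverse_def)
    then have "m \<cdot> tup \<C> d c ?i ?I = e \<cdot> d"
      using graph_multiplication_eq_P[OF m dc, of ?i ?I] by simp
    ultimately show ?thesis
      unfolding is_internal_groupoid_def split_conv is_internal_category_iff[OF dc]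
      using m by (simp add: Hom_def)
  qed
  show ?thesis
  proof
    assume i: "is_internal_groupoid \<C> ((d, e, c), m, i)"
    then have m: "is_multiplicative_graph \<C> ((d, e, c), m)"
      by (simp add: is_internal_groupoid_def is_internal_category_def)
    show "is_multiplicative_graph \<C> ((d, e, c), m) \<and> i = graph_inverse (d, e, c)"
      using m groupoid_inverse_unique[OF i inv[OF m] M_span[OF dc]] by blast
  qed (use inv in blast)
qed

lemma is_cat_iso_MG: "is_cat_iso (MG \<C> \<M>) (RG \<C> \<M>) forgetful"
  unfolding MG_def RG_def
proof (rule is_cat_iso_forgetfulI)
  let ?S = "{G. is_multiplicative_graph \<C> G \<and> span_part (fst G) \<in> \<M>}"
  fix X m assume X: "(X, m) \<in> ?S"
  obtain d e c where X_eq: "X = (d, e, c)" by (cases X)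
  show "X \<in> {G. is_reflexive_graph \<C> G \<and> span_part G \<in> \<M>}"
    using X by (simp add: X_eq is_multiplicative_graph_def)
  show "m = m'" if "(X, m') \<in> ?S" for m'
    using X that graph_multiplication_unique by (auto simp: X_eq span_part_def)
  fix Y m' assume Y: "(Y, m') \<in> ?S"
  show "multiplicative_graph_homs \<C> (X, m) (Y, m') = reflexive_graph_homs \<C> X Y"
    using X Y multiplicative_graph_homs_eq by (cases Y) (auto simp: X_eq span_part_def)
next
  fix X assume "X \<in> {G. is_reflexive_graph \<C> G \<and> span_part G \<in> \<M>}"
  then show "\<exists>m. (X, m) \<in> {G. is_multiplicative_graph \<C> G \<and> span_part (fst G) \<in> \<M>}"
    using multiplicative_graph_ex by (cases X) (auto simp: span_part_def)
qed

lemma is_cat_iso_Cat: "is_cat_iso (Cat \<C> \<M>) (RG \<C> \<M>) forgetful"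
proof -
  have "{G. is_internal_category \<C> G \<and> span_part (fst G) \<in> \<M>} =
    {G. is_multiplicative_graph \<C> G \<and> span_part (fst G) \<in> \<M>}"
    using is_internal_category_iff by (auto simp: span_part_def)
  then have "Cat \<C> \<M> = MG \<C> \<M>"
    by (simp add: Cat_def MG_def)
  then show ?thesis using is_cat_iso_MG by simp
qed

lemma graph_inverse_natural:
  assumes G: "is_reflexive_graph \<C> (d, e, c)" and G': "is_reflexive_graph \<C> (d', e', c')"
    and dc: "(d, c) \<in> \<M>" and dc': "(d', c') \<in> \<M>"
    and h: "(h1, h0) \<in> reflexive_graph_homs \<C> (d, e, c) (d', e', c')"
  shows "h1 \<cdot> graph_inverse (d, e, c) = graph_inverse (d', e', c') \<cdot> h1"
proof -
  note [simp] = reflexive_graphD[OF G] reflexive_graphD[OF G'] dc dc' graph_homsD[OF G G' h]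
  have "h1 \<cdot> graph_inverse (d, e, c) =
    P d' c' (h1 \<cdot> (e \<cdot> d)) (h1 \<cdot> Ident \<C> (Dom \<C> d)) (h1 \<cdot> (e \<cdot> c))"
    unfolding graph_inverse_def split_conv by (rule P_natural[OF dc dc', of h1 h0 h0]) simp_all
  also have "\<dots> = graph_inverse (d', e', c') \<cdot> h1"
    by (simp add: graph_inverse_def P_comp)
  finally show ?thesis .
qed

lemma is_cat_iso_Grpd: "is_cat_iso (Grpd \<C> \<M>) (RG \<C> \<M>) forgetful"
  unfolding Grpd_def RG_def
proof (rule is_cat_iso_forgetfulI)
  let ?S = "{G. is_internal_groupoid \<C> G \<and> span_part (fst G) \<in> \<M>}"
  fix X k assume X: "(X, k) \<in> ?S"
  obtain d e c where X_eq: "X = (d, e, c)" by (cases X)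
  obtain m i where k: "k = (m, i)" by (cases k)
  have dc: "(d, c) \<in> \<M>" and m: "is_multiplicative_graph \<C> ((d, e, c), m)"
    and i: "i = graph_inverse (d, e, c)"
    using X is_internal_groupoid_iff by (auto simp: X_eq k span_part_def)
  show "X \<in> {G. is_reflexive_graph \<C> G \<and> span_part G \<in> \<M>}"
    using dc m by (simp add: X_eq is_multiplicative_graph_def span_part_def)
  show "k = k'" if X': "(X, k') \<in> ?S" for k'
    using X' graph_multiplication_unique[OF m _ dc] is_internal_groupoid_iff[OF dc] i
    by (cases k') (auto simp: X_eq k)
  fix Y k' assume Y: "(Y, k') \<in> ?S"
  obtain d' e' c' where Y_eq: "Y = (d', e', c')" by (cases Y)
  obtain m' i' where k': "k' = (m', i')" by (cases k')
  have dc': "(d', c') \<in> \<M>" and m': "is_multiplicative_graph \<C> ((d', e', c'), m')"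
    and i': "i' = graph_inverse (d', e', c')"
    using Y is_internal_groupoid_iff by (auto simp: Y_eq k' span_part_def)
  have G: "is_reflexive_graph \<C> (d, e, c)" "is_reflexive_graph \<C> (d', e', c')"
    using m m' by (simp_all add: is_multiplicative_graph_def)
  show "internal_groupoid_homs \<C> (X, k) (Y, k') = reflexive_graph_homs \<C> X Y"
    unfolding internal_groupoid_homs_def X_eq Y_eq k k' split_conv
      multiplicative_graph_homs_eq[OF m dc m' dc'] i i'
    using graph_inverse_natural[OF G dc dc'] by auto
next
  fix X assume "X \<in> {G. is_reflexive_graph \<C> G \<and> span_part G \<in> \<M>}"
  moreover obtain d e c where X_eq: "X = (d, e, c)" by (cases X)
  ultimately obtain m where "(d, c) \<in> \<M>" "is_multiplicative_graph \<C> ((d, e, c), m)"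
    using multiplicative_graph_ex[of d e c] by (auto simp: span_part_def)
  then have "(X, m, graph_inverse X) \<in> {G. is_internal_groupoid \<C> G \<and> span_part (fst G) \<in> \<M>}"
    using is_internal_groupoid_iff[of d c e m "graph_inverse X"] by (simp add: X_eq span_part_def)
  then show "\<exists>k. (X, k) \<in> {G. is_internal_groupoid \<C> G \<and> span_part (fst G) \<in> \<M>}"
    by blast
qed

end

section \<open>From the other conditions back to natural pregroupoids\<close>

context span_class
begin

text \<open>The kite has legs \<open>\<alpha> = m e\<^sub>1\<close>, \<open>\<beta> = m e\<^sub>1 r\<close> and \<open>\<gamma> = m e\<^sub>2\<close>.\<close>
lemma split_square_condition_if_kite_condition:
  assumes "kite_condition \<C> \<M>"
  shows "split_square_condition \<C> \<M>"
  unfolding split_square_condition_def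
proof (intro allI impI, elim conjE)
  fix A B C E D D0 D1 p1 e1 p2 e2 f r g s d c m
  assume homs: "p1 \<in> Hom \<C> E A" "e1 \<in> Hom \<C> A E" "p2 \<in> Hom \<C> E C" "e2 \<in> Hom \<C> C E"
      "f \<in> Hom \<C> A B" "r \<in> Hom \<C> B A" "g \<in> Hom \<C> C B" "s \<in> Hom \<C> B C"
      "d \<in> Hom \<C> D D0" "c \<in> Hom \<C> D D1" "m \<in> Hom \<C> E D"
    and sq: "commutative_split_square \<C> p1 e1 p2 e2 f r g s"
    and dc: "(d, c) \<in> \<M>"
    and dm: "d \<cdot> m = d \<cdot> m \<cdot> e2 \<cdot> p2" and cm: "c \<cdot> m = c \<cdot> m \<cdot> e1 \<cdot> p1"
  have [simp]: "p1 \<in> Arr \<C>" "Dom \<C> p1 = E" "Cod \<C> p1 = A" "e1 \<in> Arr \<C>" "Dom \<C> e1 = A" "Cod \<C> e1 = E"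
    "p2 \<in> Arr \<C>" "Dom \<C> p2 = E" "Cod \<C> p2 = C" "e2 \<in> Arr \<C>" "Dom \<C> e2 = C" "Cod \<C> e2 = E"
    "f \<in> Arr \<C>" "Dom \<C> f = A" "Cod \<C> f = B" "r \<in> Arr \<C>" "Dom \<C> r = B" "Cod \<C> r = A"
    "g \<in> Arr \<C>" "Dom \<C> g = C" "Cod \<C> g = B" "s \<in> Arr \<C>" "Dom \<C> s = B" "Cod \<C> s = C"
    "d \<in> Arr \<C>" "Dom \<C> d = D" "Cod \<C> d = D0" "c \<in> Arr \<C>" "Dom \<C> c = D" "Cod \<C> c = D1"
    "m \<in> Arr \<C>" "Dom \<C> m = E" "Cod \<C> m = D"
    using homs by (simp_all add: Hom_def)
  have sq': "f \<cdot> r = Ident \<C> B" "g \<cdot> s = Ident \<C> B" "e1 \<cdot> r = e2 \<cdot> s" "p2 \<cdot> e1 = s \<cdot> f" "p1 \<cdot> e2 = r \<cdot> g"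
    using sq unfolding commutative_split_square_def by (auto simp: Hom_def)
  have er: "e1 \<cdot> (r \<cdot> x) = e2 \<cdot> (s \<cdot> x)" if "x \<in> Arr \<C>" "Cod \<C> x = B" for x
    using at_element[OF sq'(3), of x] that by simp
  have "d \<cdot> (m \<cdot> e1) = d \<cdot> (m \<cdot> (e2 \<cdot> (p2 \<cdot> e1)))" "c \<cdot> (m \<cdot> e2) = c \<cdot> (m \<cdot> (e1 \<cdot> (p1 \<cdot> e2)))"
    using at_element[OF dm, of e1] at_element[OF cm, of e2] by simp_all
  then have "d \<cdot> (m \<cdot> e1) = d \<cdot> (m \<cdot> e1 \<cdot> r) \<cdot> f" "c \<cdot> (m \<cdot> e1 \<cdot> r) \<cdot> g = c \<cdot> (m \<cdot> e2)"
    using sq'(4,5) by (simp_all add: er)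
  moreover have "m \<cdot> e2 \<cdot> s = m \<cdot> e1 \<cdot> r" using sq'(3) by simp
  ultimately have "\<exists>!n. n \<in> Hom \<C> (pb \<C> f g) D \<and>
        n \<cdot> tup \<C> f g (Ident \<C> A) (s \<cdot> f) = m \<cdot> e1 \<and>
        n \<cdot> tup \<C> f g (r \<cdot> g) (Ident \<C> C) = m \<cdot> e2 \<and>
        d \<cdot> n = d \<cdot> (m \<cdot> e2) \<cdot> pi2 \<C> f g \<and> c \<cdot> n = c \<cdot> (m \<cdot> e1) \<cdot> pi1 \<C> f g"
    using assms[unfolded kite_condition_def, rule_format,
        of f A B r g C s "m \<cdot> e1" D "m \<cdot> e1 \<cdot> r" "m \<cdot> e2" d D0 c D1] homs dc sq'(1,2)
    by (simp add: Hom_def)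
  moreover have "d \<cdot> m \<cdot> e2 = d \<cdot> (m \<cdot> e2)" "c \<cdot> m \<cdot> e1 = c \<cdot> (m \<cdot> e1)" by simp_all
  ultimately show "\<exists>!n. n \<in> Hom \<C> (pb \<C> f g) D \<and>
        n \<cdot> tup \<C> f g (Ident \<C> A) (s \<cdot> f) = m \<cdot> e1 \<and>
        n \<cdot> tup \<C> f g (r \<cdot> g) (Ident \<C> C) = m \<cdot> e2 \<and>
        d \<cdot> n = d \<cdot> m \<cdot> e2 \<cdot> pi2 \<C> f g \<and> c \<cdot> n = c \<cdot> m \<cdot> e1 \<cdot> pi1 \<C> f g"
    by simp
qed

text \<open>
  The span of a local product is a relation in the class, and the idempotents
  \<open>(a, b) \<mapsto> (a, s f a)\<close> and \<open>(a, b) \<mapsto> (r g b, b)\<close> commute because \<open>f a = g b\<close>.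
\<close>
lemma kite_condition_if_relation_condition:
  assumes "relation_condition \<C> \<M>"
  shows "kite_condition \<C> \<M>"
  unfolding kite_condition_def
proof (intro allI impI, elim conjE)
  fix A B C D D0 D1 f r g s \<alpha> \<beta> \<gamma> d c
  assume homs: "f \<in> Hom \<C> A B" "r \<in> Hom \<C> B A" "g \<in> Hom \<C> C B" "s \<in> Hom \<C> B C"
      "\<alpha> \<in> Hom \<C> A D" "\<beta> \<in> Hom \<C> B D" "\<gamma> \<in> Hom \<C> C D" "d \<in> Hom \<C> D D0" "c \<in> Hom \<C> D D1"
    and eqs: "f \<cdot> r = Ident \<C> B" "g \<cdot> s = Ident \<C> B" "\<alpha> \<cdot> r = \<beta>" "\<gamma> \<cdot> s = \<beta>"
      "d \<cdot> \<alpha> = d \<cdot> \<beta> \<cdot> f" "c \<cdot> \<beta> \<cdot> g = c \<cdot> \<gamma>"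
    and dc: "(d, c) \<in> \<M>"
  have D [simp]: "Dom \<C> f = A" "Cod \<C> f = B" "Dom \<C> g = C" "Dom \<C> d = D" "Cod \<C> d = D0" "Cod \<C> c = D1"
    using homs by (simp_all add: Hom_def)
  have K: "is_dikite \<C> (f, r, g, s, \<alpha>, \<beta>, \<gamma>, d, c)"
    using homs eqs spanD[OF M_span[OF dc]] M_span[OF dc] by (intro dikiteI) (simp_all add: Hom_def)
  note [simp] = dikiteD(1-7,26)[OF K] dikiteD(9-19)[OF K, unfolded D] spanD[OF M_span[OF dc], unfolded D]
    dikite_at[OF K, unfolded D] projections_eq[OF dikiteD(26)[OF K]]
  have objs [simp]: "A \<in> Obj \<C>" "C \<in> Obj \<C>" "B \<in> Obj \<C>"
    using obj_arr(1)[of f] obj_arr(1)[of g] obj_arr(2)[of f] by simp_all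
  let ?p = "pi1 \<C> f g" and ?q = "pi2 \<C> f g"
  let ?e = "tup \<C> f g (Ident \<C> A) (s \<cdot> f)" and ?k = "tup \<C> f g (r \<cdot> g) (Ident \<C> C)"
  have pq: "is_pullback \<C> f g ?p ?q"
    using dikiteD(26)[OF K] by (simp add: has_pullback_def)
  have E: "(?p, ?q) \<in> \<M>"
    by (rule local_product_in_M[OF pq, of r s]) (simp_all add: eqs)
  have mono: "jointly_monic \<C> ?p ?q"
    unfolding jointly_monic_def
  proof (intro allI ballI impI, elim conjE)
    fix Z h k
    assume "h \<in> Hom \<C> Z (Dom \<C> ?p)" "k \<in> Hom \<C> Z (Dom \<C> ?p)" "?p \<cdot> h = ?p \<cdot> k" "?q \<cdot> h = ?q \<cdot> k"
    then show "h = k"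
      by (intro pb_ext[OF dikiteD(26)[OF K], of h k]) (simp_all add: Hom_def)
  qed
  have arrs: "?p \<in> Hom \<C> (pb \<C> f g) A" "?q \<in> Hom \<C> (pb \<C> f g) C" "?e \<in> Hom \<C> A (pb \<C> f g)"
    "?k \<in> Hom \<C> C (pb \<C> f g)"
    by (simp_all add: Hom_def)
  have "\<exists>!m. m \<in> Hom \<C> (pb \<C> f g) D \<and> m \<cdot> ?e = \<alpha> \<and> m \<cdot> ?k = \<gamma> \<and>
      d \<cdot> m = d \<cdot> \<gamma> \<cdot> ?q \<and> c \<cdot> m = c \<cdot> \<alpha> \<cdot> ?p"
  proof (rule assms[unfolded relation_condition_def, THEN spec[of _ A], THEN spec[of _ C],
        THEN spec[of _ "pb \<C> f g"], THEN spec[of _ D], THEN spec[of _ D0], THEN spec[of _ D1],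
        THEN spec[of _ ?p], THEN spec[of _ ?e], THEN spec[of _ ?q], THEN spec[of _ ?k],
        THEN spec[of _ \<alpha>], THEN spec[of _ \<gamma>], THEN spec[of _ d], THEN spec[of _ c], THEN mp],
        intro conjI)
    show "?e \<cdot> ?p \<cdot> (?k \<cdot> ?q) = ?k \<cdot> ?q \<cdot> (?e \<cdot> ?p)"
      by (simp add: tup_comp)
    show "\<alpha> \<cdot> ?p \<cdot> (?k \<cdot> ?q) = \<gamma> \<cdot> ?q \<cdot> (?e \<cdot> ?p)"
      "d \<cdot> \<alpha> \<cdot> ?p = d \<cdot> \<alpha> \<cdot> ?p \<cdot> (?k \<cdot> ?q)" "c \<cdot> \<gamma> \<cdot> ?q = c \<cdot> \<gamma> \<cdot> ?q \<cdot> (?e \<cdot> ?p)"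
      by (simp_all add: tup_comp)
  qed (use homs arrs mono dc E in simp_all)
  then show "\<exists>!m. m \<in> Hom \<C> (pb \<C> f g) D \<and>
        m \<cdot> tup \<C> f g (Ident \<C> A) (s \<cdot> f) = \<alpha> \<and>
        m \<cdot> tup \<C> f g (r \<cdot> g) (Ident \<C> C) = \<gamma> \<and>
        d \<cdot> m = d \<cdot> \<gamma> \<cdot> pi2 \<C> f g \<and> c \<cdot> m = c \<cdot> \<alpha> \<cdot> pi1 \<C> f g" .
qed

lemma natural_pregroupoid_condition_if_kite_condition:
  assumes "kite_condition \<C> \<M>"
  shows "natural_pregroupoid_condition \<C> \<M>"
proof (rule natural_pregroupoid_condition_if_unique)
  fix d c d' c' h h0 h1
  assume dc: "(d, c) \<in> \<M>" and dc': "(d', c') \<in> \<M>" and h: "(h, h0, h1) \<in> span_homs \<C> (d, c) (d', c')"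
  have "is_dikite \<C> (kernel_kite d c h d' c')"
    by (rule is_dikite_kernel_kite_hom[OF h M_span[OF dc] M_span[OF dc']])
  moreover have "direction (kernel_kite d c h d' c') \<in> \<M>"
    using dc' by (simp add: kernel_kite_def direction_def)
  ultimately show "\<exists>!n. is_kite_multiplication \<C> (kernel_kite d c h d' c') n"
    using assms unfolding kite_condition_iff[OF spans] by blast
qed

text \<open>
  The object \<open>D(\<square>)\<close> is the corner of a split square over the kernel pairs of \<open>d\<close> and \<open>c\<close>, with
  projections \<open>\<langle>x, y, z, w\<rangle> \<mapsto> \<langle>x, y\<rangle>\<close> and \<open>\<langle>x, y, z, w\<rangle> \<mapsto> \<langle>y, z\<rangle>\<close>, split by
  \<open>\<langle>x, y\<rangle> \<mapsto> \<langle>x, y, y, x\<rangle>\<close> and \<open>\<langle>y, z\<rangle> \<mapsto> \<langle>y, y, z, z\<rangle>\<close>.  The condition for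
  the morphism \<open>h m\<close>, where \<open>m\<close> is the pseudogroupoid structure, says that the kite of the kernel
  pairs with direction \<open>(d', c')\<close> has a unique multiplication.
\<close>
lemma natural_pregroupoid_condition_if_split_square_condition:
  assumes "has_section (PseudoGrpd \<C> \<M>) (Span \<C> \<M>) forgetful" and sq: "split_square_condition \<C> \<M>"
  shows "natural_pregroupoid_condition \<C> \<M>"
proof (rule natural_pregroupoid_condition_if_unique)
  fix d c d' c' h h0 h1
  assume dc: "(d, c) \<in> \<M>" and dc': "(d', c') \<in> \<M>" and h: "(h, h0, h1) \<in> span_homs \<C> (d, c) (d', c')"
  obtain \<sigma> where "\<And>X. X \<in> {S. is_span \<C> S \<and> S \<in> \<M>} \<Longrightarrow>
      (X, \<sigma> X) \<in> {P. is_pseudogroupoid \<C> P \<and> fst P \<in> \<M>}"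
    using assms(1) unfolding PseudoGrpd_def Span_def by (rule has_section_forgetfulE) blast
  then have m': "is_pseudogroupoid \<C> ((d, c), \<sigma> (d, c))"
    using dc M_span by auto
  define m where "m = \<sigma> (d, c)"
  have box: "admits_box \<C> (d, c)" and m [simp]: "m \<in> Arr \<C>" "Dom \<C> m = box_obj \<C> d c" "Cod \<C> m = Dom \<C> d"
    using m' by (simp_all add: m_def is_pseudogroupoid_def Hom_def)
  have mx [simp]: "m \<cdot> quad \<C> d c x y y x = x" if "matching d c x y y" for x y
    using m' that by (simp add: m_def is_pseudogroupoid_def Hom_def)
  have mz [simp]: "m \<cdot> quad \<C> d c y y z z = z" if "matching d c y y z" for y z
    using m' that by (simp add: m_def is_pseudogroupoid_def Hom_def)
  have mdc: "d \<cdot> (m \<cdot> quad \<C> d c x y z w) = d \<cdot> z" "c \<cdot> (m \<cdot> quad \<C> d c x y z w) = c \<cdot> x"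
    if "box_matching d c x y z w" for x y z w
    using m' that by (simp_all add: m_def is_pseudogroupoid_def Hom_def)
  note s = M_span[OF dc] spanD[OF M_span[OF dc]] and s' = M_span[OF dc'] spanD[OF M_span[OF dc']]
  note bx = box_projections[OF box] quad[OF box]
  note [simp] = s s' bx span_homsD[OF h s(1) s'(1)] has_pullback_kpc[OF s(1)]
  let ?q1 = "box1 \<C> d c" and ?q2 = "box2 \<C> d c" and ?q3 = "box3 \<C> d c" and ?q4 = "box4 \<C> d c"
  note quad_id = quad_projections[OF box]
  let ?p1 = "tup \<C> d d ?q1 ?q2" and ?p2 = "tup \<C> c c ?q2 ?q3"
  let ?e1 = "quad \<C> d c (pi1 \<C> d d) (pi2 \<C> d d) (pi2 \<C> d d) (pi1 \<C> d d)"
  let ?e2 = "quad \<C> d c (pi1 \<C> c c) (pi1 \<C> c c) (pi2 \<C> c c) (pi2 \<C> c c)"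
  have m_eq: "d \<cdot> m = d \<cdot> ?q4" "c \<cdot> m = c \<cdot> ?q1"
    using mdc[of ?q1 ?q2 ?q3 ?q4] quad_id by simp_all
  have m_at: "d \<cdot> (m \<cdot> t) = d \<cdot> (?q4 \<cdot> t)" "c \<cdot> (m \<cdot> t) = c \<cdot> (?q1 \<cdot> t)"
    if "t \<in> Arr \<C>" "Cod \<C> t = box_obj \<C> d c" for t
    using at_element[OF m_eq(1), of t] at_element[OF m_eq(2), of t] that by simp_all
  note [simp] = projections_eq[OF s(5)] projections_eq[OF s(6)]
  have e1: "(h \<cdot> m) \<cdot> ?e1 = h \<cdot> pi1 \<C> d d" and e2: "(h \<cdot> m) \<cdot> ?e2 = h \<cdot> pi2 \<C> c c"
    by simp_all
  have quad_at: "?q1 \<cdot> (quad \<C> d c x y z w \<cdot> t) = x \<cdot> t" "?q2 \<cdot> (quad \<C> d c x y z w \<cdot> t) = y \<cdot> t"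
    "?q3 \<cdot> (quad \<C> d c x y z w \<cdot> t) = z \<cdot> t" "?q4 \<cdot> (quad \<C> d c x y z w \<cdot> t) = w \<cdot> t"
    if "box_matching d c x y z w" "t \<in> Arr \<C>" "Cod \<C> t = Dom \<C> x" for x y z w t
    using at_element[OF quad(4)[OF box that(1)], of t] at_element[OF quad(5)[OF box that(1)], of t]
      at_element[OF quad(6)[OF box that(1)], of t] at_element[OF quad(7)[OF box that(1)], of t] that
    by simp_all
  have square: "commutative_split_square \<C> ?p1 ?e1 ?p2 ?e2 (pi2 \<C> d d) (diag d) (pi1 \<C> c c) (diag c)"
    unfolding commutative_split_square_def
  proof (intro exI conjI)
    show "?e1 \<cdot> diag d = ?e2 \<cdot> diag c"
      by (rule box_ext[OF box]) (simp_all add: quad_at)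
  qed (simp_all add: Hom_def tup_comp diag_at quad_at)
  have "\<exists>!n. n \<in> Hom \<C> (pb \<C> (pi2 \<C> d d) (pi1 \<C> c c)) (Dom \<C> d') \<and>
        n \<cdot> tup \<C> (pi2 \<C> d d) (pi1 \<C> c c) (Ident \<C> (pb \<C> d d)) (diag c \<cdot> pi2 \<C> d d) = (h \<cdot> m) \<cdot> ?e1 \<and>
        n \<cdot> tup \<C> (pi2 \<C> d d) (pi1 \<C> c c) (diag d \<cdot> pi1 \<C> c c) (Ident \<C> (pb \<C> c c)) = (h \<cdot> m) \<cdot> ?e2 \<and>
        d' \<cdot> n = d' \<cdot> (h \<cdot> m) \<cdot> ?e2 \<cdot> pi2 \<C> (pi2 \<C> d d) (pi1 \<C> c c) \<and>
        c' \<cdot> n = c' \<cdot> (h \<cdot> m) \<cdot> ?e1 \<cdot> pi1 \<C> (pi2 \<C> d d) (pi1 \<C> c c)"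
  proof (rule sq[unfolded split_square_condition_def, THEN spec[of _ "pb \<C> d d"],
        THEN spec[of _ "Dom \<C> d"], THEN spec[of _ "pb \<C> c c"], THEN spec[of _ "box_obj \<C> d c"],
        THEN spec[of _ "Dom \<C> d'"], THEN spec[of _ "Cod \<C> d'"], THEN spec[of _ "Cod \<C> c'"],
        THEN spec[of _ ?p1], THEN spec[of _ ?e1], THEN spec[of _ ?p2], THEN spec[of _ ?e2],
        THEN spec[of _ "pi2 \<C> d d"], THEN spec[of _ "diag d"], THEN spec[of _ "pi1 \<C> c c"],
        THEN spec[of _ "diag c"], THEN spec[of _ d'], THEN spec[of _ c'], THEN spec[of _ "h \<cdot> m"],
        THEN mp], intro conjI)
    show "commutative_split_square \<C> ?p1 ?e1 ?p2 ?e2 (pi2 \<C> d d) (diag d) (pi1 \<C> c c) (diag c)"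
      by (rule square)
    show "d' \<cdot> (h \<cdot> m) = d' \<cdot> (h \<cdot> m) \<cdot> ?e2 \<cdot> ?p2" "c' \<cdot> (h \<cdot> m) = c' \<cdot> (h \<cdot> m) \<cdot> ?e1 \<cdot> ?p1"
      by (simp_all add: m_eq m_at quad_at)
    show "(d', c') \<in> \<M>" by (rule dc')
  qed (simp_all add: Hom_def)
  moreover have "d' \<cdot> (h \<cdot> m) \<cdot> ?e2 = d' \<cdot> (h \<cdot> pi2 \<C> c c)" "c' \<cdot> (h \<cdot> m) \<cdot> ?e1 = c' \<cdot> (h \<cdot> pi1 \<C> d d)"
    by simp_all
  ultimately show "\<exists>!n. is_kite_multiplication \<C> (kernel_kite d c h d' c') n"
    unfolding is_kite_multiplication_def kernel_kite_def split_conv e1 e2 by simp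
qed

text \<open>
  A morphism of spans \<open>f\<close> induces a morphism between the kites of kernel pairs, and the map it
  induces on their pullbacks is \<open>f \<times> f \<times> f\<close>.
\<close>
lemma natural_pregroupoid_condition_if_section_MKite:
  assumes "has_section (MKite \<C> \<M>) (DiKite \<C> \<M>) forgetful"
  shows "natural_pregroupoid_condition \<C> \<M>"
proof -
  obtain \<sigma> where \<sigma>: "\<And>K. K \<in> {K. is_dikite \<C> K \<and> direction K \<in> \<M>} \<Longrightarrow>
      (K, \<sigma> K) \<in> {(K, m). is_dikite \<C> K \<and> direction K \<in> \<M> \<and> is_kite_multiplication \<C> K m}"
    and nat: "\<And>K K' h. K \<in> {K. is_dikite \<C> K \<and> direction K \<in> \<M>} \<Longrightarrow>
      K' \<in> {K. is_dikite \<C> K \<and> direction K \<in> \<M>} \<Longrightarrow> h \<in> dikite_homs \<C> K K' \<Longrightarrow>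
      h \<in> mkite_homs \<C> (K, \<sigma> K) (K', \<sigma> K')"
    using assms unfolding MKite_def DiKite_def by (rule has_section_forgetfulE) blast
  let ?K = "\<lambda>d c. kernel_kite d c (Ident \<C> (Dom \<C> d)) d c"
  have K: "?K d c \<in> {K. is_dikite \<C> K \<and> direction K \<in> \<M>}" if "(d, c) \<in> \<M>" for d c
    using kernel_kite_identity(1)[OF M_span[OF that]] that by (simp add: direction_def kernel_kite_def)
  show ?thesis
    unfolding natural_pregroupoid_condition_iff
  proof (intro exI[of _ "\<lambda>(d, c). \<sigma> (?K d c)"] conjI allI impI; unfold split_conv)
    fix d c assume dc: "(d, c) \<in> \<M>"
    show p: "is_pregroupoid \<C> ((d, c), \<sigma> (?K d c))"
      using \<sigma>[OF K[OF dc]] kernel_kite_identity(2)[OF M_span[OF dc]] by simp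
    fix d' c' f f0 f1
    assume dc': "(d', c') \<in> \<M>" and f: "(f, f0, f1) \<in> span_homs \<C> (d, c) (d', c')"
    note s = M_span[OF dc] spanD[OF M_span[OF dc]] and s' = M_span[OF dc'] spanD[OF M_span[OF dc']]
    note [simp] = s s' span_homsD[OF f s(1) s'(1)] has_pullback_kpc[OF s(1)] has_pullback_kpc[OF s'(1)]
      projections_eq[OF s(5)] projections_eq[OF s(6)] projections_eq[OF has_pullback_kpc[OF s(1)]]
    let ?fd = "pb_map \<C> d d d' d' f f" and ?fc = "pb_map \<C> c c c' c' f f"
    have pbm [simp]: "?fd \<in> Arr \<C>" "Dom \<C> ?fd = pb \<C> d d" "Cod \<C> ?fd = pb \<C> d' d'"
      "?fc \<in> Arr \<C>" "Dom \<C> ?fc = pb \<C> c c" "Cod \<C> ?fc = pb \<C> c' c'"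
      by (simp_all add: pb_map_def)
    have "(?fd, f, ?fc, f, f0, f1) \<in> dikite_homs \<C> (?K d c) (?K d' c')"
      unfolding dikite_homs_def kernel_kite_def
      by (simp add: Hom_def pb_map_def tup_comp diag_at)
    from nat[OF K[OF dc] K[OF dc'] this]
    have "f \<cdot> \<sigma> (?K d c) = \<sigma> (?K d' c') \<cdot>
        pb_map \<C> (pi2 \<C> d d) (pi1 \<C> c c) (pi2 \<C> d' d') (pi1 \<C> c' c') ?fd ?fc"
      unfolding mkite_homs_def kernel_kite_def by simp
    also have "pb_map \<C> (pi2 \<C> d d) (pi1 \<C> c c) (pi2 \<C> d' d') (pi1 \<C> c' c') ?fd ?fc =
      kpc_map \<C> (d, c) (d', c') f"
      by (simp add: pb_map_def kpc_map_def triple_def tup_comp kpc_dom_def kpc_mid_def kpc_cod_def)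
    finally show "f \<cdot> \<sigma> (?K d c) = \<sigma> (?K d' c') \<cdot> kpc_map \<C> (d, c) (d', c') f" .
  qed
qed

lemma natural_pregroupoid_condition_if_section_PreGrpd:
  assumes "has_section (PreGrpd \<C> \<M>) (Span \<C> \<M>) forgetful"
  shows "natural_pregroupoid_condition \<C> \<M>"
proof -
  obtain \<sigma> where \<sigma>: "\<And>X. X \<in> {S. is_span \<C> S \<and> S \<in> \<M>} \<Longrightarrow>
      (X, \<sigma> X) \<in> {P. is_pregroupoid \<C> P \<and> fst P \<in> \<M>}"
    and nat: "\<And>X Y h. X \<in> {S. is_span \<C> S \<and> S \<in> \<M>} \<Longrightarrow> Y \<in> {S. is_span \<C> S \<and> S \<in> \<M>} \<Longrightarrow>
      h \<in> span_homs \<C> X Y \<Longrightarrow> h \<in> pregroupoid_homs \<C> (X, \<sigma> X) (Y, \<sigma> Y)"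
    using assms unfolding PreGrpd_def Span_def by (rule has_section_forgetfulE) blast
  show ?thesis
    unfolding natural_pregroupoid_condition_iff
  proof (intro exI[of _ \<sigma>] conjI allI impI)
    show "is_pregroupoid \<C> ((d, c), \<sigma> (d, c))" if "(d, c) \<in> \<M>" for d c
      using \<sigma>[of "(d, c)"] M_span that by simp
    show "f \<cdot> \<sigma> (d, c) = \<sigma> (d', c') \<cdot> kpc_map \<C> (d, c) (d', c') f"
      if "(d, c) \<in> \<M>" "(d', c') \<in> \<M>" "(f, f0, f1) \<in> span_homs \<C> (d, c) (d', c')"
      for d c d' c' f f0 f1
      using nat[of "(d, c)" "(d', c')" "(f, f0, f1)"] M_span that by (simp add: pregroupoid_homs_def)
  qed
qed

lemma natural_pregroupoid_condition_if_section_KockGrpd: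
  assumes "has_section (KockGrpd \<C> \<M>) (Span \<C> \<M>) forgetful"
  shows "natural_pregroupoid_condition \<C> \<M>"
proof (rule natural_pregroupoid_condition_if_section_PreGrpd)
  obtain \<sigma> where "\<And>X. X \<in> {S. is_span \<C> S \<and> S \<in> \<M>} \<Longrightarrow>
      (X, \<sigma> X) \<in> {P. is_kock_pregroupoid \<C> P \<and> fst P \<in> \<M>}"
    and "\<And>X Y h. X \<in> {S. is_span \<C> S \<and> S \<in> \<M>} \<Longrightarrow> Y \<in> {S. is_span \<C> S \<and> S \<in> \<M>} \<Longrightarrow>
      h \<in> span_homs \<C> X Y \<Longrightarrow> h \<in> pregroupoid_homs \<C> (X, \<sigma> X) (Y, \<sigma> Y)"
    using assms unfolding KockGrpd_def Span_def by (rule has_section_forgetfulE) blast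
  then show "has_section (PreGrpd \<C> \<M>) (Span \<C> \<M>) forgetful"
    unfolding PreGrpd_def Span_def using spans
    by (intro has_section_forgetfulI[where \<sigma> = \<sigma>])
      (auto simp: class_of_spans_def is_kock_pregroupoid_def pregroupoid_homs_def)
qed

text \<open>
  The kernel pair construction turns a span into the reflexive graph
  \<open>(D(d,c), D, dom, \<Delta>, cod)\<close>, whose multiplication \<open>\<mu>\<close> composes \<open>\<langle>y, x, x\<rangle>\<close> and \<open>\<langle>z, z, y\<rangle>\<close> to a
  triple \<open>\<langle>z, q, x\<rangle>\<close>.  That this is a matching triple means \<open>d q = d z\<close> and \<open>c q = c x\<close>; for
  \<open>y = z\<close> or \<open>x = y\<close> one factor is an identity, and the unit laws of \<open>\<mu>\<close> give
  the unit laws of the pregroupoid.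
\<close>
lemma natural_pregroupoid_condition_if_section_MG:
  assumes closed: "closed_under_kernel_pair_construction \<C> \<M>"
    and "has_section (MG \<C> \<M>) (RG \<C> \<M>) forgetful"
  shows "natural_pregroupoid_condition \<C> \<M>"
proof -
  let ?R = "{G. is_reflexive_graph \<C> G \<and> span_part G \<in> \<M>}"
  obtain \<mu> where \<mu>: "\<And>G. G \<in> ?R \<Longrightarrow> (G, \<mu> G) \<in> {G. is_multiplicative_graph \<C> G \<and> span_part (fst G) \<in> \<M>}"
    and nat: "\<And>G G' h. G \<in> ?R \<Longrightarrow> G' \<in> ?R \<Longrightarrow> h \<in> reflexive_graph_homs \<C> G G' \<Longrightarrow>
      h \<in> multiplicative_graph_homs \<C> (G, \<mu> G) (G', \<mu> G')"
    using assms(2) unfolding MG_def RG_def by (rule has_section_forgetfulE) blast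
  define \<Delta> where "\<Delta> d c = triple \<C> d c (Ident \<C> (Dom \<C> d)) (Ident \<C> (Dom \<C> d)) (Ident \<C> (Dom \<C> d))" for d c
  define G where "G d c = (kpc_dom \<C> d c, \<Delta> d c, kpc_cod \<C> d c)" for d c
  have \<Delta>_at: "\<Delta> d c \<cdot> x = triple \<C> d c x x x" if "span d c" "x \<in> Arr \<C>" "Cod \<C> x = Dom \<C> d" for d c x
    using that spanD[OF that(1)] by (simp add: \<Delta>_def triple_comp)
  have G: "G d c \<in> ?R" if dc: "(d, c) \<in> \<M>" for d c
  proof -
    note [simp] = M_span[OF dc] spanD[OF M_span[OF dc]]
    have "is_reflexive_graph \<C> (G d c)"
      unfolding G_def is_reflexive_graph_def split_conv
      by (intro exI[of _ "kpc \<C> d c"] exI[of _ "Dom \<C> d"]) (simp add: \<Delta>_def Hom_def)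
    moreover have "span_part (G d c) \<in> \<M>"
      using closed dc by (auto simp: closed_under_kernel_pair_construction_def G_def span_part_def)
    ultimately show ?thesis by simp
  qed
  define q where "q d c x y z = kpc_mid \<C> d c \<cdot> (\<mu> (G d c) \<cdot>
      tup \<C> (kpc_dom \<C> d c) (kpc_cod \<C> d c) (triple \<C> d c y x x) (triple \<C> d c z z y))" for d c x y z
  have GD: "has_pullback (kpc_dom \<C> d c) (kpc_cod \<C> d c)"
      "\<mu> (G d c) \<in> Arr \<C>" "Dom \<C> (\<mu> (G d c)) = pb \<C> (kpc_dom \<C> d c) (kpc_cod \<C> d c)"
      "Cod \<C> (\<mu> (G d c)) = kpc \<C> d c"
      "x \<in> Arr \<C> \<Longrightarrow> Cod \<C> x = kpc \<C> d c \<Longrightarrow> \<mu> (G d c) \<cdot>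
        tup \<C> (kpc_dom \<C> d c) (kpc_cod \<C> d c) x (\<Delta> d c \<cdot> (kpc_dom \<C> d c \<cdot> x)) = x"
      "x \<in> Arr \<C> \<Longrightarrow> Cod \<C> x = kpc \<C> d c \<Longrightarrow> \<mu> (G d c) \<cdot>
        tup \<C> (kpc_dom \<C> d c) (kpc_cod \<C> d c) (\<Delta> d c \<cdot> (kpc_cod \<C> d c \<cdot> x)) x = x"
      "t \<in> Arr \<C> \<Longrightarrow> Cod \<C> t = pb \<C> (kpc_dom \<C> d c) (kpc_cod \<C> d c) \<Longrightarrow>
        kpc_dom \<C> d c \<cdot> (\<mu> (G d c) \<cdot> t) = kpc_dom \<C> d c \<cdot> (pi2 \<C> (kpc_dom \<C> d c) (kpc_cod \<C> d c) \<cdot> t)"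
      "t \<in> Arr \<C> \<Longrightarrow> Cod \<C> t = pb \<C> (kpc_dom \<C> d c) (kpc_cod \<C> d c) \<Longrightarrow>
        kpc_cod \<C> d c \<cdot> (\<mu> (G d c) \<cdot> t) = kpc_cod \<C> d c \<cdot> (pi1 \<C> (kpc_dom \<C> d c) (kpc_cod \<C> d c) \<cdot> t)"
    if dc: "(d, c) \<in> \<M>" for d c x t
  proof -
    have r: "is_reflexive_graph \<C> (kpc_dom \<C> d c, \<Delta> d c, kpc_cod \<C> d c)"
      and s: "span (kpc_dom \<C> d c) (kpc_cod \<C> d c)"
      and m: "is_multiplicative_graph \<C> ((kpc_dom \<C> d c, \<Delta> d c, kpc_cod \<C> d c), \<mu> (G d c))"
      using G[OF dc] \<mu>[OF G[OF dc]] M_span by (auto simp: G_def span_part_def)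
    note K = is_dikite_graph_kite[OF r s, unfolded graph_kite_def]
    note D = kite_multiplicationD[OF K m[unfolded is_multiplicative_graph_iff[OF r s] graph_kite_def]]
    note [simp] = M_span[OF dc] dikiteD(26)[OF K]
    show "has_pullback (kpc_dom \<C> d c) (kpc_cod \<C> d c)" by simp
    show "\<mu> (G d c) \<in> Arr \<C>" "Dom \<C> (\<mu> (G d c)) = pb \<C> (kpc_dom \<C> d c) (kpc_cod \<C> d c)"
      "Cod \<C> (\<mu> (G d c)) = kpc \<C> d c"
      using D(1-3) by simp_all
    show "x \<in> Arr \<C> \<Longrightarrow> Cod \<C> x = kpc \<C> d c \<Longrightarrow> \<mu> (G d c) \<cdot>
        tup \<C> (kpc_dom \<C> d c) (kpc_cod \<C> d c) x (\<Delta> d c \<cdot> (kpc_dom \<C> d c \<cdot> x)) = x"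
      using D(4)[of x] by simp
    show "x \<in> Arr \<C> \<Longrightarrow> Cod \<C> x = kpc \<C> d c \<Longrightarrow> \<mu> (G d c) \<cdot>
        tup \<C> (kpc_dom \<C> d c) (kpc_cod \<C> d c) (\<Delta> d c \<cdot> (kpc_cod \<C> d c \<cdot> x)) x = x"
      using D(5)[of x] by simp
    show "t \<in> Arr \<C> \<Longrightarrow> Cod \<C> t = pb \<C> (kpc_dom \<C> d c) (kpc_cod \<C> d c) \<Longrightarrow>
        kpc_dom \<C> d c \<cdot> (\<mu> (G d c) \<cdot> t) = kpc_dom \<C> d c \<cdot> (pi2 \<C> (kpc_dom \<C> d c) (kpc_cod \<C> d c) \<cdot> t)"
      "t \<in> Arr \<C> \<Longrightarrow> Cod \<C> t = pb \<C> (kpc_dom \<C> d c) (kpc_cod \<C> d c) \<Longrightarrow>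
        kpc_cod \<C> d c \<cdot> (\<mu> (G d c) \<cdot> t) = kpc_cod \<C> d c \<cdot> (pi1 \<C> (kpc_dom \<C> d c) (kpc_cod \<C> d c) \<cdot> t)"
      using D(6,7)[of t] by simp_all
  qed
  define p where "p = (\<lambda>(d, c). q d c (kpc_dom \<C> d c) (kpc_mid \<C> d c) (kpc_cod \<C> d c))"
  have q_comp: "q d c x y z \<cdot> w = q d c (x \<cdot> w) (y \<cdot> w) (z \<cdot> w)"
    if dc: "(d, c) \<in> \<M>" and xyz: "matching d c x y z" and w: "w \<in> Arr \<C>" "Cod \<C> w = Dom \<C> x"
    for d c x y z w
  proof -
    have "matching d c y x x" "matching d c z z y" using xyz by simp_all
    note [simp] = matching_comp[OF M_span[OF dc] this(1), of w] matching_comp[OF M_span[OF dc] this(2), of w]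
    show ?thesis
      using M_span[OF dc] GD[OF dc] xyz w by (simp add: q_def tup_comp triple_comp)
  qed
  have q_arr: "q d c x y z \<in> Arr \<C>" "Dom \<C> (q d c x y z) = Dom \<C> x" "Cod \<C> (q d c x y z) = Dom \<C> d"
    "d \<cdot> q d c x y z = d \<cdot> z" "c \<cdot> q d c x y z = c \<cdot> x"
    if dc: "(d, c) \<in> \<M>" and xyz: "matching d c x y z" for d c x y z
  proof -
    note [simp] = M_span[OF dc] GD(1-4)[OF dc] xyz
    let ?t = "tup \<C> (kpc_dom \<C> d c) (kpc_cod \<C> d c) (triple \<C> d c y x x) (triple \<C> d c z z y)"
    show "q d c x y z \<in> Arr \<C>" "Dom \<C> (q d c x y z) = Dom \<C> x" "Cod \<C> (q d c x y z) = Dom \<C> d"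
      using xyz by (simp_all add: q_def)
    have "kpc_dom \<C> d c \<cdot> (\<mu> (G d c) \<cdot> ?t) = z" "kpc_cod \<C> d c \<cdot> (\<mu> (G d c) \<cdot> ?t) = x"
      using GD(7,8)[OF dc, of ?t] xyz by simp_all
    then show "d \<cdot> q d c x y z = d \<cdot> z" "c \<cdot> q d c x y z = c \<cdot> x"
      using kpc_eq_at[OF M_span[OF dc], of "\<mu> (G d c) \<cdot> ?t"] xyz by (simp_all add: q_def)
  qed
  have q_cancel: "matching d c x y y \<Longrightarrow> q d c x y y = x" "matching d c y y z \<Longrightarrow> q d c y y z = z"
    if dc: "(d, c) \<in> \<M>" for d c x y z
    using GD(5)[OF dc, of "triple \<C> d c y x x"] GD(6)[OF dc, of "triple \<C> d c z z y"] M_span[OF dc]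
    by (simp_all add: q_def \<Delta>_at)
  have p_triple: "p (d, c) \<cdot> triple \<C> d c x y z = q d c x y z"
    if dc: "(d, c) \<in> \<M>" and xyz: "matching d c x y z" for d c x y z
    using q_comp[OF dc, of "kpc_dom \<C> d c" "kpc_mid \<C> d c" "kpc_cod \<C> d c" "triple \<C> d c x y z"]
      M_span[OF dc] xyz by (simp add: p_def)
  have p_arr: "p (d, c) \<in> Hom \<C> (kpc \<C> d c) (Dom \<C> d)" if dc: "(d, c) \<in> \<M>" for d c
    using q_arr(1-3)[OF dc, of "kpc_dom \<C> d c" "kpc_mid \<C> d c" "kpc_cod \<C> d c"] M_span[OF dc]
    by (simp add: p_def Hom_def)
  show ?thesis
    unfolding natural_pregroupoid_condition_iff
  proof (intro exI[of _ p] conjI allI impI)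
    fix d c assume dc: "(d, c) \<in> \<M>"
    show "is_pregroupoid \<C> ((d, c), p (d, c))"
      using M_span[OF dc] p_arr[OF dc] p_triple[OF dc] q_cancel[OF dc] q_arr[OF dc]
      by (auto simp: is_pregroupoid_def Hom_def)
    fix d' c' f f0 f1
    assume dc': "(d', c') \<in> \<M>" and f: "(f, f0, f1) \<in> span_homs \<C> (d, c) (d', c')"
    note s = M_span[OF dc] spanD[OF M_span[OF dc]] and s' = M_span[OF dc'] spanD[OF M_span[OF dc']]
    note [simp] = s s' span_homsD[OF f s(1) s'(1)] GD(1-4)[OF dc] GD(1-4)[OF dc']
    let ?F = "kpc_map \<C> (d, c) (d', c') f"
    have F [simp]: "?F \<in> Arr \<C>" "Dom \<C> ?F = kpc \<C> d c" "Cod \<C> ?F = kpc \<C> d' c'"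
      "kpc_mid \<C> d' c' \<cdot> ?F = f \<cdot> kpc_mid \<C> d c"
      by (simp_all add: kpc_map_def)
    have F_at [simp]: "kpc_dom \<C> d' c' \<cdot> (?F \<cdot> t) = f \<cdot> (kpc_dom \<C> d c \<cdot> t)"
      "kpc_cod \<C> d' c' \<cdot> (?F \<cdot> t) = f \<cdot> (kpc_cod \<C> d c \<cdot> t)"
      if "t \<in> Arr \<C>" "Cod \<C> t = kpc \<C> d c" for t
      using that by (simp_all add: kpc_map_def)
    have F_triple: "?F \<cdot> triple \<C> d c x y z = triple \<C> d' c' (f \<cdot> x) (f \<cdot> y) (f \<cdot> z)"
      if "matching d c x y z" for x y z
      using that by (simp add: kpc_map_def triple_comp)
    have "(?F, f) \<in> reflexive_graph_homs \<C> (G d c) (G d' c')"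
      by (simp add: reflexive_graph_homs_def G_def Hom_def \<Delta>_def kpc_map_def triple_comp)
    from nat[OF G[OF dc] G[OF dc'] this]
    have F_nat: "?F \<cdot> \<mu> (G d c) = \<mu> (G d' c') \<cdot> pb_map \<C> (kpc_dom \<C> d c) (kpc_cod \<C> d c)
        (kpc_dom \<C> d' c') (kpc_cod \<C> d' c') ?F ?F"
      unfolding multiplicative_graph_homs_def G_def by simp
    let ?x = "kpc_dom \<C> d c" and ?y = "kpc_mid \<C> d c" and ?z = "kpc_cod \<C> d c"
    let ?t = "tup \<C> ?x ?z (triple \<C> d c ?y ?x ?x) (triple \<C> d c ?z ?z ?y)"
    have "f \<cdot> p (d, c) = f \<cdot> (?y \<cdot> (\<mu> (G d c) \<cdot> ?t))"
      by (simp add: p_def q_def)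
    also have "\<dots> = kpc_mid \<C> d' c' \<cdot> ((?F \<cdot> \<mu> (G d c)) \<cdot> ?t)"
      using at_element[OF F(4), of "\<mu> (G d c) \<cdot> ?t"] by simp
    also have "\<dots> = q d' c' (f \<cdot> ?x) (f \<cdot> ?y) (f \<cdot> ?z)"
      unfolding F_nat by (simp add: pb_map_def tup_comp F_triple q_def projections_eq[OF GD(1)[OF dc]])
    also have "\<dots> = p (d', c') \<cdot> ?F"
      using p_triple[OF dc', of "f \<cdot> ?x" "f \<cdot> ?y" "f \<cdot> ?z"] by (simp add: kpc_map_def)
    finally show "f \<cdot> p (d, c) = p (d', c') \<cdot> ?F" .
  qed
qed

lemma has_section_MG_if_section_Cat:
  assumes "has_section (Cat \<C> \<M>) (RG \<C> \<M>) forgetful"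
  shows "has_section (MG \<C> \<M>) (RG \<C> \<M>) forgetful"
proof -
  let ?R = "{G. is_reflexive_graph \<C> G \<and> span_part G \<in> \<M>}"
  obtain \<mu> where "\<And>G. G \<in> ?R \<Longrightarrow> (G, \<mu> G) \<in> {G. is_internal_category \<C> G \<and> span_part (fst G) \<in> \<M>}"
    and "\<And>G G' h. G \<in> ?R \<Longrightarrow> G' \<in> ?R \<Longrightarrow> h \<in> reflexive_graph_homs \<C> G G' \<Longrightarrow>
      h \<in> multiplicative_graph_homs \<C> (G, \<mu> G) (G', \<mu> G')"
    using assms unfolding Cat_def RG_def by (rule has_section_forgetfulE) blast
  then show ?thesis
    unfolding MG_def RG_def
    by (intro has_section_forgetfulI[where \<sigma> = \<mu>])
      (auto simp: is_internal_category_def is_multiplicative_graph_def multiplicative_graph_homs_def)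
qed

lemma has_section_MG_if_section_Grpd:
  assumes "has_section (Grpd \<C> \<M>) (RG \<C> \<M>) forgetful"
  shows "has_section (MG \<C> \<M>) (RG \<C> \<M>) forgetful"
proof -
  let ?R = "{G. is_reflexive_graph \<C> G \<and> span_part G \<in> \<M>}"
  obtain \<mu> where \<mu>: "\<And>G. G \<in> ?R \<Longrightarrow> (G, \<mu> G) \<in> {G. is_internal_groupoid \<C> G \<and> span_part (fst G) \<in> \<M>}"
    and nat: "\<And>G G' h. G \<in> ?R \<Longrightarrow> G' \<in> ?R \<Longrightarrow> h \<in> reflexive_graph_homs \<C> G G' \<Longrightarrow>
      h \<in> internal_groupoid_homs \<C> (G, \<mu> G) (G', \<mu> G')"
    using assms unfolding Grpd_def RG_def by (rule has_section_forgetfulE) blast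
  show ?thesis
    unfolding MG_def RG_def
  proof (rule has_section_forgetfulI[where \<sigma> = "\<lambda>G. fst (\<mu> G)"])
    show "(G, fst (\<mu> G)) \<in> {G. is_multiplicative_graph \<C> G \<and> span_part (fst G) \<in> \<M>}" if "G \<in> ?R" for G
      using \<mu>[OF that] by (cases G; cases "\<mu> G")
        (simp add: is_internal_groupoid_def is_internal_category_def)
    show "reflexive_graph_homs \<C> G G' \<subseteq> multiplicative_graph_homs \<C> (G, fst (\<mu> G)) (G', fst (\<mu> G'))"
      if "G \<in> ?R" "G' \<in> ?R" for G G'
      using nat[OF that] by (cases "\<mu> G"; cases "\<mu> G'") (auto simp: internal_groupoid_homs_def)
  qed (auto simp: is_multiplicative_graph_def multiplicative_graph_homs_def)
qed

lemma natural_pregroupoidsE: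
  assumes "natural_pregroupoid_condition \<C> \<M>"
  obtains p where "natural_pregroupoids \<C> \<M> p"
proof -
  from assms obtain p where
    "\<And>d c. (d, c) \<in> \<M> \<Longrightarrow> is_pregroupoid \<C> ((d, c), p (d, c))"
    "\<And>d c d' c' f f0 f1. (d, c) \<in> \<M> \<Longrightarrow> (d', c') \<in> \<M> \<Longrightarrow>
      (f, f0, f1) \<in> span_homs \<C> (d, c) (d', c') \<Longrightarrow>
      f \<cdot> p (d, c) = p (d', c') \<cdot> kpc_map \<C> (d, c) (d', c') f"
    unfolding natural_pregroupoid_condition_iff by blast
  then have "natural_pregroupoids \<C> \<M> p"
    by unfold_locales
  then show thesis by (rule that)
qed

end

section \<open>The equivalence\<close>

theorem theorem3:
  fixes \<C> :: "('o, 'm) lim_cat" and \<M> :: "('m \<times> 'm) set"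
  assumes "category \<C>"
    and "chosen_limits \<C>"
    and "pullbacks_of_split_epis_along_split_epis \<C>"
    and "class_of_spans \<C> \<M>"
    and "box_defined \<C> \<M>"
    and "closed_under_kernel_pair_construction \<C> \<M>"
    and "contains_local_products \<C> \<M>"
  shows "all_equivalent
    [lawvere_condition \<C> \<M>,
     has_section (Grpd \<C> \<M>) (RG \<C> \<M>) forgetful,
     is_cat_iso (Cat \<C> \<M>) (RG \<C> \<M>) forgetful,
     has_section (Cat \<C> \<M>) (RG \<C> \<M>) forgetful,
     is_cat_iso (MG \<C> \<M>) (RG \<C> \<M>) forgetful,
     has_section (MG \<C> \<M>) (RG \<C> \<M>) forgetful,
     relation_condition \<C> \<M>,
     kite_condition \<C> \<M>,
     has_section (PseudoGrpd \<C> \<M>) (Span \<C> \<M>) forgetful \<and> split_square_condition \<C> \<M>,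
     natural_pregroupoid_condition \<C> \<M>,
     is_cat_iso (PreGrpd \<C> \<M>) (Span \<C> \<M>) forgetful,
     has_section (KockGrpd \<C> \<M>) (Span \<C> \<M>) forgetful,
     is_cat_iso (KockGrpd \<C> \<M>) (Span \<C> \<M>) forgetful,
     has_section (MKite \<C> \<M>) (DiKite \<C> \<M>) forgetful,
     is_cat_iso (MKite \<C> \<M>) (DiKite \<C> \<M>) forgetful]"
proof -
  interpret span_class \<C> \<M>
    using assms
    by (intro span_class.intro split_pullback_category.intro span_class_axioms.intro
        split_pullback_category_axioms.intro)
  let ?J = "natural_pregroupoid_condition \<C> \<M>"
  have from_J: "lawvere_condition \<C> \<M>" "is_cat_iso (Cat \<C> \<M>) (RG \<C> \<M>) forgetful"
    "is_cat_iso (MG \<C> \<M>) (RG \<C> \<M>) forgetful" "relation_condition \<C> \<M>" "kite_condition \<C> \<M>"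
    "has_section (PseudoGrpd \<C> \<M>) (Span \<C> \<M>) forgetful \<and> split_square_condition \<C> \<M>"
    "is_cat_iso (PreGrpd \<C> \<M>) (Span \<C> \<M>) forgetful" "is_cat_iso (KockGrpd \<C> \<M>) (Span \<C> \<M>) forgetful"
    "is_cat_iso (MKite \<C> \<M>) (DiKite \<C> \<M>) forgetful"
    if J: ?J
  proof -
    obtain p where "natural_pregroupoids \<C> \<M> p" using J by (rule natural_pregroupoidsE)
    then interpret natural_pregroupoids \<C> \<M> p .
    show "lawvere_condition \<C> \<M>" unfolding lawvere_condition_def by (rule is_cat_iso_Grpd)
    show "has_section (PseudoGrpd \<C> \<M>) (Span \<C> \<M>) forgetful \<and> split_square_condition \<C> \<M>"
      using has_section_PseudoGrpd[OF assms(5)]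
        split_square_condition_if_kite_condition[OF kite_condition_holds] by blast
    show "is_cat_iso (Cat \<C> \<M>) (RG \<C> \<M>) forgetful"
      "is_cat_iso (MG \<C> \<M>) (RG \<C> \<M>) forgetful"
      "relation_condition \<C> \<M>" "kite_condition \<C> \<M>"
      "is_cat_iso (PreGrpd \<C> \<M>) (Span \<C> \<M>) forgetful"
      "is_cat_iso (KockGrpd \<C> \<M>) (Span \<C> \<M>) forgetful"
      "is_cat_iso (MKite \<C> \<M>) (DiKite \<C> \<M>) forgetful"
      by (fact is_cat_iso_Cat is_cat_iso_MG relation_condition_holds kite_condition_holds
          is_cat_iso_PreGrpd is_cat_iso_KockGrpd is_cat_iso_MKite)+
  qed
  note J_MG = natural_pregroupoid_condition_if_section_MG[OF assms(6)]
  note J_Cat = J_MG[OF has_section_MG_if_section_Cat]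
    and J_Grpd = J_MG[OF has_section_MG_if_section_Grpd]
  note iso_sec = has_section_if_is_cat_iso
  have "lawvere_condition \<C> \<M> \<longleftrightarrow> ?J"
    "has_section (Grpd \<C> \<M>) (RG \<C> \<M>) forgetful \<longleftrightarrow> ?J"
    unfolding lawvere_condition_def
    using from_J(1)[unfolded lawvere_condition_def] iso_sec J_Grpd by blast+
  moreover have "is_cat_iso (Cat \<C> \<M>) (RG \<C> \<M>) forgetful \<longleftrightarrow> ?J"
    "has_section (Cat \<C> \<M>) (RG \<C> \<M>) forgetful \<longleftrightarrow> ?J"
    using from_J(2) iso_sec J_Cat by blast+
  moreover have "is_cat_iso (MG \<C> \<M>) (RG \<C> \<M>) forgetful \<longleftrightarrow> ?J"
    "has_section (MG \<C> \<M>) (RG \<C> \<M>) forgetful \<longleftrightarrow> ?J"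
    using from_J(3) iso_sec J_MG by blast+
  moreover have "relation_condition \<C> \<M> \<longleftrightarrow> ?J" "kite_condition \<C> \<M> \<longleftrightarrow> ?J"
    using from_J(4,5) natural_pregroupoid_condition_if_kite_condition
      kite_condition_if_relation_condition by blast+
  moreover have "has_section (PseudoGrpd \<C> \<M>) (Span \<C> \<M>) forgetful \<and>
      split_square_condition \<C> \<M> \<longleftrightarrow> ?J"
    using from_J(6) natural_pregroupoid_condition_if_split_square_condition by blast
  moreover have "is_cat_iso (PreGrpd \<C> \<M>) (Span \<C> \<M>) forgetful \<longleftrightarrow> ?J"
    using from_J(7) iso_sec natural_pregroupoid_condition_if_section_PreGrpd by blast
  moreover have "is_cat_iso (KockGrpd \<C> \<M>) (Span \<C> \<M>) forgetful \<longleftrightarrow> ?J"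
    "has_section (KockGrpd \<C> \<M>) (Span \<C> \<M>) forgetful \<longleftrightarrow> ?J"
    using from_J(8) iso_sec natural_pregroupoid_condition_if_section_KockGrpd by blast+
  moreover have "is_cat_iso (MKite \<C> \<M>) (DiKite \<C> \<M>) forgetful \<longleftrightarrow> ?J"
    "has_section (MKite \<C> \<M>) (DiKite \<C> \<M>) forgetful \<longleftrightarrow> ?J"
    using from_J(9) iso_sec natural_pregroupoid_condition_if_section_MKite by blast+
  ultimately show ?thesis
    by (simp add: all_equivalent_def)
qed

end
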